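(* Let $X$, $U$, $I=[0,b]$, $A(t)=A+\widetilde B(t)$, $S_0$, $S$, $C$, $B$, $F$ be as in the context, and let $x_0,y_0\in X$. Assume: (1) $aR(a,\Upsilon_0^b)\to 0$ as $a\to 0^+$ in the strong operator topology; (2) $S_0(t)$ is compact for every $t>0$; (3) for each $r>0$ there exists $L_{f,r}\in L^1(I,\mathbb{R}^+)$ such that for every $x\in\mathcal{C}$ with $\|x\|_{\mathcal{C}}\le r$ one has $\sup\{\|f\|: f\in F(t,x(t))\}\le L_{f,r}(t)$ for a.e. $t\in I$; (4) there exists $\gamma>0$ such that $\lim_{r\to\infty}\frac{1}{r}\int_0^b L_{f,r}(s)\,ds=\gamma<+\infty$. Assume additionally that there exists $N\in L^1(I,[0,\infty))$ such that $\sup_{x\in X}\|F(t,x)\|\le N(t)$ for a.e. $t\in I$, where $\|F(t,x)\|=\sup\{\|f\|:f\in F(t,x)\}$. Then the differential inclusion $$x''(t)\in A(t)x(t)+F(t,x(t))+Bu(t),\ t\in I,\qquad x(0)=x_0,\quad x'(0)=y_0,$$ is approximately controllable on $I$.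
   Context: $X$ and $U$ are Hilbert spaces, $b>0$, $I=[0,b]$, $\mathcal{C}=C(I,X)$ with the sup norm $\|x\|_{\mathcal{C}}=\sup_{t\in I}\|x(t)\|$; $\mathcal{L}(Y,Z)$ denotes bounded linear operators, $\mathcal{L}(X)=\mathcal{L}(X,X)$. $B\in\mathcal{L}(U,X)$; controls $u$ belong to $L^2(I,U)$. Operators. $A:D(A)\subseteq X\to X$ generates a strongly continuous cosine family $(C_0(t))_{t\in\mathbb{R}}$ on $X$, with sine family $S_0(t)x=\int_0^tC_0(s)x\,ds$. $E$ is the space of $x\in X$ for which $t\mapsto C_0(t)x$ is of class $C^1$ on $\mathbb{R}$, with norm $\|x\|_E=\|x\|+\sup_{0\le t\le1}\|AS_0(t)x\|$. $A(t)=A+\widetilde B(t)$, where $\widetilde B:\mathbb{R}\to\mathcal{L}(E,X)$ is such that $t\mapsto\widetilde B(t)x$ is continuously differentiable in $X$ for each $x\in E$; $D=D(A(t))=D(A)$ is dense and independent of $t$, and $A(t)$ is closed. $S(t,s)\in\mathcal{L}(X)$, $t,s\in I$, is the associated evolution operator: for $y\in E$, $t\mapsto S(t,s)y$ is the unique solution of $x(t)=S_0(t-s)y+\int_s^tS_0(t-\tau)\widetilde B(\tau)x(\tau)\,d\tau$, and $S(t,s)$ is extended to $X$ by density. It is an evolution operator for $x''=A(t)x$ in the following sense: (Z1) for each $x\in X$, $(t,s)\mapsto S(t,s)x$ is of class $C^1$ on $I\times I$, $S(t,t)=0$, $\frac{\partial}{\partial t}S(t,s)x|_{t=s}=x$,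 $\frac{\partial}{\partial s}S(t,s)x|_{t=s}=-x$; (Z2) if $x\in D$ then $S(t,s)x\in D$, $(t,s)\mapsto S(t,s)x$ is of class $C^2$, $\frac{\partial^2}{\partial t^2}S(t,s)x=A(t)S(t,s)x$, $\frac{\partial^2}{\partial s^2}S(t,s)x=S(t,s)A(s)x$, $\frac{\partial}{\partial s}\frac{\partial}{\partial t}S(t,s)x|_{t=s}=0$; (Z3) if $x\in D$ then $\frac{\partial}{\partial s}S(t,s)x\in D$, the following derivatives exist, $\frac{\partial^2}{\partial t^2}\frac{\partial}{\partial s}S(t,s)x=A(t)\frac{\partial}{\partial s}S(t,s)x$, $\frac{\partial^2}{\partial s^2}\frac{\partial}{\partial t}S(t,s)x=\frac{\partial}{\partial t}S(t,s)A(s)x$, and $(t,s)\mapsto A(t)\frac{\partial}{\partial s}S(t,s)x$ is continuous. Put $C(t,s)=-\frac{\partial S(t,s)}{\partial s}$. Multivalued map. $F:I\times X\to 2^X\setminus\{\emptyset\}$ has bounded, closed, convex values, is measurable in $t$ for each fixed $x\in X$, upper semicontinuous in $x$ for each $t\in I$, and for each $x\in\mathcal{C}$ the set $S_{F,x}=\{f\in L^1(I,X): f(t)\in F(t,x(t))\text{ for } t\in I\}$ is nonempty. (A map $G$ is upper semicontinuous if each $G(x_0)$ is nonempty closed and for each open $V\supseteq G(x_0)$ there is a neighbourhood $W$ of $x_0$ with $G(W)\subseteq V$.) $\Upsilon_0^b=\int_0^bS(b,s)BB^*S^*(b,s)\,ds\in\mathcal{L}(X)$ and $R(a,\Upsilon_0^b)=(aI+\Upsilon_0^b)^{-1}$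 for $a>0$, where here $I$ is the identity operator and $S^*(b,s)$ is the adjoint of $S(b,s)$. Mild solution. For given $u\in L^2(I,U)$, $x\in\mathcal{C}$ is a mild solution if there is $f\in S_{F,x}$ with $x(t)=C(t,0)x_0+S(t,0)y_0+\int_0^tS(t,s)f(s)\,ds+\int_0^tS(t,s)Bu(s)\,ds$ for $t\in I$ (the initial conditions $x(0)=x_0$, $x'(0)=y_0$ being imposed through this equation). Approximate controllability on $I$: $\overline{R(b)}=X$, where $R(b)=\{x(b;u): u\in L^2(I,U),\ x(\cdot;u)\text{ a mild solution of the system with control }u\}$. *)

theory Defs
  imports "HOL-Analysis.Analysis"
begin

text \<open>
  Hilbert spaces are types of sort \<open>{real_inner, banach}\<close>; no separability is assumed.
  The Bochner integral of HOL-Analysis is restricted to second countable spaces, so strong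
  measurability and the spaces \<open>L\<^sup>1\<close>, \<open>L\<^sup>2\<close> are defined here for arbitrary
  normed spaces. Vector-valued integrals are written with the Henstock-Kurzweil integral, which
  is available for every normed space and agrees with the Bochner integral for each
  Bochner integrable function on a compact interval.
\<close>

subsection \<open>Strong measurability, Lebesgue spaces, integrals\<close>

definition strongly_measurable_on :: "real set \<Rightarrow> (real \<Rightarrow> 'a::real_normed_vector) \<Rightarrow> bool" where
  "strongly_measurable_on S f \<longleftrightarrow>
     (\<exists>s. (\<forall>n::nat. simple_function (lebesgue_on S) (s n)) \<and>
          (AE t in lebesgue_on S. (\<lambda>n. s n t) \<longlonglongrightarrow> f t))"

definition L1_on :: "real set \<Rightarrow> (real \<Rightarrow> 'a::real_normed_vector) set" where
  "L1_on S = {f. strongly_measurable_on S f \<and> integrable (lebesgue_on S) (\<lambda>t. norm (f t))}"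

definition L2_on :: "real set \<Rightarrow> (real \<Rightarrow> 'a::real_normed_vector) set" where
  "L2_on S = {f. strongly_measurable_on S f \<and> integrable (lebesgue_on S) (\<lambda>t. (norm (f t))\<^sup>2)}"

text \<open>The library integral over \<open>{s..t}\<close> vanishes for \<open>t < s\<close>, hence a signed version.\<close>

definition signed_integral :: "real \<Rightarrow> real \<Rightarrow> (real \<Rightarrow> 'a::real_normed_vector) \<Rightarrow> 'a" where
  "signed_integral s t f = (if s \<le> t then integral {s..t} f else - integral {t..s} f)"

definition compact_operator :: "('a::real_normed_vector \<Rightarrow> 'b::real_normed_vector) \<Rightarrow> bool" where
  "compact_operator T \<longleftrightarrow> bounded_linear T \<and> (\<forall>M. bounded M \<longrightarrow> compact (closure (T ` M)))"


subsection \<open>Partial derivatives and smoothness on the square \<open>J \<times> J\<close>\<close>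

text \<open>At the boundary of \<open>J\<close> the derivatives are one-sided.\<close>

definition pd1 :: "real set \<Rightarrow> (real \<Rightarrow> real \<Rightarrow> 'a::real_normed_vector) \<Rightarrow> real \<Rightarrow> real \<Rightarrow> 'a" where
  "pd1 J g t s = vector_derivative (\<lambda>\<tau>. g \<tau> s) (at t within J)"

definition pd2 :: "real set \<Rightarrow> (real \<Rightarrow> real \<Rightarrow> 'a::real_normed_vector) \<Rightarrow> real \<Rightarrow> real \<Rightarrow> 'a" where
  "pd2 J g t s = vector_derivative (\<lambda>\<sigma>. g t \<sigma>) (at s within J)"

definition class_C1 :: "real set \<Rightarrow> (real \<Rightarrow> real \<Rightarrow> 'a::real_normed_vector) \<Rightarrow> bool" where
  "class_C1 J g \<longleftrightarrow>
     (\<forall>t\<in>J. \<forall>s\<in>J. (\<lambda>\<tau>. g \<tau> s) differentiable (at t within J) \<and>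
                    (\<lambda>\<sigma>. g t \<sigma>) differentiable (at s within J)) \<and>
     continuous_on (J \<times> J) (\<lambda>(t, s). pd1 J g t s) \<and>
     continuous_on (J \<times> J) (\<lambda>(t, s). pd2 J g t s)"

definition class_C2 :: "real set \<Rightarrow> (real \<Rightarrow> real \<Rightarrow> 'a::real_normed_vector) \<Rightarrow> bool" where
  "class_C2 J g \<longleftrightarrow> class_C1 J g \<and> class_C1 J (pd1 J g) \<and> class_C1 J (pd2 J g)"


subsection \<open>Cosine families\<close>

definition cosine_family :: "(real \<Rightarrow> 'a::banach \<Rightarrow>\<^sub>L 'a) \<Rightarrow> bool" where
  "cosine_family C0 \<longleftrightarrow>
     C0 0 = id_blinfun \<and>
     (\<forall>t s. C0 (t + s) + C0 (t - s) = 2 *\<^sub>R (C0 t o\<^sub>L C0 s)) \<and>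
     (\<forall>x. continuous_on UNIV (\<lambda>t. C0 t x))"

definition sine_family :: "(real \<Rightarrow> 'a::banach \<Rightarrow>\<^sub>L 'a) \<Rightarrow> real \<Rightarrow> 'a \<Rightarrow> 'a" where
  "sine_family C0 t x = signed_integral 0 t (\<lambda>s. C0 s x)"

text \<open>An unbounded operator is a total function \<open>A\<close> together with its domain \<open>D\<close>; the values of
  \<open>A\<close> outside \<open>D\<close> play no role. Here \<open>D\<close> is the set of \<open>x\<close> for which \<open>t \<mapsto> C\<^sub>0(t)x\<close> is of
  class \<open>C\<^sup>2\<close>, and \<open>Ax\<close> is the second derivative at \<open>0\<close>.\<close>

definition generates_cosine ::
    "('a \<Rightarrow> 'a) \<Rightarrow> 'a set \<Rightarrow> (real \<Rightarrow> 'a::banach \<Rightarrow>\<^sub>L 'a) \<Rightarrow> bool" where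
  "generates_cosine A D C0 \<longleftrightarrow>
     cosine_family C0 \<and>
     D = {x. \<exists>v. (\<forall>t. ((\<lambda>t. C0 t x) has_vector_derivative v t) (at t)) \<and>
                 v C1_differentiable_on UNIV} \<and>
     (\<forall>x\<in>D. ((\<lambda>t. vector_derivative (\<lambda>s. C0 s x) (at t)) has_vector_derivative A x) (at 0))"

definition E_space :: "(real \<Rightarrow> 'a::banach \<Rightarrow>\<^sub>L 'a) \<Rightarrow> 'a set" where
  "E_space C0 = {x. (\<lambda>t. C0 t x) C1_differentiable_on UNIV}"

definition E_norm :: "('a \<Rightarrow> 'a) \<Rightarrow> (real \<Rightarrow> 'a::banach \<Rightarrow>\<^sub>L 'a) \<Rightarrow> 'a \<Rightarrow> real" where
  "E_norm A C0 x = norm x + (SUP t\<in>{0..1}. norm (A (sine_family C0 t x)))"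


subsection \<open>The perturbation and the evolution operator\<close>

definition bounded_linear_from_E ::
    "('a \<Rightarrow> 'a) \<Rightarrow> (real \<Rightarrow> 'a::banach \<Rightarrow>\<^sub>L 'a) \<Rightarrow> ('a \<Rightarrow> 'a) \<Rightarrow> bool" where
  "bounded_linear_from_E A C0 P \<longleftrightarrow>
     (\<forall>x\<in>E_space C0. \<forall>y\<in>E_space C0. P (x + y) = P x + P y) \<and>
     (\<forall>c. \<forall>x\<in>E_space C0. P (c *\<^sub>R x) = c *\<^sub>R P x) \<and>
     (\<exists>K. \<forall>x\<in>E_space C0. norm (P x) \<le> K * E_norm A C0 x)"

definition admissible_perturbation ::
    "('a \<Rightarrow> 'a) \<Rightarrow> (real \<Rightarrow> 'a::banach \<Rightarrow>\<^sub>L 'a) \<Rightarrow> (real \<Rightarrow> 'a \<Rightarrow> 'a) \<Rightarrow> bool" where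
  "admissible_perturbation A C0 Bt \<longleftrightarrow>
     (\<forall>t. bounded_linear_from_E A C0 (Bt t)) \<and>
     (\<forall>x\<in>E_space C0. (\<lambda>t. Bt t x) C1_differentiable_on UNIV)"

text \<open>The operators \<open>A(t) = A + Bt(t)\<close>, with domain \<open>D \<subseteq> E\<close>.\<close>

definition A_pert :: "('a::real_vector \<Rightarrow> 'a) \<Rightarrow> (real \<Rightarrow> 'a \<Rightarrow> 'a) \<Rightarrow> real \<Rightarrow> 'a \<Rightarrow> 'a" where
  "A_pert A Bt t x = A x + Bt t x"

definition closed_operator :: "'a set \<Rightarrow> ('a::real_normed_vector \<Rightarrow> 'a) \<Rightarrow> bool" where
  "closed_operator D T \<longleftrightarrow> closed {(x, T x) | x. x \<in> D}"

text \<open>Solutions on \<open>J\<close> of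
  \<open>x(t) = S\<^sub>0(t - s)y + \<integral>\<^sub>s\<^sup>t S\<^sub>0(t - \<tau>) Bt(\<tau>) x(\<tau>) d\<tau>\<close>
  are sought among the functions that are continuous from \<open>J\<close> to \<open>E\<close> with the norm of \<open>E\<close>, so that
  the integrand is continuous.\<close>

definition perturbed_solution ::
    "real set \<Rightarrow> ('a \<Rightarrow> 'a) \<Rightarrow> (real \<Rightarrow> 'a::banach \<Rightarrow>\<^sub>L 'a) \<Rightarrow> (real \<Rightarrow> 'a \<Rightarrow> 'a) \<Rightarrow>
       real \<Rightarrow> 'a \<Rightarrow> (real \<Rightarrow> 'a) \<Rightarrow> bool" where
  "perturbed_solution J A C0 Bt s y x \<longleftrightarrow>
     (\<forall>t\<in>J. x t \<in> E_space C0) \<and>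
     (\<forall>t\<in>J. ((\<lambda>\<tau>. E_norm A C0 (x \<tau> - x t)) \<longlongrightarrow> 0) (at t within J)) \<and>
     (\<forall>t\<in>J. x t = sine_family C0 (t - s) y +
              signed_integral s t (\<lambda>\<tau>. sine_family C0 (t - \<tau>) (Bt \<tau> (x \<tau>))))"

text \<open>Since \<open>E\<close> is dense, a bounded operator on the whole space is determined by its values
  on \<open>E\<close>; this is the extension by density.\<close>

definition associated_evolution ::
    "real set \<Rightarrow> ('a \<Rightarrow> 'a) \<Rightarrow> (real \<Rightarrow> 'a::banach \<Rightarrow>\<^sub>L 'a) \<Rightarrow> (real \<Rightarrow> 'a \<Rightarrow> 'a) \<Rightarrow>
       (real \<Rightarrow> real \<Rightarrow> 'a \<Rightarrow>\<^sub>L 'a) \<Rightarrow> bool" where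
  "associated_evolution J A C0 Bt S \<longleftrightarrow>
     (\<forall>s\<in>J. \<forall>y\<in>E_space C0.
        perturbed_solution J A C0 Bt s y (\<lambda>t. S t s y) \<and>
        (\<forall>x. perturbed_solution J A C0 Bt s y x \<longrightarrow> (\<forall>t\<in>J. x t = S t s y)))"

definition evolution_Z1 :: "real set \<Rightarrow> (real \<Rightarrow> real \<Rightarrow> 'a::banach \<Rightarrow>\<^sub>L 'a) \<Rightarrow> bool" where
  "evolution_Z1 J S \<longleftrightarrow>
     (\<forall>x. class_C1 J (\<lambda>t s. S t s x)) \<and>
     (\<forall>t\<in>J. S t t = 0) \<and>
     (\<forall>x. \<forall>t\<in>J. pd1 J (\<lambda>t s. S t s x) t t = x \<and> pd2 J (\<lambda>t s. S t s x) t t = - x)"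

definition evolution_Z2 ::
    "real set \<Rightarrow> 'a set \<Rightarrow> (real \<Rightarrow> 'a \<Rightarrow> 'a) \<Rightarrow> (real \<Rightarrow> real \<Rightarrow> 'a::banach \<Rightarrow>\<^sub>L 'a) \<Rightarrow> bool" where
  "evolution_Z2 J D At S \<longleftrightarrow>
     (\<forall>x\<in>D.
        (\<forall>t\<in>J. \<forall>s\<in>J. S t s x \<in> D) \<and>
        class_C2 J (\<lambda>t s. S t s x) \<and>
        (\<forall>t\<in>J. \<forall>s\<in>J.
           pd1 J (pd1 J (\<lambda>t s. S t s x)) t s = At t (S t s x) \<and>
           pd2 J (pd2 J (\<lambda>t s. S t s x)) t s = S t s (At s x)) \<and>
        (\<forall>t\<in>J. pd2 J (pd1 J (\<lambda>t s. S t s x)) t t = 0))"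

text \<open>In the third condition the first-order derivatives \<open>\<partial>\<^sub>t\<partial>\<^sub>sS\<close> and \<open>\<partial>\<^sub>s\<partial>\<^sub>tS\<close> exist by the
  second condition; \<open>has_vector_derivative\<close> asserts the existence of the next ones.\<close>

definition evolution_Z3 ::
    "real set \<Rightarrow> 'a set \<Rightarrow> (real \<Rightarrow> 'a \<Rightarrow> 'a) \<Rightarrow> (real \<Rightarrow> real \<Rightarrow> 'a::banach \<Rightarrow>\<^sub>L 'a) \<Rightarrow> bool" where
  "evolution_Z3 J D At S \<longleftrightarrow>
     (\<forall>x\<in>D.
        (\<forall>t\<in>J. \<forall>s\<in>J. pd2 J (\<lambda>t s. S t s x) t s \<in> D) \<and>
        (\<forall>t\<in>J. \<forall>s\<in>J.
           ((\<lambda>\<tau>. pd1 J (pd2 J (\<lambda>t s. S t s x)) \<tau> s) has_vector_derivative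
              At t (pd2 J (\<lambda>t s. S t s x) t s)) (at t within J) \<and>
           ((\<lambda>\<sigma>. pd2 J (pd1 J (\<lambda>t s. S t s x)) t \<sigma>) has_vector_derivative
              pd1 J (\<lambda>\<tau> \<sigma>. S \<tau> \<sigma> (At s x)) t s) (at s within J)) \<and>
        continuous_on (J \<times> J) (\<lambda>(t, s). At t (pd2 J (\<lambda>t s. S t s x) t s)))"

definition C_evol ::
    "real set \<Rightarrow> (real \<Rightarrow> real \<Rightarrow> 'a::banach \<Rightarrow>\<^sub>L 'a) \<Rightarrow> real \<Rightarrow> real \<Rightarrow> 'a \<Rightarrow> 'a" where
  "C_evol J S t s x = - pd2 J (\<lambda>t s. S t s x) t s"


subsection \<open>Multivalued maps\<close>

text \<open>Measurability of \<open>G\<close> means measurability of all distance functions \<open>t \<mapsto> d(y, G(t))\<close>. For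
  separable spaces this is the same as measurability of \<open>{t. G(t) \<inter> V \<noteq> {}}\<close> for all open \<open>V\<close>; in
  general the latter implies it.\<close>

definition measurable_multimap :: "real set \<Rightarrow> (real \<Rightarrow> 'a::metric_space set) \<Rightarrow> bool" where
  "measurable_multimap J G \<longleftrightarrow> (\<forall>y. (\<lambda>t. infdist y (G t)) \<in> borel_measurable (lebesgue_on J))"

definition usc_multimap :: "('a::topological_space \<Rightarrow> 'b::topological_space set) \<Rightarrow> bool" where
  "usc_multimap G \<longleftrightarrow>
     (\<forall>x0. G x0 \<noteq> {} \<and> closed (G x0) \<and>
        (\<forall>V. open V \<and> G x0 \<subseteq> V \<longrightarrow> (\<exists>W. open W \<and> x0 \<in> W \<and> (\<Union>x\<in>W. G x) \<subseteq> V)))"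

definition selections ::
    "real set \<Rightarrow> (real \<Rightarrow> 'a \<Rightarrow> 'a set) \<Rightarrow> (real \<Rightarrow> 'a::real_normed_vector) \<Rightarrow> (real \<Rightarrow> 'a) set" where
  "selections J F x = {f \<in> L1_on J. \<forall>t\<in>J. f t \<in> F t (x t)}"

definition admissible_multimap ::
    "real set \<Rightarrow> (real \<Rightarrow> 'a \<Rightarrow> 'a::real_normed_vector set) \<Rightarrow> bool" where
  "admissible_multimap J F \<longleftrightarrow>
     (\<forall>t\<in>J. \<forall>x. F t x \<noteq> {} \<and> bounded (F t x) \<and> closed (F t x) \<and> convex (F t x)) \<and>
     (\<forall>x. measurable_multimap J (\<lambda>t. F t x)) \<and>
     (\<forall>t\<in>J. usc_multimap (F t)) \<and>
     (\<forall>x. continuous_on J x \<longrightarrow> selections J F x \<noteq> {})"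


subsection \<open>Controllability\<close>

definition Gramian ::
    "real \<Rightarrow> (real \<Rightarrow> real \<Rightarrow> 'a::{real_inner,banach} \<Rightarrow>\<^sub>L 'a) \<Rightarrow> ('u::{real_inner,banach} \<Rightarrow>\<^sub>L 'a) \<Rightarrow>
       'a \<Rightarrow> 'a" where
  "Gramian b S B x =
     integral {0..b} (\<lambda>s. S b s (B (adjoint (blinfun_apply B) (adjoint (blinfun_apply (S b s)) x))))"

definition resolvent_op :: "real \<Rightarrow> ('a::real_vector \<Rightarrow> 'a) \<Rightarrow> 'a \<Rightarrow> 'a" where
  "resolvent_op a G = inv (\<lambda>x. a *\<^sub>R x + G x)"

definition mild_solution ::
    "real \<Rightarrow> (real \<Rightarrow> real \<Rightarrow> 'a::{real_inner,banach} \<Rightarrow>\<^sub>L 'a) \<Rightarrow> ('u::{real_inner,banach} \<Rightarrow>\<^sub>L 'a) \<Rightarrow>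
       (real \<Rightarrow> 'a \<Rightarrow> 'a set) \<Rightarrow> 'a \<Rightarrow> 'a \<Rightarrow> (real \<Rightarrow> 'u) \<Rightarrow> (real \<Rightarrow> 'a) \<Rightarrow> bool" where
  "mild_solution b S B F x0 y0 u x \<longleftrightarrow>
     continuous_on {0..b} x \<and>
     (\<exists>f\<in>selections {0..b} F x. \<forall>t\<in>{0..b}.
        x t = C_evol {0..b} S t 0 x0 + S t 0 y0
              + integral {0..t} (\<lambda>s. S t s (f s))
              + integral {0..t} (\<lambda>s. S t s (B (u s))))"

definition reachable_set ::
    "real \<Rightarrow> (real \<Rightarrow> real \<Rightarrow> 'a::{real_inner,banach} \<Rightarrow>\<^sub>L 'a) \<Rightarrow> ('u::{real_inner,banach} \<Rightarrow>\<^sub>L 'a) \<Rightarrow>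
       (real \<Rightarrow> 'a \<Rightarrow> 'a set) \<Rightarrow> 'a \<Rightarrow> 'a \<Rightarrow> 'a set" where
  "reachable_set b S B F x0 y0 =
     {x b | x u. u \<in> L2_on {0..b} \<and> mild_solution b S B F x0 y0 u x}"

definition approximately_controllable ::
    "real \<Rightarrow> (real \<Rightarrow> real \<Rightarrow> 'a::{real_inner,banach} \<Rightarrow>\<^sub>L 'a) \<Rightarrow> ('u::{real_inner,banach} \<Rightarrow>\<^sub>L 'a) \<Rightarrow>
       (real \<Rightarrow> 'a \<Rightarrow> 'a set) \<Rightarrow> 'a \<Rightarrow> 'a \<Rightarrow> bool" where
  "approximately_controllable b S B F x0 y0 \<longleftrightarrow> closure (reachable_set b S B F x0 y0) = UNIV"

end

theory Submission
  imports Defs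
begin

text \<open>
  Fix \<open>a > 0\<close> and a target. For a forcing term \<open>f\<close> let the defect \<open>p(f)\<close> be what separates the target
  from the uncontrolled final state, and use the control \<open>B\<^sup>* S(b,s)\<^sup>* R(a) p(f)\<close>. Since the Gramian \<open>\<Upsilon>\<close>
  is the effect of such controls at time \<open>b\<close>, the resulting trajectory \<open>T f\<close> ends at
  \<open>target - a R(a) p(f)\<close>. The values \<open>f\<close> of the inclusion are dominated by the integrable function
  \<open>N\<close>, so all \<open>p(f)\<close> lie in one set that does not depend on \<open>a\<close> and, by compactness of \<open>S(b,s)\<close>,
  is totally bounded. As \<open>a R(a)\<close> has norm at most one and tends to zero strongly, it tends to zero
  uniformly on that set. It remains to find, for each \<open>a\<close>, some \<open>f\<close> with
  \<open>f(t) \<in> F(t, (T f)(t))\<close> almost everywhere.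

  This fixed point problem is solved in two steps. The trajectories lie in a convex totally bounded
  subset of \<open>C(I,X)\<close> (\<open>volterra_range_finite_cover\<close>). Choosing one selection for each continuous
  function and interpolating with a partition of unity, Brouwer's theorem (through Kuhn's
  combinatorial lemma, which treats the dimension as a number) gives approximate solutions
  (\<open>Cellina_approximate_fixed_point\<close>): \<open>f(t)\<close> is in the convex hull of values of \<open>F(t,\<cdot>)\<close> near
  \<open>(T f)(t)\<close>. A limit point \<open>x\<close> of their trajectories exists by compactness. The approximate solutions
  at scale \<open>1/k\<close> around \<open>x\<close> form decreasing convex sets, and instead of weak compactness and
  Mazur's lemma in \<open>L\<^sup>1\<close> it suffices to take elements of almost least norm in the Hilbert space with
  weight \<open>1/(N+1)\<close>: by the parallelogram law they converge, in \<open>L\<^sup>1\<close> and almost everywhere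
  (\<open>nested_dominated_convex_sets\<close>). Since \<open>T\<close> is affine and continuous for the \<open>L\<^sup>1\<close> norm and
  \<open>F(t,\<cdot>)\<close> is upper semicontinuous with closed convex values, the limit is a solution.

  Compactness of \<open>S(t,s)\<close> comes from that of \<open>S\<^sub>0\<close>. The integral equation represents
  \<open>S(t,s)y\<close> by \<open>S\<^sub>0(t-s)y\<close> and an integral of \<open>S\<^sub>0(t-\<tau>)\<close> against \<open>Bt(\<tau>)S(\<tau>,s)y\<close>, which is compact
  in \<open>y\<close> as soon as the latter is bounded by a multiple of the norm of \<open>y\<close> in \<open>X\<close> (\<open>forcing_bound\<close>).
  That bound needs one uniform bound on all \<open>Bt(\<tau>)\<close>, hence the uniform boundedness principle on
  \<open>E\<close> and the completeness of \<open>E\<close>, and then a Gronwall estimate in the norm of \<open>E\<close>. Lipschitz continuity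
  of \<open>S\<close> in the operator norm follows from the \<open>C\<^sup>1\<close> property by uniform boundedness on \<open>X\<close>
  (\<open>evolution_lipschitz\<close>).
\<close>

section \<open>Adjoints and coercive operators on Hilbert spaces\<close>

text \<open>The functional \<open>x \<bullet> x / 2 - \<phi> x\<close> is bounded below; by the parallelogram law every minimising
  sequence is Cauchy, and the derivative vanishes at the minimiser.\<close>

lemma riesz_representation:
  fixes \<phi> :: "'a::{real_inner,banach} \<Rightarrow> real"
  assumes "bounded_linear \<phi>"
  shows "\<exists>y. \<forall>x. \<phi> x = x \<bullet> y"
proof -
  interpret bounded_linear \<phi> by fact
  define J where "J x = (x \<bullet> x) / 2 - \<phi> x" for x
  obtain K where K: "\<And>x. norm (\<phi> x) \<le> norm x * K" "K > 0"
    using pos_bounded by blast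
  have low: "J x \<ge> - K\<^sup>2 / 2" for x
  proof -
    have "\<phi> x \<le> norm x * K" using K(1)[of x] by simp
    moreover have "(norm x - K)\<^sup>2 \<ge> 0" by simp
    ultimately show ?thesis
      unfolding J_def dot_square_norm by (simp add: power2_diff algebra_simps)
  qed
  define m where "m = (INF x. J x)"
  have bdd: "bdd_below (range J)" using low by (intro bdd_belowI[of _ "- K\<^sup>2/2"]) auto
  have mle: "m \<le> J x" for x unfolding m_def using bdd by (intro cINF_lower) auto
  have "\<exists>x. J x < m + 1 / Suc n" for n
    using cINF_less_iff[OF _ bdd, of "m + 1 / Suc n"] unfolding m_def by auto
  then obtain s where s: "\<And>n::nat. J (s n) < m + 1 / Suc n" by metis
  have par: "(norm (x - y))\<^sup>2 = 4 * (J x + J y) - 8 * J ((1/2) *\<^sub>R (x + y))" for x y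
    unfolding J_def scale add power2_norm_eq_inner
    by (simp add: inner_simps inner_commute field_simps)
  have "Cauchy s"
  proof (rule metric_CauchyI)
    fix e :: real assume "e > 0"
    obtain M :: nat where M: "8 / (e\<^sup>2) < M" using reals_Archimedean2 by blast
    have "dist (s i) (s j) < e" if "i \<ge> M" "j \<ge> M" for i j
    proof -
      have b: "1 / Suc k < e\<^sup>2 / 8" if "k \<ge> M" for k
      proof -
        have "8 / e\<^sup>2 < Suc k" using M that by (smt (verit) of_nat_Suc of_nat_mono)
        then show ?thesis using \<open>e > 0\<close> by (simp add: field_simps del: of_nat_Suc)
      qed
      have "(norm (s i - s j))\<^sup>2 < 4 * (2 * m + e\<^sup>2/8 + e\<^sup>2/8) - 8 * m"
        unfolding par using s[of i] s[of j] mle[of "(1/2) *\<^sub>R (s i + s j)"] b that by (smt (verit))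
      then have "(norm (s i - s j))\<^sup>2 < e\<^sup>2" by simp
      then show ?thesis using \<open>e > 0\<close> by (simp add: dist_norm power2_less_imp_less)
    qed
    then show "\<exists>M. \<forall>m\<ge>M. \<forall>n\<ge>M. dist (s m) (s n) < e" by blast
  qed
  then obtain y where y: "s \<longlonglongrightarrow> y" using Cauchy_convergent_iff convergent_def by blast
  have "(\<lambda>n. J (s n)) \<longlonglongrightarrow> J y"
    unfolding J_def by (intro tendsto_intros y tendsto) auto
  moreover have "(\<lambda>n. m + 1 / Suc n) \<longlonglongrightarrow> m + 0"
    by (intro tendsto_intros LIMSEQ_Suc[OF lim_1_over_n])
  ultimately have Jy: "J y \<le> m" using s LIMSEQ_le[of "\<lambda>n. J (s n)" "J y" "\<lambda>n. m + 1 / Suc n" "m+0"]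
    by (metis (no_types, lifting) add.right_neutral less_eq_real_def)
  have "\<phi> x = x \<bullet> y" for x
  proof (rule ccontr)
    define d where "d = \<phi> x - x \<bullet> y"
    assume "\<phi> x \<noteq> x \<bullet> y" then have d: "d \<noteq> 0" unfolding d_def by simp
    then have x: "x \<bullet> x > 0" unfolding d_def by (metis inner_gt_zero_iff diff_self inner_zero_left zero)
    define t where "t = d / (x \<bullet> x)"
    have "J (y + t *\<^sub>R x) = J y - t * d + t\<^sup>2 * (x \<bullet> x) / 2"
      unfolding J_def d_def add scale by (simp add: inner_simps inner_commute power2_eq_square algebra_simps)
    also have "\<dots> = J y - d\<^sup>2 / (2 * (x \<bullet> x))"
      unfolding t_def using x by (simp add: field_simps power2_eq_square)
    also have "\<dots> < J y" using d x by simp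
    finally show False using Jy mle[of "y + t *\<^sub>R x"] by linarith
  qed
  then show ?thesis by blast
qed

text \<open>Riesz representation provides a function with the defining property, so the choice made in
  \<^const>\<open>adjoint\<close> has it.\<close>

lemma adjoint_blinfun_inner:
  fixes T :: "'a::{real_inner,banach} \<Rightarrow>\<^sub>L 'b::real_inner"
  shows "T x \<bullet> y = x \<bullet> adjoint (blinfun_apply T) y"
proof -
  have "\<exists>z. \<forall>x. T x \<bullet> y = x \<bullet> z" for y
    by (rule riesz_representation)
      (intro bounded_linear_compose[OF bounded_linear_inner_left] blinfun.bounded_linear_right)
  then have "\<exists>f'. \<forall>x y. T x \<bullet> y = x \<bullet> f' y" by metis
  then have "\<forall>x y. T x \<bullet> y = x \<bullet> adjoint (blinfun_apply T) y"
    unfolding adjoint_def by (rule someI_ex)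
  then show ?thesis by blast
qed

lemma adjoint_blinfun_unique:
  fixes T :: "'a::{real_inner,banach} \<Rightarrow>\<^sub>L 'b::real_inner"
  assumes "\<And>x. T x \<bullet> y = x \<bullet> z"
  shows "adjoint (blinfun_apply T) y = z"
proof -
  have "\<forall>x. x \<bullet> adjoint (blinfun_apply T) y = x \<bullet> z"
    using assms adjoint_blinfun_inner[of T _ y] by simp
  then show ?thesis by (simp only: vector_eq_ldot)
qed

lemma norm_adjoint_blinfun_le:
  fixes T :: "'a::{real_inner,banach} \<Rightarrow>\<^sub>L 'b::real_inner"
  shows "norm (adjoint (blinfun_apply T) y) \<le> norm T * norm y"
proof -
  let ?z = "adjoint (blinfun_apply T) y"
  have "norm ?z * norm ?z = T ?z \<bullet> y"
    unfolding adjoint_blinfun_inner by (simp add: dot_square_norm power2_eq_square)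
  also have "\<dots> \<le> norm (T ?z) * norm y" by (rule norm_cauchy_schwarz)
  also have "\<dots> \<le> (norm T * norm ?z) * norm y" by (intro mult_right_mono norm_blinfun) auto
  finally have "norm ?z * norm ?z \<le> (norm T * norm y) * norm ?z" by (simp add: mult_ac)
  then show ?thesis
    by (cases "?z = 0") (auto simp: mult_le_cancel_right)
qed

lemma bounded_linear_adjoint_blinfun:
  fixes T :: "'a::{real_inner,banach} \<Rightarrow>\<^sub>L 'b::real_inner"
  shows "bounded_linear (adjoint (blinfun_apply T))"
  by (rule bounded_linear_intro[where K = "norm T"])
    (auto intro!: adjoint_blinfun_unique norm_adjoint_blinfun_le
      simp: inner_add_right adjoint_blinfun_inner norm_adjoint_blinfun_le mult.commute[of "norm _" "norm T"])

lemma adjoint_blinfun_diff: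
  fixes S T :: "'a::{real_inner,banach} \<Rightarrow>\<^sub>L 'b::real_inner"
  shows "adjoint (blinfun_apply S) y - adjoint (blinfun_apply T) y = adjoint (blinfun_apply (S - T)) y"
  by (rule adjoint_blinfun_unique[symmetric])
    (simp add: blinfun.diff_left inner_diff_left inner_diff_right adjoint_blinfun_inner)

locale positive_operator =
  fixes G :: "'a::{real_inner,banach} \<Rightarrow>\<^sub>L 'a"
  assumes nonneg: "0 \<le> G x \<bullet> x"
begin

lemma shift_coercive: "a * (norm x)\<^sup>2 \<le> (a *\<^sub>R x + G x) \<bullet> x"
  using nonneg[of x] by (simp add: inner_add_left power2_norm_eq_inner)

lemma norm_shift_ge:
  assumes "a > 0"
  shows "a * norm x \<le> norm (a *\<^sub>R x + G x)"
proof (cases "x = 0")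
  case False
  have "a * norm x * norm x \<le> norm (a *\<^sub>R x + G x) * norm x"
    using shift_coercive[of a x] norm_cauchy_schwarz[of "a *\<^sub>R x + G x" x]
    by (simp add: power2_eq_square)
  then show ?thesis using False by simp
qed (simp add: blinfun.zero_right)

text \<open>Coercivity makes the iteration \<open>x \<mapsto> x - \<rho> (a x + G x - y)\<close> a contraction for small \<open>\<rho>\<close>, and its
  fixed point solves \<open>a x + G x = y\<close>.\<close>

lemma bij_shift:
  assumes "a > 0"
  shows "bij (\<lambda>x. a *\<^sub>R x + G x)"
proof (rule bijI)
  show "inj (\<lambda>x. a *\<^sub>R x + G x)"
  proof (rule injI)
    fix x y assume "a *\<^sub>R x + G x = a *\<^sub>R y + G y"
    then have "a *\<^sub>R (x - y) + G (x - y) = 0" by (simp add: blinfun.diff_right algebra_simps)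
    then show "x = y" using norm_shift_ge[OF assms, of "x - y"] assms
      by (simp add: mult_le_0_iff)
  qed
  show "surj (\<lambda>x. a *\<^sub>R x + G x)"
    unfolding surj_def
  proof
    fix y
    define M where "M = a + norm G"
    have M: "M > 0" "a \<le> M" unfolding M_def using assms by (auto intro: add_pos_nonneg)
    \<comment> \<open>The minimiser of the contraction factor \<open>1 - 2 \<rho> a + \<rho>\<^sup>2 M\<^sup>2\<close>\<close>
    define \<rho> where "\<rho> = a / M\<^sup>2"
    define f where "f x = x - \<rho> *\<^sub>R (a *\<^sub>R x + G x - y)" for x
    have \<rho>: "\<rho> > 0" unfolding \<rho>_def using assms M by simp
    have nM: "norm (a *\<^sub>R x + G x) \<le> M * norm x" for x
      unfolding M_def using norm_triangle_ineq[of "a *\<^sub>R x" "G x"] norm_blinfun[of G x] assms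
      by (simp add: algebra_simps)
    define c where "c = sqrt (1 - a\<^sup>2 / M\<^sup>2)"
    have aM: "a\<^sup>2 / M\<^sup>2 \<le> 1" using M assms by (simp add: divide_le_eq power_mono)
    have c: "0 \<le> c" "c < 1" unfolding c_def using assms M aM by auto
    have contr: "norm (w - \<rho> *\<^sub>R (a *\<^sub>R w + G w)) \<le> c * norm w" for w
    proof (rule power2_le_imp_le)
      have "(norm (w - \<rho> *\<^sub>R (a *\<^sub>R w + G w)))\<^sup>2
        = (norm w)\<^sup>2 - 2 * \<rho> * ((a *\<^sub>R w + G w) \<bullet> w) + \<rho>\<^sup>2 * (norm (a *\<^sub>R w + G w))\<^sup>2"
        unfolding power2_norm_eq_inner
        by (simp add: inner_simps inner_commute power2_eq_square algebra_simps)
      also have "\<dots> \<le> (norm w)\<^sup>2 - 2 * \<rho> * (a * (norm w)\<^sup>2) + \<rho>\<^sup>2 * (M * norm w)\<^sup>2"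
        using shift_coercive[of a w] nM[of w] \<rho>
        by (intro add_mono diff_mono mult_left_mono power_mono) auto
      also have "\<dots> = (1 - 2 * \<rho> * a + \<rho>\<^sup>2 * M\<^sup>2) * (norm w)\<^sup>2"
        by (simp add: algebra_simps power_mult_distrib)
      also have "1 - 2 * \<rho> * a + \<rho>\<^sup>2 * M\<^sup>2 = 1 - a\<^sup>2 / M\<^sup>2"
        unfolding \<rho>_def using M by (simp add: field_simps power2_eq_square)
      also have "\<dots> * (norm w)\<^sup>2 = (c * norm w)\<^sup>2"
        unfolding c_def using aM by (simp add: power_mult_distrib)
      finally show "(norm (w - \<rho> *\<^sub>R (a *\<^sub>R w + G w)))\<^sup>2 \<le> (c * norm w)\<^sup>2" .
    qed (use c in auto)
    have "\<exists>!x. f x = x"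
    proof (rule banach_fix_type[of c])
      show "\<forall>x y. dist (f x) (f y) \<le> c * dist x y"
      proof (intro allI)
        fix x z
        have "f x - f z = (x - z) - \<rho> *\<^sub>R (a *\<^sub>R (x - z) + G (x - z))"
          unfolding f_def by (simp add: blinfun.diff_right algebra_simps)
        then show "dist (f x) (f z) \<le> c * dist x z" unfolding dist_norm using contr by metis
      qed
    qed (use c in auto)
    then obtain x where "f x = x" by blast
    then show "\<exists>x. y = a *\<^sub>R x + G x" unfolding f_def using \<rho> by (intro exI[of _ x]) simp
  qed
qed

lemma shift_resolvent:
  assumes "a > 0"
  shows "a *\<^sub>R resolvent_op a (blinfun_apply G) y + G (resolvent_op a (blinfun_apply G) y) = y"
  unfolding resolvent_op_def using surj_f_inv_f[OF bij_is_surj[OF bij_shift[OF assms]]] .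

lemma resolvent_unique:
  assumes "a > 0" "a *\<^sub>R x + G x = y"
  shows "resolvent_op a (blinfun_apply G) y = x"
  unfolding resolvent_op_def using inv_f_f[OF bij_is_inj[OF bij_shift[OF assms(1)]]] assms(2) by auto

lemma bounded_linear_resolvent:
  assumes "a > 0"
  shows "bounded_linear (resolvent_op a (blinfun_apply G))"
proof (rule bounded_linear_intro[where K = "1 / a"])
  let ?R = "resolvent_op a (blinfun_apply G)"
  note R = shift_resolvent[OF assms]
  show "?R (x + y) = ?R x + ?R y" for x y
    using R[of x] R[of y]
    by (intro resolvent_unique[OF assms]) (simp add: scaleR_right_distrib blinfun.add_right algebra_simps)
  show "?R (r *\<^sub>R x) = r *\<^sub>R ?R x" for r x
  proof (rule resolvent_unique[OF assms])
    have "a *\<^sub>R r *\<^sub>R ?R x + G (r *\<^sub>R ?R x) = r *\<^sub>R (a *\<^sub>R ?R x + G (?R x))"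
      by (simp add: scaleR_right_distrib blinfun.scaleR_right mult.commute)
    then show "a *\<^sub>R r *\<^sub>R ?R x + G (r *\<^sub>R ?R x) = r *\<^sub>R x" by (simp only: R)
  qed
  show "norm (?R x) \<le> norm x * (1 / a)" for x
    using norm_shift_ge[OF assms, of "?R x"] R[of x] assms by (simp add: field_simps)
qed

text \<open>The bound does not depend on \<open>a\<close>; this turns strong convergence of \<open>a R(a)\<close> into uniform
  convergence on totally bounded sets.\<close>

lemma norm_scaled_resolvent_le:
  assumes "a > 0"
  shows "norm (a *\<^sub>R resolvent_op a (blinfun_apply G) y) \<le> norm y"
  using norm_shift_ge[OF assms, of "resolvent_op a (blinfun_apply G) y"] shift_resolvent[OF assms, of y] assms by simp

end

section \<open>The uniform boundedness principle\<close>

text \<open>A gliding hump: if the bounds \<open>N (j n)\<close> exceed \<open>4 ^ n\<close>, steps of length \<open>3 ^ -n\<close> can be chosen so that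
  the \<open>n\<close>-th one makes \<open>p (j n)\<close> large and the later ones, being geometrically small, do not undo
  this. The principle is formulated for a seminorm on a subspace so that it covers both the whole
  space and the phase space \<open>E\<close> with its own norm, and completeness is required just for sequences
  with such geometric steps.\<close>

lemma uniform_boundedness:
  fixes E :: "'a::real_vector set" and \<nu> :: "'a \<Rightarrow> real" and p :: "'i \<Rightarrow> 'a \<Rightarrow> real"
  assumes E: "subspace E"
    and \<nu>_add: "\<And>x y. x \<in> E \<Longrightarrow> y \<in> E \<Longrightarrow> \<nu> (x + y) \<le> \<nu> x + \<nu> y"
    and \<nu>_scale: "\<And>c x. x \<in> E \<Longrightarrow> \<nu> (c *\<^sub>R x) = \<bar>c\<bar> * \<nu> x"
    and complete: "\<And>s. (\<And>n. s n \<in> E) \<Longrightarrow> (\<And>n. \<nu> (s (Suc n) - s n) \<le> (1/3)^n)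
      \<Longrightarrow> \<exists>x\<in>E. (\<lambda>n. \<nu> (x - s n)) \<longlonglongrightarrow> 0"
    and p_add: "\<And>i x y. i \<in> I \<Longrightarrow> x \<in> E \<Longrightarrow> y \<in> E \<Longrightarrow> p i (x + y) \<le> p i x + p i y"
    and p_scale: "\<And>i c x. i \<in> I \<Longrightarrow> x \<in> E \<Longrightarrow> p i (c *\<^sub>R x) = \<bar>c\<bar> * p i x"
    and p_bounded: "\<And>i. i \<in> I \<Longrightarrow> \<exists>K. \<forall>x\<in>E. p i x \<le> K * \<nu> x"
    and pointwise: "\<And>x. x \<in> E \<Longrightarrow> \<exists>K. \<forall>i\<in>I. p i x \<le> K"
  shows "\<exists>K. \<forall>i\<in>I. \<forall>x\<in>E. p i x \<le> K * \<nu> x"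
proof (rule ccontr)
  assume unb: "\<not> ?thesis"
  note Eadd = subspace_add[OF E] and Escale = subspace_scale[OF E] and Ediff = subspace_diff[OF E]
  have \<nu>0: "\<nu> 0 = 0" using \<nu>_scale[of 0 0] subspace_0[OF E] by simp
  have \<nu>_nonneg: "\<nu> x \<ge> 0" if "x \<in> E" for x
    using \<nu>_add[OF that Escale[OF that, of "-1"]] \<nu>_scale[OF that, of "-1"] \<nu>0 by simp
  have \<nu>_minus: "\<nu> (x - y) = \<nu> (y - x)" if "x \<in> E" "y \<in> E" for x y
    using \<nu>_scale[OF Ediff[OF that], of "-1"] by simp
  have p_nonneg: "p i x \<ge> 0" if "i \<in> I" "x \<in> E" for i x
    using p_add[OF that Escale[OF that(2), of "-1"]] p_scale[OF that, of "-1"] p_scale[OF that, of 0] by simp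
  define B where "B i = {p i x |x. x \<in> E \<and> \<nu> x \<le> 1}" for i
  define N where "N i = Sup (B i)" for i
  have bdd: "bdd_above (B i)" if i: "i \<in> I" for i
  proof -
    obtain K where K: "\<forall>x\<in>E. p i x \<le> K * \<nu> x" using p_bounded[OF i] by blast
    have "p i x \<le> \<bar>K\<bar>" if "x \<in> E" "\<nu> x \<le> 1" for x
    proof -
      have "K * \<nu> x \<le> \<bar>K\<bar> * 1" using \<nu>_nonneg[OF that(1)] that(2) by (intro mult_mono) auto
      then show ?thesis using K that by fastforce
    qed
    then show ?thesis unfolding B_def by (intro bdd_aboveI[of _ "\<bar>K\<bar>"]) auto
  qed
  have zero: "p i x = 0" if "i \<in> I" "x \<in> E" "\<nu> x = 0" for i x
    using p_bounded[OF that(1)] that p_nonneg[OF that(1,2)] by fastforce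
  have pN: "p i x \<le> N i * \<nu> x" if i: "i \<in> I" and x: "x \<in> E" for i x
  proof (cases "\<nu> x = 0")
    case False
    then have pos: "\<nu> x > 0" using \<nu>_nonneg[OF x] by simp
    have "p i ((1 / \<nu> x) *\<^sub>R x) \<in> B i"
      unfolding B_def using Escale[OF x] \<nu>_scale[OF x] pos by auto
    then have "p i ((1 / \<nu> x) *\<^sub>R x) \<le> N i"
      unfolding N_def using bdd[OF i] by (intro cSup_upper)
    then show ?thesis using pos p_scale[OF i x] by (simp add: field_simps)
  qed (use zero[OF i x] in simp)
  have "\<exists>i\<in>I. N i > 4 ^ n" for n :: nat
  proof -
    obtain i x where ix: "i \<in> I" "x \<in> E" "p i x > 4 ^ n * \<nu> x" using unb by (meson not_le)
    have "\<nu> x > 0" using zero[OF ix(1,2)] ix(3) \<nu>_nonneg[OF ix(2)] by (cases "\<nu> x = 0") auto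
    moreover have "N i * \<nu> x > 4 ^ n * \<nu> x" using pN[OF ix(1,2)] ix(3) by linarith
    ultimately show ?thesis using ix(1) by auto
  qed
  then obtain j where j: "\<And>n::nat. j n \<in> I" "\<And>n. N (j n) > 4 ^ n" by metis
  have "\<exists>e\<in>E. \<nu> e \<le> 1 \<and> p (j n) e \<ge> 3/4 * N (j n)" for n
  proof -
    have "N (j n) > 0" using j(2)[of n] by (smt (verit) zero_less_power)
    then have "3/4 * N (j n) < Sup (B (j n))" unfolding N_def by simp
    moreover have "B (j n) \<noteq> {}" unfolding B_def using subspace_0[OF E] \<nu>0 by auto
    ultimately obtain v where "v \<in> B (j n)" "3/4 * N (j n) < v" using less_cSup_iff[OF _ bdd[OF j(1)]] by blast
    then show ?thesis unfolding B_def by force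
  qed
  then obtain e where e: "\<And>n. e n \<in> E" "\<And>n. \<nu> (e n) \<le> 1" "\<And>n. p (j n) (e n) \<ge> 3/4 * N (j n)" by metis
  \<comment> \<open>One of \<open>x \<plusminus> v\<close> has seminorm at least \<open>p v\<close>, since \<open>2 v\<close> is their difference.\<close>
  have choose: "\<exists>y\<in>E. \<nu> (y - x) \<le> (1/3)^n \<and> p (j n) y \<ge> 3/4 * (1/3)^n * N (j n)" if x: "x \<in> E" for x n
  proof -
    define v where "v = (1/3)^n *\<^sub>R e n"
    have v: "v \<in> E" "\<nu> v \<le> (1/3)^n"
      unfolding v_def using Escale e \<nu>_scale[OF e(1)] by (auto simp: mult_left_le)
    have "(1/3)^n * (3/4 * N (j n)) \<le> (1/3)^n * p (j n) (e n)" using e(3)[of n] by (intro mult_left_mono) auto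
    then have v3: "p (j n) v \<ge> 3/4 * (1/3)^n * N (j n)"
      unfolding v_def using p_scale[OF j(1) e(1), of n "(1/3)^n" n] by (simp add: mult_ac)
    have "p (j n) (2 *\<^sub>R v) \<le> p (j n) (x + v) + p (j n) ((-1) *\<^sub>R (x - v))"
      using p_add[OF j(1), of "x + v" "(-1) *\<^sub>R (x - v)" n] x v Eadd Ediff Escale
      by (simp add: scaleR_2 algebra_simps del: scaleR_minus1_left)
    then have "2 * p (j n) v \<le> p (j n) (x + v) + p (j n) (x - v)"
      using p_scale[OF j(1) v(1), of n 2] p_scale[OF j(1) Ediff[OF x v(1)], of n "-1"] by simp
    then have "p (j n) (x + v) \<ge> p (j n) v \<or> p (j n) (x - v) \<ge> p (j n) v" by linarith
    moreover have "\<nu> (x - v - x) = \<nu> v" using \<nu>_scale[OF v(1), of "-1"] by simp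
    moreover have "x + v \<in> E" "x - v \<in> E" using x v(1) Eadd Ediff by auto
    moreover have "\<nu> (x + v - x) = \<nu> v" by simp
    moreover note v(2) v3
    ultimately show ?thesis
      by (elim disjE) (rule bexI[of _ "x + v"] bexI[of _ "x - v"]; simp del: add_diff_cancel_left' add_diff_cancel_right')+
  qed
  have "\<exists>s. \<forall>n. s n \<in> E \<and> (\<nu> (s (Suc n) - s n) \<le> (1/3)^n \<and> p (j n) (s (Suc n)) \<ge> 3/4 * (1/3)^n * N (j n))"
    by (rule dependent_nat_choice) (use subspace_0[OF E] choose in blast)+
  then obtain s where s: "\<And>n. s n \<in> E" "\<And>n. \<nu> (s (Suc n) - s n) \<le> (1/3)^n"
    "\<And>n. p (j n) (s (Suc n)) \<ge> 3/4 * (1/3)^n * N (j n)" by blast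
  obtain x where x: "x \<in> E" "(\<lambda>n. \<nu> (x - s n)) \<longlonglongrightarrow> 0" using complete[of s] s by blast
  have step: "\<nu> (s (m + k) - s m) \<le> 3/2 * (1/3)^m * (1 - (1/3)^k)" for m k
  proof (induction k)
    case (Suc k)
    have "\<nu> (s (m + Suc k) - s m) = \<nu> ((s (Suc (m + k)) - s (m+k)) + (s (m + k) - s m))" by simp
    also have "\<dots> \<le> (1/3)^(m+k) + 3/2 * (1/3)^m * (1 - (1/3)^k)"
      using \<nu>_add[of "s (Suc (m + k)) - s (m+k)" "s (m + k) - s m"] s(2)[of "m+k"] Suc Ediff s(1) by fastforce
    also have "\<dots> = 3/2 * (1/3)^m * (1 - (1/3)^Suc k)" by (simp add: power_add field_simps)
    finally show ?case .
  qed (simp add: \<nu>0)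
  have tail: "\<nu> (x - s m) \<le> 3/2 * (1/3)^m" for m
  proof (rule LIMSEQ_le_const)
    show "(\<lambda>k. \<nu> (x - s k) + 3/2 * (1/3)^m) \<longlonglongrightarrow> 3/2 * (1/3)^m"
      using tendsto_add[OF x(2) tendsto_const] by simp
    have "\<nu> (x - s m) \<le> \<nu> (x - s k) + 3/2 * (1/3)^m" if "k \<ge> m" for k
    proof -
      have "\<nu> (x - s m) = \<nu> ((x - s k) + (s k - s m))" by simp
      also have "\<dots> \<le> \<nu> (x - s k) + \<nu> (s k - s m)" by (intro \<nu>_add Ediff x s)
      also have "\<nu> (s k - s m) \<le> 3/2 * (1/3)^m * (1 - (1/3)^(k-m))" using step[of m "k - m"] that by simp
      also have "\<dots> \<le> 3/2 * (1/3)^m" by (simp add: mult_left_le)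
      finally show ?thesis by simp
    qed
    then show "\<exists>N. \<forall>n\<ge>N. \<nu> (x - s m) \<le> \<nu> (x - s n) + 3/2 * (1/3)^m" by blast
  qed
  obtain K where K: "\<forall>i\<in>I. p i x \<le> K" using pointwise[OF x(1)] by blast
  have "(4/3)^n \<le> 4 * K" for n :: nat
  proof -
    have Npos: "N (j n) \<ge> 0" using j(2)[of n] by (smt (verit) zero_less_power)
    have "3/4 * (1/3)^n * N (j n) \<le> p (j n) (x + (s (Suc n) - x))" using s(3)[of n] by simp
    also have "\<dots> \<le> p (j n) x + p (j n) (s (Suc n) - x)" by (intro p_add j x Ediff s)
    also have "p (j n) (s (Suc n) - x) \<le> N (j n) * \<nu> (x - s (Suc n))"
      using pN[OF j(1) Ediff[OF s(1) x(1)]] \<nu>_minus[OF x(1) s(1)] by metis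
    also have "\<dots> \<le> N (j n) * (3/2 * (1/3)^Suc n)" by (intro mult_left_mono tail Npos)
    finally have "1/4 * (1/3)^n * N (j n) \<le> p (j n) x" by (simp add: algebra_simps)
    moreover have "1/4 * (1/3)^n * 4^n \<le> 1/4 * (1/3)^n * N (j n)" using j(2)[of n] by simp
    moreover have "p (j n) x \<le> K" using K j by blast
    ultimately have "1/4 * (1/3)^n * 4^n \<le> K" by linarith
    then show ?thesis by (simp add: power_divide)
  qed
  moreover obtain n where "(4/3::real)^n > 4 * K" using real_arch_pow[of "4/3"] by auto
  ultimately show False by (meson not_le)
qed

lemma uniform_boundedness_blinfun:
  fixes T :: "'i \<Rightarrow> 'a::banach \<Rightarrow>\<^sub>L 'b::real_normed_vector"
  assumes "\<And>x. \<exists>K. \<forall>i\<in>I. norm (T i x) \<le> K"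
  shows "\<exists>K\<ge>0. \<forall>i\<in>I. norm (T i) \<le> K"
proof -
  have "\<exists>K. \<forall>i\<in>I. \<forall>x\<in>UNIV. norm (T i x) \<le> K * norm x"
  proof (rule uniform_boundedness)
    fix s :: "nat \<Rightarrow> 'a" assume s: "\<And>n. norm (s (Suc n) - s n) \<le> (1/3)^n"
    have "summable (\<lambda>n. s (Suc n) - s n)"
      by (rule summable_comparison_test[OF _ summable_geometric[of "1/3::real"]]) (use s in auto)
    then have "convergent (\<lambda>n. \<Sum>i<n. s (Suc i) - s i)" by (simp add: summable_iff_convergent)
    then have "convergent (\<lambda>n. s n - s 0)" by (simp add: sum_lessThan_telescope)
    then obtain l where "(\<lambda>n. s n - s 0) \<longlonglongrightarrow> l" unfolding convergent_def by blast
    then have "(\<lambda>n. (l + s 0) - s n) \<longlonglongrightarrow> 0"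
      by (auto simp: tendsto_iff dist_norm norm_minus_commute algebra_simps)
    then show "\<exists>x\<in>UNIV. (\<lambda>n. norm (x - s n)) \<longlonglongrightarrow> 0" using tendsto_norm_zero by blast
  next
    fix i show "\<exists>K. \<forall>x\<in>UNIV. norm (T i x) \<le> K * norm x" using norm_blinfun by blast
  qed (use assms in \<open>auto simp: blinfun.add_right blinfun.scaleR_right norm_triangle_ineq\<close>)
  then obtain K where K: "\<forall>i\<in>I. \<forall>x. norm (T i x) \<le> K * norm x" by auto
  have "norm (T i) \<le> max K 0" if "i \<in> I" for i
  proof (rule norm_blinfun_bound)
    fix x
    have "norm (T i x) \<le> K * norm x" using K that by blast
    also have "\<dots> \<le> max K 0 * norm x" by (intro mult_right_mono) auto
    finally show "norm (T i x) \<le> max K 0 * norm x" .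
  qed simp
  then show ?thesis by (intro exI[of _ "max K 0"]) auto
qed

section \<open>Strong measurability and the Henstock-Kurzweil integral\<close>

text \<open>A Riemann sum of \<open>f - s n\<close> is bounded by the same Riemann sum of \<open>\<phi> n\<close>, and a fine one is close to
  a small integral. Hence approximation in the mean preserves integrability for values in any Banach
  space, separable or not.\<close>

lemma integrable_on_L1_limit:
  fixes f :: "real \<Rightarrow> 'a::banach"
  assumes s: "\<And>n. s n integrable_on {a..b}"
    and \<phi>: "\<And>n. \<phi> n integrable_on {a..b}"
    and bound: "\<And>n t. t \<in> {a..b} \<Longrightarrow> norm (f t - s n t) \<le> \<phi> n t"
    and lim: "(\<lambda>n. integral {a..b} (\<phi> n)) \<longlonglongrightarrow> (0::real)"
  shows "f integrable_on {a..b}"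
proof -
  define I where "I n = integral {a..b} (s n)" for n
  have IJ: "norm (I m - I n) \<le> integral {a..b} (\<phi> m) + integral {a..b} (\<phi> n)" for m n
  proof -
    have "norm (integral {a..b} (\<lambda>t. s m t - s n t)) \<le> integral {a..b} (\<lambda>t. \<phi> m t + \<phi> n t)"
    proof (rule integral_norm_bound_integral)
      fix t assume t: "t \<in> {a..b}"
      show "norm (s m t - s n t) \<le> \<phi> m t + \<phi> n t"
        using bound[OF t, of m] bound[OF t, of n] norm_triangle_ineq4[of "f t - s n t" "f t - s m t"] by simp
    qed (intro integrable_diff integrable_add s \<phi>)+
    then show ?thesis unfolding I_def by (simp add: integral_diff integral_add s \<phi>)
  qed
  have small: "\<exists>M. \<forall>n\<ge>M. integral {a..b} (\<phi> n) < e" if "e > 0" for e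
    using order_tendstoD(2)[OF lim that] unfolding eventually_sequentially .
  have "Cauchy I"
  proof (rule metric_CauchyI)
    fix e :: real assume "e > 0"
    then obtain M where "\<forall>n\<ge>M. integral {a..b} (\<phi> n) < e / 2" using small[of "e/2"] by auto
    then show "\<exists>M. \<forall>m\<ge>M. \<forall>n\<ge>M. dist (I m) (I n) < e"
      unfolding dist_norm using IJ by (smt (verit) field_sum_of_halves)
  qed
  then obtain J where J: "I \<longlonglongrightarrow> J" using Cauchy_convergent_iff convergent_def by blast
  have "(f has_integral J) {a..b}"
    unfolding has_integral_real
  proof (intro allI impI)
    fix e :: real assume e: "e > 0"
    obtain M where M: "\<forall>n\<ge>M. integral {a..b} (\<phi> n) < e / 5" using small[of "e/5"] e by auto
    obtain M' where M': "\<forall>n\<ge>M'. norm (I n - J) < e / 5" using J e unfolding LIMSEQ_iff by (metis zero_less_divide_iff zero_less_numeral)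
    define n where "n = max M M'"
    have n: "integral {a..b} (\<phi> n) < e / 5" "norm (I n - J) < e / 5" using M M' unfolding n_def by auto
    obtain g1 where g1: "gauge g1" "\<And>D. D tagged_division_of {a..b} \<and> g1 fine D \<Longrightarrow>
        norm ((\<Sum>(x,k)\<in>D. measure lborel k *\<^sub>R s n x) - I n) < e / 5"
      using integrable_integral[OF s[of n]] e unfolding has_integral_real I_def
      by (metis zero_less_divide_iff zero_less_numeral)
    obtain g2 where g2: "gauge g2" "\<And>D. D tagged_division_of {a..b} \<and> g2 fine D \<Longrightarrow>
        norm ((\<Sum>(x,k)\<in>D. measure lborel k *\<^sub>R \<phi> n x) - integral {a..b} (\<phi> n)) < e / 5"
      using integrable_integral[OF \<phi>[of n]] e unfolding has_integral_real
      by (metis zero_less_divide_iff zero_less_numeral)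
    have three: "norm (u - J) < e" if "norm (u - v) < 2 * e / 5" "norm (v - I n) < e / 5" "norm (I n - J) < e / 5" for u v
      using dist_triangle[of u J v] dist_triangle[of v J "I n"] that e unfolding dist_norm by linarith
    have "norm ((\<Sum>(x,k)\<in>D. measure lborel k *\<^sub>R f x) - J) < e"
      if D: "D tagged_division_of {a..b}" "(\<lambda>x. g1 x \<inter> g2 x) fine D" for D
    proof -
      have fine: "g1 fine D" "g2 fine D" using D(2) by (auto simp: fine_Int)
      have "norm ((\<Sum>(x,k)\<in>D. measure lborel k *\<^sub>R f x) - (\<Sum>(x,k)\<in>D. measure lborel k *\<^sub>R s n x))
        = norm (\<Sum>(x,k)\<in>D. measure lborel k *\<^sub>R (f x - s n x))"
        by (simp add: sum_subtractf[symmetric] split_def scaleR_diff_right)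
      also have "\<dots> \<le> (\<Sum>(x,k)\<in>D. measure lborel k *\<^sub>R \<phi> n x)"
      proof (intro sum_norm_le, clarify)
        fix x k assume "(x, k) \<in> D"
        then have "x \<in> {a..b}" using tag_in_interval[OF D(1)] by blast
        then show "norm (measure lborel k *\<^sub>R (f x - s n x)) \<le> measure lborel k *\<^sub>R \<phi> n x"
          using bound by (simp add: mult_left_mono)
      qed
      also have "\<dots> < 2 * e / 5" using g2(2)[OF conjI[OF D(1) fine(2)]] n(1) unfolding real_norm_def by linarith
      finally have l1: "norm ((\<Sum>(x,k)\<in>D. measure lborel k *\<^sub>R f x) - (\<Sum>(x,k)\<in>D. measure lborel k *\<^sub>R s n x)) < 2 * e / 5" .
      have l2: "norm ((\<Sum>(x,k)\<in>D. measure lborel k *\<^sub>R s n x) - I n) < e / 5" using g1(2) D(1) fine by blast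
      show ?thesis by (rule three[OF l1 l2 n(2)])
    qed
    then show "\<exists>g. gauge g \<and> (\<forall>D. D tagged_division_of {a..b} \<and> g fine D \<longrightarrow>
        norm ((\<Sum>(x,k)\<in>D. measure lborel k *\<^sub>R f x) - J) < e)"
      using gauge_Int[OF g1(1) g2(1)] by blast
  qed
  then show ?thesis by blast
qed

text \<open>By monotone convergence the sum of the series has a finite integral.\<close>

lemma AE_summable_of_summable_integrals:
  fixes f :: "nat \<Rightarrow> 'a \<Rightarrow> real"
  assumes f: "\<And>k. integrable M (f k)" and nn: "\<And>k x. 0 \<le> f k x" and S: "summable (\<lambda>k. integral\<^sup>L M (f k))"
  shows "AE x in M. summable (\<lambda>k. f k x)"
proof -
  have [measurable]: "\<And>k. f k \<in> borel_measurable M" using f by auto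
  have "(\<integral>\<^sup>+x. (\<Sum>k. ennreal (f k x)) \<partial>M) = (\<Sum>k. \<integral>\<^sup>+x. ennreal (f k x) \<partial>M)"
    by (rule nn_integral_suminf) simp
  also have "\<dots> = (\<Sum>k. ennreal (integral\<^sup>L M (f k)))"
    using f nn by (simp add: nn_integral_eq_integral)
  also have "\<dots> \<noteq> \<infinity>"
    using S nn by (subst suminf_ennreal2) (auto intro: integral_nonneg)
  finally have "AE x in M. (\<Sum>k. ennreal (f k x)) \<noteq> \<infinity>"
    by (intro nn_integral_PInf_AE) auto
  then show ?thesis
    by eventually_elim (use nn in \<open>auto intro: summable_suminf_not_top\<close>)
qed

lemma complete_measure_lebesgue_on:
  assumes "S \<in> sets lebesgue"
  shows "complete_measure (lebesgue_on S)"
proof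
  fix A B assume "A \<subseteq> B" "B \<in> null_sets (lebesgue_on S)"
  then have "B \<in> null_sets lebesgue" "B \<subseteq> S" using assms by (auto simp: null_sets_restrict_space)
  then show "A \<in> sets (lebesgue_on S)"
    using \<open>A \<subseteq> B\<close> assms completion.complete2[of A B lborel] by (auto simp: sets_restrict_space_iff null_sets_def)
qed

lemma (in complete_measure) measurable_AE_eq:
  assumes f: "f \<in> measurable M N" and g: "g \<in> space M \<rightarrow> space N" and eq: "AE x in M. f x = g x"
  shows "g \<in> measurable M N"
proof (rule measurableI)
  fix A assume A: "A \<in> sets N"
  show "g -` A \<inter> space M \<in> sets M"
  proof (rule in_sets_AE)
    show "AE x in M. (x \<in> f -` A \<inter> space M) = (x \<in> g -` A \<inter> space M)" using eq by eventually_elim auto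
  qed (use f A in \<open>auto intro: measurable_sets\<close>)
qed (use g in auto)

lemma finite_measure_lebesgue_on_Icc: "finite_measure (lebesgue_on {a..b::real})"
  by (rule finite_measureI) (simp add: emeasure_restrict_space emeasure_lborel_Icc_eq)

lemma strongly_measurable_on_AE_eq:
  assumes "strongly_measurable_on S f" "AE t in lebesgue_on S. f t = g t"
  shows "strongly_measurable_on S g"
proof -
  obtain s where s: "\<forall>n::nat. simple_function (lebesgue_on S) (s n)"
    "AE t in lebesgue_on S. (\<lambda>n. s n t) \<longlonglongrightarrow> f t" using assms(1) unfolding strongly_measurable_on_def by blast
  have "AE t in lebesgue_on S. (\<lambda>n. s n t) \<longlonglongrightarrow> g t"
    using s(2) assms(2) by eventually_elim simp
  then show ?thesis unfolding strongly_measurable_on_def using s(1) by blast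
qed

lemma strongly_measurable_on_compose2:
  assumes "strongly_measurable_on S f" "strongly_measurable_on S g"
    and h: "\<And>X Y x y. X \<longlonglongrightarrow> x \<Longrightarrow> Y \<longlonglongrightarrow> y \<Longrightarrow> (\<lambda>n. h (X n) (Y n)) \<longlonglongrightarrow> h x y"
  shows "strongly_measurable_on S (\<lambda>t. h (f t) (g t))"
proof -
  obtain s r where s: "\<forall>n::nat. simple_function (lebesgue_on S) (s n)"
    "AE t in lebesgue_on S. (\<lambda>n. s n t) \<longlonglongrightarrow> f t"
    and r: "\<forall>n::nat. simple_function (lebesgue_on S) (r n)"
    "AE t in lebesgue_on S. (\<lambda>n. r n t) \<longlonglongrightarrow> g t"
    using assms(1,2) unfolding strongly_measurable_on_def by blast
  have "AE t in lebesgue_on S. (\<lambda>n. h (s n t) (r n t)) \<longlonglongrightarrow> h (f t) (g t)"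
    using s(2) r(2) by eventually_elim (rule h)
  then show ?thesis unfolding strongly_measurable_on_def using s(1) r(1)
    by (intro exI[of _ "\<lambda>n t. h (s n t) (r n t)"]) (auto intro: simple_function_compose2)
qed

lemma strongly_measurable_on_simple: "simple_function (lebesgue_on S) f \<Longrightarrow> strongly_measurable_on S f"
  unfolding strongly_measurable_on_def by (intro exI[of _ "\<lambda>_. f"]) auto

lemma strongly_measurable_on_const: "strongly_measurable_on S (\<lambda>_. c)"
  by (rule strongly_measurable_on_simple) simp

lemma strongly_measurable_on_add:
  "strongly_measurable_on S f \<Longrightarrow> strongly_measurable_on S g \<Longrightarrow> strongly_measurable_on S (\<lambda>t. f t + g t)"
  by (rule strongly_measurable_on_compose2) (auto intro: tendsto_add)

lemma strongly_measurable_on_diff: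
  "strongly_measurable_on S f \<Longrightarrow> strongly_measurable_on S g \<Longrightarrow> strongly_measurable_on S (\<lambda>t. f t - g t)"
  by (rule strongly_measurable_on_compose2) (auto intro: tendsto_diff)

lemma strongly_measurable_on_scaleR:
  "strongly_measurable_on S f \<Longrightarrow> strongly_measurable_on S (\<lambda>t. c *\<^sub>R f t)"
  by (rule strongly_measurable_on_compose2[where h = "\<lambda>x y. c *\<^sub>R x"]) (auto intro: tendsto_intros)

lemma strongly_measurable_on_sum:
  "(\<And>i. i \<in> I \<Longrightarrow> strongly_measurable_on S (f i)) \<Longrightarrow> strongly_measurable_on S (\<lambda>t. \<Sum>i\<in>I. f i t)"
  by (induction I rule: infinite_finite_induct) (auto intro: strongly_measurable_on_add strongly_measurable_on_const)

text \<open>Where the simple functions converge their norms converge too; completeness of Lebesgue measure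
  takes care of the remaining null set.\<close>

lemma borel_measurable_norm_strongly_measurable:
  fixes f :: "real \<Rightarrow> 'a::real_normed_vector"
  assumes "strongly_measurable_on S f" and S: "S \<in> sets lebesgue"
  shows "(\<lambda>t. norm (f t)) \<in> borel_measurable (lebesgue_on S)"
proof -
  interpret complete_measure "lebesgue_on S" by (rule complete_measure_lebesgue_on[OF S])
  obtain s where s: "\<And>n::nat. simple_function (lebesgue_on S) (s n)"
    "AE t in lebesgue_on S. (\<lambda>n. s n t) \<longlonglongrightarrow> f t" using assms(1) unfolding strongly_measurable_on_def by blast
  define G where "G = {t \<in> S. (\<lambda>n. s n t) \<longlonglongrightarrow> f t}"
  have "space (lebesgue_on S) - G \<in> null_sets (lebesgue_on S)"
    using s(2) unfolding AE_iff_null_sets G_def by (simp add: set_diff_eq Collect_conj_eq[symmetric] conj_commute cong: conj_cong)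
  then have "space (lebesgue_on S) - (space (lebesgue_on S) - G) \<in> sets (lebesgue_on S)"
    by (intro sets.compl_sets null_setsD2)
  moreover have "space (lebesgue_on S) - (space (lebesgue_on S) - G) = G" unfolding G_def by auto
  ultimately have G[measurable]: "G \<in> sets (lebesgue_on S)" by simp
  have "(\<lambda>t. norm (f t) * indicator G t) \<in> borel_measurable (lebesgue_on S)"
  proof (rule borel_measurable_LIMSEQ_real[where u = "\<lambda>n t. norm (s n t) * indicator G t"])
    fix t show "(\<lambda>n. norm (s n t) * indicator G t) \<longlonglongrightarrow> norm (f t) * indicator G t"
      by (cases "t \<in> G") (auto simp: G_def intro: tendsto_norm)
  next
    fix n show "(\<lambda>t. norm (s n t) * indicator G t) \<in> borel_measurable (lebesgue_on S)"
      using borel_measurable_simple_function[OF simple_function_compose1[OF s(1)[of n], of norm]] by measurable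
  qed
  then show ?thesis
  proof (rule measurable_AE_eq)
    show "AE t in lebesgue_on S. norm (f t) * indicator G t = norm (f t)"
      using s(2) AE_space by eventually_elim (auto simp: G_def)
  qed auto
qed

lemma strongly_measurable_on_continuous:
  fixes f :: "real \<Rightarrow> 'a::real_normed_vector"
  assumes f: "continuous_on {a..b} f"
  shows "strongly_measurable_on {a..b} f"
proof (cases "a \<le> b")
  case True
  \<comment> \<open>Rounding down to multiples of \<open>1 / Suc n\<close>; the maximum keeps the argument in the interval.\<close>
  define q where "q n t = max a (of_int \<lfloor>real (Suc n) * t\<rfloor> / real (Suc n))" for n :: nat and t :: real
  have q_lim: "(\<lambda>n. q n t) \<longlonglongrightarrow> t" if "t \<in> {a..b}" for t
  proof (rule tendsto_sandwich[OF always_eventually always_eventually])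
    show "\<forall>n. t - 1 / Suc n \<le> q n t"
    proof
      fix n
      have "(real (Suc n) * t - 1) / real (Suc n) \<le> of_int \<lfloor>real (Suc n) * t\<rfloor> / real (Suc n)"
        by (rule divide_right_mono) linarith+
      then show "t - 1 / Suc n \<le> q n t" unfolding q_def by (simp add: diff_divide_distrib)
    qed
    show "\<forall>n. q n t \<le> t"
    proof
      fix n
      have "of_int \<lfloor>real (Suc n) * t\<rfloor> / real (Suc n) \<le> (real (Suc n) * t) / real (Suc n)"
        by (rule divide_right_mono) linarith+
      then show "q n t \<le> t" unfolding q_def using that by simp
    qed
    show "(\<lambda>n. t - 1 / Suc n) \<longlonglongrightarrow> t"
      using tendsto_diff[OF tendsto_const LIMSEQ_Suc[OF lim_1_over_n]] by simp
  qed simp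
  have q_le: "q n t \<in> {a..b}" if "t \<in> {a..b}" for n t
  proof -
    have "of_int \<lfloor>real (Suc n) * t\<rfloor> / real (Suc n) \<le> (real (Suc n) * t) / real (Suc n)"
      by (rule divide_right_mono) linarith+
    then show ?thesis unfolding q_def using that by simp
  qed
  have sq: "simple_function (lebesgue_on {a..b}) (q n)" for n
  proof (rule simple_function_borel_measurable)
    have "q n ` space (lebesgue_on {a..b}) \<subseteq>
      (\<lambda>k::int. max a (of_int k / real (Suc n))) ` {\<lfloor>real (Suc n) * a\<rfloor>..\<lfloor>real (Suc n) * b\<rfloor>}"
      unfolding q_def by (auto intro!: imageI floor_mono mult_left_mono simp del: of_nat_Suc)
    then show "finite (q n ` space (lebesgue_on {a..b}))" by (rule finite_subset) auto
    show "q n \<in> borel_measurable (lebesgue_on {a..b})"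
      unfolding q_def by (intro measurable_restrict_space1 measurable_completion) (auto simp: measurable_lborel1)
  qed
  have "(\<lambda>n. f (q n t)) \<longlonglongrightarrow> f t" if "t \<in> {a..b}" for t
    by (rule continuous_on_tendsto_compose[OF f q_lim[OF that] that]) (use q_le[OF that] in auto)
  then have "AE t in lebesgue_on {a..b}. (\<lambda>n. f (q n t)) \<longlonglongrightarrow> f t"
    by (intro AE_I2) simp
  then show ?thesis unfolding strongly_measurable_on_def
    using sq by (intro exI[of _ "\<lambda>n t. f (q n t)"]) (auto intro: simple_function_compose1)
next
  case False
  then show ?thesis unfolding strongly_measurable_on_def
    by (intro exI[of _ "\<lambda>_ _. 0"]) (auto intro: AE_I2)
qed

lemma integrable_on_simple_function:
  fixes s :: "real \<Rightarrow> 'a::banach"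
  assumes "simple_function (lebesgue_on {a..b}) s"
  shows "s integrable_on {a..b}"
proof -
  let ?A = "\<lambda>y. s -` {y} \<inter> {a..b}"
  have fin: "finite (s ` {a..b})" and meas: "\<And>y. y \<in> s ` {a..b} \<Longrightarrow> ?A y \<in> sets (lebesgue_on {a..b})"
    using assms unfolding simple_function_def by auto
  have "(\<lambda>t. \<Sum>y\<in>s ` {a..b}. indicat_real (?A y) t *\<^sub>R y) integrable_on {a..b}"
  proof (intro integrable_sum fin)
    fix y assume "y \<in> s ` {a..b}"
    then have "?A y \<in> sets lebesgue" using meas by (simp add: sets_restrict_space_iff)
    then have "?A y \<in> lmeasurable" by (rule bounded_set_imp_lmeasurable[rotated]) (auto intro: bounded_subset[OF bounded_closed_interval])
    moreover have "?A y \<inter> {a..b} = ?A y" by auto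
    ultimately have "indicat_real (?A y) integrable_on {a..b}" using integrable_on_indicator by metis
    then show "(\<lambda>t. indicat_real (?A y) t *\<^sub>R y) integrable_on {a..b}" by (rule integrable_on_scaleR_left)
  qed
  then show ?thesis
  proof (rule integrable_eq)
    fix t assume t: "t \<in> {a..b}"
    have "(\<Sum>y\<in>s ` {a..b}. indicat_real (?A y) t *\<^sub>R y) = (\<Sum>y\<in>s ` {a..b}. if y = s t then y else 0)"
      using t by (intro sum.cong) auto
    also have "\<dots> = s t" using fin t by simp
    finally show "(\<Sum>y\<in>s ` {a..b}. indicat_real (?A y) t *\<^sub>R y) = s t" .
  qed
qed

text \<open>The simple functions are set to zero where their norm exceeds \<open>2 * norm (f t)\<close>. This keeps their
  limit and makes the errors dominated by \<open>3 * norm (f t)\<close>.\<close>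

lemma L1_on_simple_approximation:
  fixes f :: "real \<Rightarrow> 'a::real_normed_vector"
  assumes f: "f \<in> L1_on S" and S: "S \<in> sets lebesgue"
  shows "\<exists>s. (\<forall>n. simple_function (lebesgue_on S) (s n)) \<and>
    (\<forall>n::nat. integrable (lebesgue_on S) (\<lambda>t. norm (f t - s n t))) \<and>
    (\<lambda>n. LINT t|lebesgue_on S. norm (f t - s n t)) \<longlonglongrightarrow> 0"
proof -
  have sm: "strongly_measurable_on S f" and int: "integrable (lebesgue_on S) (\<lambda>t. norm (f t))"
    using f unfolding L1_on_def by auto
  obtain r where r: "\<And>n::nat. simple_function (lebesgue_on S) (r n)"
    "AE t in lebesgue_on S. (\<lambda>n. r n t) \<longlonglongrightarrow> f t" using sm unfolding strongly_measurable_on_def by blast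
  define A where "A n = {t \<in> space (lebesgue_on S). norm (r n t) \<le> 2 * norm (f t)}" for n
  have [measurable]: "(\<lambda>t. norm (f t)) \<in> borel_measurable (lebesgue_on S)" using int by auto
  have [measurable]: "(\<lambda>t. norm (r n t)) \<in> borel_measurable (lebesgue_on S)" for n
    by (rule borel_measurable_simple_function[OF simple_function_compose1[OF r(1)]])
  have A: "A n \<in> sets (lebesgue_on S)" for n unfolding A_def by measurable
  define s where "s n t = indicat_real (A n) t *\<^sub>R r n t" for n t
  have s: "simple_function (lebesgue_on S) (s n)" for n
    unfolding s_def by (intro simple_function_compose2[where h = "(*\<^sub>R)"] simple_function_indicator A r)
  have meas: "(\<lambda>t. norm (f t - s n t)) \<in> borel_measurable (lebesgue_on S)" for n
    by (intro borel_measurable_norm_strongly_measurable strongly_measurable_on_diff sm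
        strongly_measurable_on_simple s S)
  have bd: "AE t in lebesgue_on S. norm (norm (f t - s n t)) \<le> 3 * norm (f t)" for n
  proof (rule AE_I2)
    fix t assume "t \<in> space (lebesgue_on S)"
    have "norm (s n t) \<le> 2 * norm (f t)" unfolding s_def A_def by (auto simp: indicator_def)
    then show "norm (norm (f t - s n t)) \<le> 3 * norm (f t)" using norm_triangle_ineq4[of "f t" "s n t"] by simp
  qed
  have lim: "AE t in lebesgue_on S. (\<lambda>n. norm (f t - s n t)) \<longlonglongrightarrow> 0"
    using r(2) AE_space
  proof eventually_elim
    case (elim t)
    have "(\<lambda>n. s n t) \<longlonglongrightarrow> f t"
    proof (cases "f t = 0")
      case True
      then have "s n t = 0" for n unfolding s_def A_def by (auto simp: indicator_def)
      then show ?thesis using True by simp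
    next
      case False
      have "eventually (\<lambda>n. norm (r n t) < 2 * norm (f t)) sequentially"
        using False by (intro order_tendstoD(2)[OF tendsto_norm[OF elim(1)]]) simp
      then have "eventually (\<lambda>n. s n t = r n t) sequentially"
        by eventually_elim (use elim(2) in \<open>auto simp: s_def A_def\<close>)
      then show ?thesis using elim(1) by (simp add: tendsto_cong)
    qed
    then have "(\<lambda>n. f t - s n t) \<longlonglongrightarrow> f t - f t" by (intro tendsto_intros)
    then show ?case using tendsto_norm_zero by fastforce
  qed
  have int3: "integrable (lebesgue_on S) (\<lambda>t. 3 * norm (f t))" using int by simp
  have "integrable (lebesgue_on S) (\<lambda>t. norm (f t - s n t))" for n
    by (rule integrable_dominated_convergence2[OF _ meas int3 lim bd]) simp
  moreover have "(\<lambda>n. LINT t|lebesgue_on S. norm (f t - s n t)) \<longlonglongrightarrow> (LINT t|lebesgue_on S. 0)"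
    by (rule integral_dominated_convergence[OF _ meas int3 lim bd]) simp
  ultimately show ?thesis using s by (intro exI[of _ s]) simp
qed

lemma L1_on_integrable_on:
  fixes f :: "real \<Rightarrow> 'a::banach"
  assumes f: "f \<in> L1_on {a..b}"
  shows "f integrable_on {a..b}"
proof -
  obtain s where s: "\<And>n. simple_function (lebesgue_on {a..b}) (s n)"
    "\<And>n::nat. integrable (lebesgue_on {a..b}) (\<lambda>t. norm (f t - s n t))"
    "(\<lambda>n. LINT t|lebesgue_on {a..b}. norm (f t - s n t)) \<longlonglongrightarrow> 0"
    using L1_on_simple_approximation[OF f] by auto
  note hi = has_integral_integral_lebesgue_on[OF s(2)]
  show ?thesis
  proof (rule integrable_on_L1_limit[where s = s and \<phi> = "\<lambda>n t. norm (f t - s n t)"])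
    show "s n integrable_on {a..b}" for n by (rule integrable_on_simple_function[OF s(1)])
    show "(\<lambda>t. norm (f t - s n t)) integrable_on {a..b}" for n using hi[of n] by auto
    show "(\<lambda>n. integral {a..b} (\<lambda>t. norm (f t - s n t))) \<longlonglongrightarrow> 0"
      using s(3) integral_unique[OF hi] by simp
  qed simp
qed

text \<open>Each \<open>h k\<close> is replaced by a simple function at distance less than \<open>2 ^ -k\<close> in \<open>L\<^sup>1\<close>; the distances
  are summable, so the differences tend to zero almost everywhere.\<close>

lemma strongly_measurable_on_AE_limit:
  fixes f :: "real \<Rightarrow> 'a::real_normed_vector"
  assumes S: "S \<in> sets lebesgue" and h: "\<And>k::nat. h k \<in> L1_on S" and lim: "AE t in lebesgue_on S. (\<lambda>k. h k t) \<longlonglongrightarrow> f t"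
  shows "strongly_measurable_on S f"
proof -
  have "\<exists>s. simple_function (lebesgue_on S) s \<and> integrable (lebesgue_on S) (\<lambda>t. norm (h k t - s t)) \<and>
      (LINT t|lebesgue_on S. norm (h k t - s t)) < (1/2)^k" for k
  proof -
    obtain s where s: "\<And>n. simple_function (lebesgue_on S) (s n)"
      "\<And>n::nat. integrable (lebesgue_on S) (\<lambda>t. norm (h k t - s n t))"
      "(\<lambda>n. LINT t|lebesgue_on S. norm (h k t - s n t)) \<longlonglongrightarrow> 0"
      using L1_on_simple_approximation[OF h S] by blast
    have "eventually (\<lambda>n. (LINT t|lebesgue_on S. norm (h k t - s n t)) < (1/2)^k) sequentially"
      by (rule order_tendstoD(2)[OF s(3)]) simp
    then show ?thesis using s(1,2) unfolding eventually_sequentially by blast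
  qed
  then obtain s where s: "\<And>k. simple_function (lebesgue_on S) (s k)"
    "\<And>k. integrable (lebesgue_on S) (\<lambda>t. norm (h k t - s k t))"
    "\<And>k::nat. (LINT t|lebesgue_on S. norm (h k t - s k t)) < (1/2)^k" by metis
  have "summable (\<lambda>k. LINT t|lebesgue_on S. norm (h k t - s k t))"
    by (rule summable_comparison_test[OF _ summable_geometric[of "1/2::real"]])
      (use s(3) in \<open>auto intro!: exI[of _ 0] less_imp_le simp: abs_of_nonneg\<close>)
  then have "AE t in lebesgue_on S. summable (\<lambda>k. norm (h k t - s k t))"
    by (intro AE_summable_of_summable_integrals s(2)) auto
  then have "AE t in lebesgue_on S. (\<lambda>k. s k t) \<longlonglongrightarrow> f t"
    using lim
  proof eventually_elim
    case (elim t)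
    have "(\<lambda>k. h k t - s k t) \<longlonglongrightarrow> 0" using summable_LIMSEQ_zero[OF elim(1)] tendsto_norm_zero_iff by blast
    from tendsto_diff[OF elim(2) this] show ?case by simp
  qed
  then show ?thesis unfolding strongly_measurable_on_def using s(1) by blast
qed

section \<open>Nested convex sets of dominated functions\<close>

lemma dominated_imp_L1_on:
  fixes h :: "real \<Rightarrow> 'a::real_normed_vector"
  assumes S: "S \<in> sets lebesgue" and h: "strongly_measurable_on S h" and N: "integrable (lebesgue_on S) N"
    and bd: "\<And>t. t \<in> S \<Longrightarrow> norm (h t) \<le> N t"
  shows "h \<in> L1_on S"
proof -
  have "integrable (lebesgue_on S) (\<lambda>t. norm (h t))"
    by (rule Bochner_Integration.integrable_bound[OF N borel_measurable_norm_strongly_measurable[OF h S]])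
      (use bd in \<open>auto intro!: AE_I2 order_trans[OF _ abs_ge_self]\<close>)
  then show ?thesis using h unfolding L1_on_def by blast
qed

text \<open>This takes the place of weak compactness and of Mazur's lemma. All functions lie in a bounded
  subset of the Hilbert space with weight \<open>1 / (N + 1)\<close>. Let \<open>d n\<close> be the infimum of the squared norm over
  \<open>V n\<close>; these numbers increase to a limit, so by the parallelogram law elements of the sets whose
  squared norm is close enough to the limit form a Cauchy sequence. Convergence in the weighted norm is
  stronger than in \<open>L\<^sup>1\<close> because \<open>N + 1\<close> is integrable, and geometric rates give convergence almost
  everywhere. Only midpoints enter, so \<open>V\<close> need not be given as convex sets of a vector space type.\<close>

lemma nested_dominated_convex_sets:
  fixes V :: "nat \<Rightarrow> (real \<Rightarrow> 'a::{real_inner,banach}) set"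
  assumes ne: "\<And>n. V n \<noteq> {}" and dec: "decseq V"
    and meas: "\<And>n h. h \<in> V n \<Longrightarrow> strongly_measurable_on {a..b} h"
    and bd: "\<And>n h t. h \<in> V n \<Longrightarrow> t \<in> {a..b} \<Longrightarrow> norm (h t) \<le> N t"
    and mid: "\<And>n h g. h \<in> V n \<Longrightarrow> g \<in> V n \<Longrightarrow> (\<lambda>t. (1/2) *\<^sub>R (h t + g t)) \<in> V n"
    and N: "integrable (lebesgue_on {a..b}) N"
  shows "\<exists>h f. (\<forall>k. h k \<in> V k) \<and> strongly_measurable_on {a..b} f \<and> (\<forall>t\<in>{a..b}. norm (f t) \<le> N t) \<and>
    (AE t in lebesgue_on {a..b}. (\<lambda>k. h k t) \<longlonglongrightarrow> f t)"
proof -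
  let ?M = "lebesgue_on {a..b}"
  have S: "{a..b} \<in> sets lebesgue" by simp
  interpret finite_measure ?M by (rule finite_measure_lebesgue_on_Icc)
  have N0: "N t \<ge> 0" if "t \<in> {a..b}" for t
    using ne[of 0] bd[OF _ that] norm_ge_zero order_trans by blast
  have [measurable]: "N \<in> borel_measurable ?M" using N by auto
  define D where "D h t = (norm (h t))\<^sup>2 / (N t + 1)" for h :: "real \<Rightarrow> 'a" and t
  define En where "En h = (LINT t|?M. D h t)" for h
  have D_int: "integrable ?M (D h)" if h: "strongly_measurable_on {a..b} h" "\<And>t. t \<in> {a..b} \<Longrightarrow> norm (h t) \<le> 2 * N t" for h
  proof (rule Bochner_Integration.integrable_bound[of _ "\<lambda>t. 4 * N t"])
    have [measurable]: "(\<lambda>t. norm (h t)) \<in> borel_measurable ?M"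
      by (rule borel_measurable_norm_strongly_measurable[OF h(1) S])
    show "D h \<in> borel_measurable ?M" unfolding D_def by measurable
    show "AE t in ?M. norm (D h t) \<le> norm (4 * N t)"
    proof (rule AE_I2)
      fix t assume "t \<in> space ?M" then have t: "t \<in> {a..b}" by simp
      have "(norm (h t))\<^sup>2 \<le> (2 * N t)\<^sup>2" using h(2)[OF t] by (rule power_mono) simp
      also have "\<dots> \<le> 4 * N t * (N t + 1)" using N0[OF t] by (simp add: power2_eq_square algebra_simps)
      finally show "norm (D h t) \<le> norm (4 * N t)" unfolding D_def using N0[OF t] by (simp add: divide_le_eq)
    qed
  qed (use N in simp)
  have V_int: "integrable ?M (D h)" if "h \<in> V n" for h n
    by (rule D_int[OF meas[OF that]]) (use bd[OF that] N0 in \<open>fastforce\<close>)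
  have En_bound: "0 \<le> En h" "En h \<le> (LINT t|?M. N t)" if "h \<in> V n" for h n
  proof -
    show "0 \<le> En h" unfolding En_def using N0
      by (intro integral_nonneg_AE AE_I2) (simp add: D_def)
    show "En h \<le> (LINT t|?M. N t)" unfolding En_def
    proof (rule integral_mono[OF V_int[OF that] N])
      fix t assume "t \<in> space ?M" then have t: "t \<in> {a..b}" by simp
      have "(norm (h t))\<^sup>2 \<le> (N t)\<^sup>2" using bd[OF that t] by (rule power_mono) simp
      also have "\<dots> \<le> N t * (N t + 1)" using N0[OF t] by (simp add: power2_eq_square algebra_simps)
      finally show "D h t \<le> N t" unfolding D_def using N0[OF t] by (simp add: divide_le_eq)
    qed
  qed
  \<comment> \<open>The parallelogram law in the Hilbert space with weight \<open>1 / (N + 1)\<close>.\<close>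
  have par: "En (\<lambda>t. h t - g t) = 2 * En h + 2 * En g - 4 * En (\<lambda>t. (1/2) *\<^sub>R (h t + g t))"
    if "h \<in> V n" "g \<in> V n" for h g n
  proof -
    have "(norm (x - y))\<^sup>2 = 2 * (norm x)\<^sup>2 + 2 * (norm y)\<^sup>2 - 4 * (norm ((1/2) *\<^sub>R (x + y)))\<^sup>2" for x y :: 'a
      unfolding power2_norm_eq_inner by (simp add: inner_simps inner_commute field_simps)
    then have "D (\<lambda>t. h t - g t) = (\<lambda>t. 2 * D h t + 2 * D g t - 4 * D (\<lambda>t. (1/2) *\<^sub>R (h t + g t)) t)"
      unfolding D_def by (simp only: diff_divide_distrib add_divide_distrib times_divide_eq_right)
    then show ?thesis unfolding En_def
      using V_int[OF that(1)] V_int[OF that(2)] V_int[OF mid[OF that]] by simp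
  qed
  have Vsub: "h \<in> V m" if "h \<in> V n" "m \<le> n" for h m n using decseqD[OF dec that(2)] that(1) by auto
  define d where "d n = (INF h\<in>V n. En h)" for n
  have bdd: "bdd_below (En ` V n)" for n using En_bound by (intro bdd_belowI[of _ 0]) auto
  have d_le: "d n \<le> En h" if "h \<in> V n" for n h unfolding d_def using bdd that by (rule cINF_lower)
  have d_mono: "d m \<le> d n" if "m \<le> n" for m n
    unfolding d_def using bdd ne Vsub that by (intro cINF_superset_mono) auto
  have d_bd: "d n \<le> (LINT t|?M. N t)" for n using ne d_le En_bound(2) by (meson all_not_in_conv order_trans)
  define dsup where "dsup = (SUP n. d n)"
  have bdd_d: "bdd_above (range d)" using d_bd by (intro bdd_aboveI) auto
  have d_sup: "d n \<le> dsup" for n unfolding dsup_def using bdd_d by (intro cSUP_upper) auto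
  \<comment> \<open>The parallelogram law loses a factor 8, and the passage to \<open>L\<^sup>1\<close> a further \<open>4 ^ k\<close>.\<close>
  define \<delta> where "\<delta> k = (1/16)^k / (8::real)" for k :: nat
  have \<delta>: "\<delta> k > 0" "\<delta> (Suc k) \<le> \<delta> k" for k unfolding \<delta>_def by auto
  have "\<exists>n\<ge>k. d n > dsup - \<delta> k \<and> (\<exists>h\<in>V n. En h < dsup + \<delta> k)" for k
  proof -
    have "\<exists>m. dsup - \<delta> k < d m"
      using less_cSUP_iff[OF _ bdd_d, of "dsup - \<delta> k"] \<delta>(1)[of k] unfolding dsup_def by simp
    then obtain m where m: "dsup - \<delta> k < d m" by blast
    define n where "n = max m k"
    have "d n > dsup - \<delta> k" using m d_mono[of m n] unfolding n_def by simp
    moreover have "d n < dsup + \<delta> k" using d_sup[of n] \<delta>(1)[of k] by simp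
    ultimately show ?thesis using cINF_less_iff[OF ne bdd, of n "dsup + \<delta> k"] unfolding d_def n_def
      by (intro exI[of _ "max m k"]) auto
  qed
  then obtain n h where n: "\<And>k. n k \<ge> k" "\<And>k. d (n k) > dsup - \<delta> k"
    and h: "\<And>k. h k \<in> V (n k)" "\<And>k. En (h k) < dsup + \<delta> k" by metis
  have hV: "h k \<in> V k" for k using Vsub h(1) n(1) by blast
  have diff: "En (\<lambda>t. h (Suc k) t - h k t) \<le> (1/16)^k" for k
  proof -
    define m where "m = min (n k) (n (Suc k))"
    have V: "h (Suc k) \<in> V m" "h k \<in> V m" using h(1) Vsub unfolding m_def by (meson min.cobounded1 min.cobounded2)+
    have "d m > dsup - \<delta> k" using n(2)[of k] n(2)[of "Suc k"] \<delta>(2)[of k] unfolding m_def min_def by (auto split: if_splits)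
    then have "En (\<lambda>t. (1/2) *\<^sub>R (h (Suc k) t + h k t)) > dsup - \<delta> k" using d_le[OF mid[OF V]] by linarith
    then have "En (\<lambda>t. h (Suc k) t - h k t) \<le> 8 * \<delta> k"
      unfolding par[OF V] using h(2)[of k] h(2)[of "Suc k"] \<delta>(2)[of k] by linarith
    then show ?thesis unfolding \<delta>_def by simp
  qed
  have dsm: "strongly_measurable_on {a..b} (\<lambda>t. h (Suc k) t - h k t)" for k
    by (intro strongly_measurable_on_diff meas[OF hV])
  have dbd: "norm (h (Suc k) t - h k t) \<le> 2 * N t" if "t \<in> {a..b}" for k t
    using norm_triangle_ineq4[of "h (Suc k) t" "h k t"] bd[OF hV that, of k] bd[OF hV that, of "Suc k"] by simp
  have N2: "integrable ?M (\<lambda>t. 2 * N t)" using N by simp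
  have dint: "integrable ?M (\<lambda>t. norm (h (Suc k) t - h k t))" for k
    using dominated_imp_L1_on[OF S dsm N2 dbd] unfolding L1_on_def by blast
  define T where "T = (LINT t|?M. N t + 1)"
  have N1: "integrable ?M (\<lambda>t. N t + 1)" using N by simp
  have l1: "(LINT t|?M. norm (h (Suc k) t - h k t)) \<le> (1/2) * (1 + T) * (1/4)^k" for k
  proof -
    let ?g = "\<lambda>t. h (Suc k) t - h k t"
    have "(LINT t|?M. norm (?g t)) \<le> (LINT t|?M. (1/2) * (4^k * D ?g t) + (1/2) * ((1/4)^k * (N t + 1)))"
    proof (rule integral_mono)
      fix t assume "t \<in> space ?M" then have t: "t \<in> {a..b}" by simp
      \<comment> \<open>The weighted inequality \<open>2 x \<le> c x\<^sup>2 / w + w / c\<close> with \<open>c = 4 ^ k\<close>\<close>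
      have pos: "N t + 1 > 0" using N0[OF t] by simp
      have "0 \<le> (2^k * norm (?g t) - (1/2)^k * (N t + 1))\<^sup>2" by simp
      also have "\<dots> = 4^k * (norm (?g t))\<^sup>2 + (1/4)^k * (N t + 1)\<^sup>2 - 2 * norm (?g t) * (N t + 1)"
      proof -
        have "(2^k * (1/2)^k) = (1::real)" "(2^k)\<^sup>2 = (4::real)^k" "((1/2)^k)\<^sup>2 = (1/4::real)^k"
          by (simp_all add: power_mult_distrib[symmetric] power2_eq_square)
        moreover have "(p * x - q * w)\<^sup>2 = p\<^sup>2 * x\<^sup>2 + q\<^sup>2 * w\<^sup>2 - 2 * (p * q) * (x * w)" for p q x w :: real
          by (simp add: power2_eq_square algebra_simps)
        ultimately show ?thesis by simp
      qed
      finally have "2 * norm (?g t) \<le> (4^k * (norm (?g t))\<^sup>2 + (1/4)^k * (N t + 1)\<^sup>2) / (N t + 1)"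
        using pos by (simp add: le_divide_eq)
      also have "\<dots> = 4^k * D ?g t + (1/4)^k * (N t + 1)"
        unfolding D_def using pos by (simp add: field_simps power2_eq_square)
      finally show "norm (?g t) \<le> (1/2) * (4^k * D ?g t) + (1/2) * ((1/4)^k * (N t + 1))" by simp
    qed (use dint D_int[OF dsm dbd] N1 in auto)
    also have "\<dots> = (1/2) * (4^k * En ?g) + (1/2) * ((1/4)^k * T)"
      unfolding En_def T_def using D_int[OF dsm dbd] N1
      by (subst Bochner_Integration.integral_add) simp_all
    also have "\<dots> \<le> (1/2) * (4^k * (1/16)^k) + (1/2) * ((1/4)^k * T)"
      using diff by (intro add_mono mult_left_mono) auto
    also have "4^k * (1/16)^k = (1/4::real)^k" by (simp add: power_mult_distrib[symmetric])
    finally show ?thesis by (simp add: algebra_simps)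
  qed
  have "summable (\<lambda>k. LINT t|?M. norm (h (Suc k) t - h k t))"
  proof (rule summable_comparison_test)
    show "summable (\<lambda>k. (1/2) * (1 + T) * (1/4::real)^k)" by (intro summable_mult summable_geometric) simp
    show "\<exists>N. \<forall>n\<ge>N. norm (LINT t|?M. norm (h (Suc n) t - h n t)) \<le> (1/2) * (1 + T) * (1/4)^n"
      using l1 by (intro exI[of _ 0]) (simp add: abs_of_nonneg)
  qed
  then have "AE t in ?M. summable (\<lambda>k. norm (h (Suc k) t - h k t))"
    by (intro AE_summable_of_summable_integrals dint) auto
  then have conv: "AE t in ?M. convergent (\<lambda>k. h k t)"
  proof eventually_elim
    case (elim t)
    then have "convergent (\<lambda>n. \<Sum>k<n. h (Suc k) t - h k t)"
      using summable_norm_cancel by (simp add: summable_iff_convergent)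
    then have "convergent (\<lambda>n. h n t - h 0 t)" by (simp add: sum_lessThan_telescope[of "\<lambda>k. h k t"])
    then show ?case using convergent_add[OF _ convergent_const[of "h 0 t"]] by fastforce
  qed
  define f where "f t = (if convergent (\<lambda>k. h k t) then lim (\<lambda>k. h k t) else 0)" for t
  have lim: "AE t in ?M. (\<lambda>k. h k t) \<longlonglongrightarrow> f t"
    using conv by eventually_elim (simp add: f_def convergent_LIMSEQ_iff)
  have "norm (f t) \<le> N t" if "t \<in> {a..b}" for t
  proof (cases "convergent (\<lambda>k. h k t)")
    case True
    then have "(\<lambda>k. norm (h k t)) \<longlonglongrightarrow> norm (f t)" unfolding f_def by (intro tendsto_norm) (simp add: convergent_LIMSEQ_iff)
    then show ?thesis by (rule LIMSEQ_le_const2) (use bd[OF hV that] in auto)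
  qed (use N0[OF that] in \<open>simp add: f_def\<close>)
  moreover have "strongly_measurable_on {a..b} f"
    by (rule strongly_measurable_on_AE_limit[OF S _ lim]) (rule dominated_imp_L1_on[OF S meas[OF hV] N bd[OF hV]])
  ultimately show ?thesis using hV lim by blast
qed

section \<open>Total boundedness of sets of integrals\<close>

text \<open>Total boundedness at the single scale \<open>r\<close>; keeping the radius explicit allows it to be added up
  along sums and approximations.\<close>

definition finite_cover :: "real \<Rightarrow> 'a::metric_space set \<Rightarrow> bool" where
  "finite_cover r A \<longleftrightarrow> (\<exists>k. finite k \<and> A \<subseteq> (\<Union>c\<in>k. ball c r))"

lemma finite_cover_subset: "finite_cover r B \<Longrightarrow> A \<subseteq> B \<Longrightarrow> finite_cover r A"
  unfolding finite_cover_def by (meson subset_trans)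

lemma finite_cover_near:
  assumes "finite_cover r A" "\<And>b. b \<in> B \<Longrightarrow> \<exists>a\<in>A. dist a b \<le> s"
  shows "finite_cover (r + s) B"
proof -
  obtain k where k: "finite k" "A \<subseteq> (\<Union>c\<in>k. ball c r)" using assms(1) unfolding finite_cover_def by blast
  have "B \<subseteq> (\<Union>c\<in>k. ball c (r + s))"
  proof
    fix b assume "b \<in> B"
    then obtain a where a: "a \<in> A" "dist a b \<le> s" using assms(2) by blast
    then obtain c where "c \<in> k" "dist c a < r" using k(2) by auto
    then show "b \<in> (\<Union>c\<in>k. ball c (r + s))"
      using dist_triangle[of c b a] a(2) by (intro UN_I[of c]) (auto simp: mem_ball)
  qed
  then show ?thesis unfolding finite_cover_def using k(1) by blast
qed

lemma finite_cover_mono: "finite_cover r A \<Longrightarrow> r \<le> s \<Longrightarrow> finite_cover s A"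
  using finite_cover_near[of r A A "s - r"] by (force intro: bexI)

lemma finite_cover_plus:
  fixes A B :: "'a::real_normed_vector set"
  assumes "finite_cover r A" "finite_cover s B"
  shows "finite_cover (r + s) {x + y |x y. x \<in> A \<and> y \<in> B}"
proof -
  obtain k where k: "finite k" "A \<subseteq> (\<Union>c\<in>k. ball c r)" using assms(1) unfolding finite_cover_def by blast
  obtain l where l: "finite l" "B \<subseteq> (\<Union>c\<in>l. ball c s)" using assms(2) unfolding finite_cover_def by blast
  have "{x + y |x y. x \<in> A \<and> y \<in> B} \<subseteq> (\<Union>c\<in>(\<lambda>(x, y). x + y) ` (k \<times> l). ball c (r + s))"
  proof clarify
    fix x y assume "x \<in> A" "y \<in> B"
    then obtain c d where c: "c \<in> k" "dist c x < r" and d: "d \<in> l" "dist d y < s" 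
      using subsetD[OF k(2)] subsetD[OF l(2)] by (metis UN_E mem_ball)
    have "norm (c + d - (x + y)) \<le> norm (c - x) + norm (d - y)" by (rule norm_diff_triangle_ineq)
    then have "c + d \<in> (\<lambda>(x, y). x + y) ` (k \<times> l)" "x + y \<in> ball (c + d) (r + s)"
      using c d by (auto simp: dist_norm)
    then show "x + y \<in> (\<Union>c\<in>(\<lambda>(x, y). x + y) ` (k \<times> l). ball c (r + s))" by blast
  qed
  moreover have "finite ((\<lambda>(x, y). x + y) ` (k \<times> l))" using k(1) l(1) by simp
  ultimately show ?thesis unfolding finite_cover_def by blast
qed

lemma compact_operator_finite_cover:
  fixes T :: "'a::real_normed_vector \<Rightarrow> 'b::real_normed_vector"
  assumes "compact_operator T" "\<epsilon> > 0"
  shows "finite_cover \<epsilon> (T ` cball 0 r)"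
proof -
  have "compact (closure (T ` cball 0 r))" using assms(1) unfolding compact_operator_def by simp
  then have "finite_cover \<epsilon> (closure (T ` cball 0 r))"
    using assms(2) unfolding compact_eq_totally_bounded finite_cover_def by blast
  then show ?thesis using finite_cover_subset closure_subset by blast
qed

lemma compact_operatorI:
  fixes T :: "'a::real_normed_vector \<Rightarrow> 'b::banach"
  assumes T: "bounded_linear T" and cov: "\<And>\<epsilon>. \<epsilon> > 0 \<Longrightarrow> finite_cover \<epsilon> (T ` cball 0 1)"
  shows "compact_operator T"
  unfolding compact_operator_def
proof (intro conjI T allI impI)
  interpret bounded_linear T by (rule T)
  fix M :: "'a set" assume "bounded M"
  then obtain r where r: "r > 0" "\<forall>x\<in>M. norm x \<le> r" unfolding bounded_pos by auto
  have "finite_cover \<epsilon> (closure (T ` M))" if \<epsilon>: "\<epsilon> > 0" for \<epsilon>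
  proof -
    obtain k where k: "finite k" "T ` cball 0 1 \<subseteq> (\<Union>c\<in>k. ball c (\<epsilon> / 2 / r))"
      using cov[of "\<epsilon> / 2 / r"] \<epsilon> r unfolding finite_cover_def by auto
    have "T ` M \<subseteq> (\<Union>c\<in>(\<lambda>c. r *\<^sub>R c) ` k. ball c (\<epsilon> / 2))"
    proof clarify
      fix x assume "x \<in> M"
      then have "(1 / r) *\<^sub>R x \<in> cball 0 1" using r by (auto simp: divide_le_eq)
      then have "T ((1 / r) *\<^sub>R x) \<in> (\<Union>c\<in>k. ball c (\<epsilon> / 2 / r))" using k(2) by blast
      then obtain c where c: "c \<in> k" "dist c (T ((1 / r) *\<^sub>R x)) < \<epsilon> / 2 / r" by (metis UN_E mem_ball)
      have "T x = r *\<^sub>R T ((1 / r) *\<^sub>R x)" using r by (simp add: scaleR)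
      then have "dist (r *\<^sub>R c) (T x) = r * dist c (T ((1 / r) *\<^sub>R x))"
        using r by (simp add: dist_norm flip: scaleR_diff_right)
      also have "\<dots> < r * (\<epsilon> / 2 / r)" using c(2) r(1) by (intro mult_strict_left_mono)
      finally show "T x \<in> (\<Union>c\<in>(\<lambda>c. r *\<^sub>R c) ` k. ball c (\<epsilon> / 2))" using c(1) r by (auto simp: mem_ball)
    qed
    then have "finite_cover (\<epsilon> / 2) (T ` M)" unfolding finite_cover_def using finite_imageI[OF k(1)] by blast
    then have "finite_cover (\<epsilon> / 2 + \<epsilon> / 2) (closure (T ` M))"
      by (rule finite_cover_near) (use \<epsilon> closure_approachable[of _ "T ` M"] in \<open>meson half_gt_zero less_imp_le\<close>)
    then show ?thesis by simp
  qed
  then show "compact (closure (T ` M))"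
    unfolding compact_eq_totally_bounded finite_cover_def by (simp add: complete_eq_closed)
qed

lemma continuous_operator_near:
  fixes P :: "real \<Rightarrow> 'a::real_normed_vector \<Rightarrow>\<^sub>L 'b::real_normed_vector"
  assumes P: "continuous_on {\<alpha>..\<beta>} P" and x: "x \<in> {\<alpha>..\<beta>}" and \<epsilon>: "\<epsilon> > 0"
  shows "\<exists>d>0. \<forall>c e t v. c \<le> x \<and> x \<le> e \<and> e - c < d \<and> t \<in> {c..e} \<and> t \<in> {\<alpha>..\<beta>} \<longrightarrow> norm (P t v - P x v) \<le> \<epsilon> * norm v"
proof -
  obtain d where d: "d > 0" "\<And>t. t \<in> {\<alpha>..\<beta>} \<Longrightarrow> dist t x < d \<Longrightarrow> dist (P t) (P x) < \<epsilon>"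
    using P x \<epsilon> unfolding continuous_on_iff by blast
  have "norm (P t v - P x v) \<le> \<epsilon> * norm v"
    if "c \<le> x" "x \<le> e" "e - c < d" "t \<in> {c..e}" "t \<in> {\<alpha>..\<beta>}" for c e t v
  proof -
    have "dist t x < d" using that by (auto simp: dist_real_def)
    then have "norm (P t - P x) \<le> \<epsilon>" using d(2) that(5) by (auto simp: dist_norm less_imp_le)
    then show ?thesis
      using norm_blinfun[of "P t - P x" v] by (simp add: blinfun.diff_left) (meson mult_right_mono norm_ge_zero order_trans)
  qed
  then show ?thesis using d(1) by blast
qed

text \<open>On a short interval \<open>P t\<close> is close in norm to a constant operator, which preserves integrability, and
  the error is at most \<open>\<epsilon> * N t\<close>. The property of being approximable in this way passes to unions of
  adjacent intervals, so Bolzano's bisection principle gives it on the whole interval.\<close>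

lemma integrable_on_continuous_operator:
  fixes P :: "real \<Rightarrow> 'a::banach \<Rightarrow>\<^sub>L 'b::banach"
  assumes P: "continuous_on {\<alpha>..\<beta>} P" and f: "f integrable_on {\<alpha>..\<beta>}" and N: "N integrable_on {\<alpha>..\<beta>}"
    and bd: "\<And>t. t \<in> {\<alpha>..\<beta>} \<Longrightarrow> norm (f t) \<le> N t"
  shows "(\<lambda>t. P t (f t)) integrable_on {\<alpha>..\<beta>}"
proof (cases "\<alpha> \<le> \<beta>")
  case True
  \<comment> \<open>Freezing the operator at one point of each short interval\<close>
  have frozen: "\<exists>s. s integrable_on {\<alpha>..\<beta>} \<and> (\<forall>t\<in>{\<alpha>..\<beta>}. norm (P t (f t) - s t) \<le> \<epsilon> * N t)" if \<epsilon>: "\<epsilon> > 0" for \<epsilon>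
  proof -
    define Q where "Q c e \<longleftrightarrow> (\<alpha> \<le> c \<and> e \<le> \<beta> \<longrightarrow>
        (\<exists>s. s integrable_on {c..e} \<and> (\<forall>t\<in>{c..e}. norm (P t (f t) - s t) \<le> \<epsilon> * N t)))" for c e
    have "Q \<alpha> \<beta>"
      using True
    proof (induction rule: Bolzano)
      case (trans c m e)
      show ?case
        unfolding Q_def
      proof
        assume "\<alpha> \<le> c \<and> e \<le> \<beta>"
        then obtain s r where s: "s integrable_on {c..m}" "\<forall>t\<in>{c..m}. norm (P t (f t) - s t) \<le> \<epsilon> * N t"
          and r: "r integrable_on {m..e}" "\<forall>t\<in>{m..e}. norm (P t (f t) - r t) \<le> \<epsilon> * N t"
          using trans unfolding Q_def by fastforce
        define q where "q t = (if t \<le> m then s t else r t)" for t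
        have "q integrable_on {c..m}" using s(1) by (rule integrable_eq) (simp add: q_def)
        moreover have "q integrable_on {m..e}"
          using r(1) by (rule integrable_spike_finite[of "{m}", rotated 2]) (auto simp: q_def)
        ultimately have "q integrable_on {c..e}" by (rule Henstock_Kurzweil_Integration.integrable_combine[OF trans(3,4)])
        then show "\<exists>s. s integrable_on {c..e} \<and> (\<forall>t\<in>{c..e}. norm (P t (f t) - s t) \<le> \<epsilon> * N t)"
          using s(2) r(2) by (intro exI[of _ q]) (auto simp: q_def)
      qed
    next
      case (local x)
      then obtain d where d: "d > 0" "\<And>c e t v. c \<le> x \<Longrightarrow> x \<le> e \<Longrightarrow> e - c < d \<Longrightarrow> t \<in> {c..e} \<Longrightarrow> t \<in> {\<alpha>..\<beta>}
          \<Longrightarrow> norm (P t v - P x v) \<le> \<epsilon> * norm v"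
        using continuous_operator_near[OF P _ \<epsilon>, of x] by auto
      have "\<exists>s. s integrable_on {c..e} \<and> (\<forall>t\<in>{c..e}. norm (P t (f t) - s t) \<le> \<epsilon> * N t)"
        if ce: "c \<le> x" "x \<le> e" "e - c < d" "\<alpha> \<le> c" "e \<le> \<beta>" for c e
      proof (intro exI conjI ballI)
        have "f integrable_on {c..e}" by (rule integrable_subinterval_real[OF f]) (use ce in auto)
        from integrable_linear[OF this blinfun.bounded_linear_right[of "P x"]]
        show "(\<lambda>t. P x (f t)) integrable_on {c..e}" by (simp add: o_def)
        fix t assume t: "t \<in> {c..e}"
        then have "t \<in> {\<alpha>..\<beta>}" using ce by auto
        then show "norm (P t (f t) - P x (f t)) \<le> \<epsilon> * N t"
          using d(2)[OF ce(1-3) t, of "f t"] bd[of t] \<epsilon> by (meson mult_left_mono less_imp_le order_trans)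
      qed
      then show ?case unfolding Q_def using d(1) by blast
    qed
    then show ?thesis unfolding Q_def by simp
  qed
  have "\<exists>s. s integrable_on {\<alpha>..\<beta>} \<and> (\<forall>t\<in>{\<alpha>..\<beta>}. norm (P t (f t) - s t) \<le> (1 / real (Suc n)) * N t)" for n :: nat
    by (rule frozen) simp
  then obtain s where s: "\<And>n::nat. s n integrable_on {\<alpha>..\<beta>}"
    "\<And>n t. t \<in> {\<alpha>..\<beta>} \<Longrightarrow> norm (P t (f t) - s n t) \<le> (1 / real (Suc n)) * N t" by metis
  show ?thesis
  proof (rule integrable_on_L1_limit[OF s(1) _ s(2)])
    show "(\<lambda>t. (1 / real (Suc n)) * N t) integrable_on {\<alpha>..\<beta>}" for n using N by (rule integrable_on_mult_right)
    have "(\<lambda>n. (1 / real (Suc n)) * integral {\<alpha>..\<beta>} N) \<longlonglongrightarrow> 0 * integral {\<alpha>..\<beta>} N"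
      by (intro tendsto_intros LIMSEQ_Suc[OF lim_1_over_n])
    then show "(\<lambda>n. integral {\<alpha>..\<beta>} (\<lambda>t. (1 / real (Suc n)) * N t)) \<longlonglongrightarrow> 0" by simp
  qed
qed (simp add: integrable_on_empty)

text \<open>On a short interval the integral is, up to \<open>\<delta>\<close> times the integral of \<open>N\<close>, the image of a bounded
  vector under one compact operator. Errors of this form add up over adjacent intervals without
  growing, whatever the number of intervals, while the slack \<open>\<eta>\<close> can be split at will; so bisection
  applies again.\<close>

lemma totally_bounded_integrals:
  fixes P :: "real \<Rightarrow> 'a::banach \<Rightarrow>\<^sub>L 'b::banach"
  assumes "\<alpha> \<le> \<beta>" and P: "continuous_on {\<alpha>..\<beta>} P" and cpt: "\<And>t. t \<in> {\<alpha>..\<beta>} \<Longrightarrow> compact_operator (blinfun_apply (P t))"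
    and N: "N integrable_on {\<alpha>..\<beta>}" and N0: "\<And>t. t \<in> {\<alpha>..\<beta>} \<Longrightarrow> 0 \<le> N t" and "\<epsilon> > 0"
  shows "finite_cover \<epsilon> {integral {\<alpha>..\<beta>} (\<lambda>t. P t (f t)) |f. f integrable_on {\<alpha>..\<beta>} \<and> (\<forall>t\<in>{\<alpha>..\<beta>}. norm (f t) \<le> N t)}"
proof -
  let ?F = "{f. f integrable_on {\<alpha>..\<beta>} \<and> (\<forall>t\<in>{\<alpha>..\<beta>}. norm (f t) \<le> N t)}"
  define R where "R c e = {integral {c..e} (\<lambda>t. P t (f t)) |f. f \<in> ?F}" for c e
  have Pf: "(\<lambda>t. P t (f t)) integrable_on {\<alpha>..\<beta>}" if "f \<in> ?F" for f
    using that by (intro integrable_on_continuous_operator[OF P _ N]) auto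
  have cover: "finite_cover (\<delta> * integral {\<alpha>..\<beta>} N + \<eta>) (R \<alpha> \<beta>)" if \<delta>: "\<delta> > 0" and "\<eta> > 0" for \<delta> \<eta>
  proof -
    define Q where "Q c e \<longleftrightarrow> (\<alpha> \<le> c \<and> e \<le> \<beta> \<longrightarrow>
        (\<forall>\<eta>>0. finite_cover (\<delta> * integral {c..e} N + \<eta>) (R c e)))" for c e
    have "Q \<alpha> \<beta>"
      using assms(1)
    proof (induction rule: Bolzano)
      case (trans c m e)
      show ?case
        unfolding Q_def
      proof (intro impI allI)
        fix \<eta> :: real assume a: "\<alpha> \<le> c \<and> e \<le> \<beta>" "\<eta> > 0"
        have "finite_cover (\<delta> * integral {c..m} N + \<eta>/2) (R c m)" "finite_cover (\<delta> * integral {m..e} N + \<eta>/2) (R m e)"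
          using trans a unfolding Q_def by auto
        note cov = finite_cover_plus[OF this]
        have sub: "R c e \<subseteq> {x + y |x y. x \<in> R c m \<and> y \<in> R m e}"
        proof
          fix z assume "z \<in> R c e"
          then obtain f where f: "f \<in> ?F" "z = integral {c..e} (\<lambda>t. P t (f t))" unfolding R_def by blast
          have "(\<lambda>t. P t (f t)) integrable_on {c..e}"
            by (rule integrable_subinterval_real[OF Pf[OF f(1)]]) (use a in auto)
          then have "z = integral {c..m} (\<lambda>t. P t (f t)) + integral {m..e} (\<lambda>t. P t (f t))"
            unfolding f(2) by (rule Henstock_Kurzweil_Integration.integral_combine[OF trans(3,4), symmetric])
          then show "z \<in> {x + y |x y. x \<in> R c m \<and> y \<in> R m e}" unfolding R_def using f(1) by blast
        qed
        have eq: "\<delta> * integral {c..m} N + \<eta>/2 + (\<delta> * integral {m..e} N + \<eta>/2) = \<delta> * integral {c..e} N + \<eta>"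
        proof -
          have "N integrable_on {c..e}" by (rule integrable_subinterval_real[OF N]) (use a in auto)
          then have "integral {c..m} N + integral {m..e} N = integral {c..e} N"
            using trans(3,4) by (intro Henstock_Kurzweil_Integration.integral_combine)
          from this[symmetric] show ?thesis by (simp add: algebra_simps)
        qed
        show "finite_cover (\<delta> * integral {c..e} N + \<eta>) (R c e)"
          using finite_cover_subset[OF cov sub] unfolding eq .
      qed
    next
      case (local x)
      then have x: "x \<in> {\<alpha>..\<beta>}" by simp
      obtain d where d: "d > 0" "\<And>c e t v. c \<le> x \<Longrightarrow> x \<le> e \<Longrightarrow> e - c < d \<Longrightarrow> t \<in> {c..e} \<Longrightarrow> t \<in> {\<alpha>..\<beta>}
          \<Longrightarrow> norm (P t v - P x v) \<le> \<delta> * norm v"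
        using continuous_operator_near[OF P x \<delta>] by auto
      have "finite_cover (\<delta> * integral {c..e} N + \<eta>) (R c e)"
        if ce: "c \<le> x" "x \<le> e" "e - c < d" "\<alpha> \<le> c" "e \<le> \<beta>" and \<eta>: "\<eta> > 0" for c e \<eta>
      proof -
        have sub: "{c..e} \<subseteq> {\<alpha>..\<beta>}" using ce by auto
        have Nce: "N integrable_on {c..e}" by (rule integrable_subinterval_real[OF N sub])
        have "finite_cover (\<eta> + \<delta> * integral {c..e} N) (R c e)"
        proof (rule finite_cover_near)
          show "finite_cover \<eta> (P x ` cball 0 (integral {c..e} N))"
            by (rule compact_operator_finite_cover[OF cpt[OF x] \<eta>])
          fix z assume "z \<in> R c e"
          then obtain f where f: "f \<in> ?F" "z = integral {c..e} (\<lambda>t. P t (f t))" unfolding R_def by blast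
          have fce: "f integrable_on {c..e}" by (rule integrable_subinterval_real[OF _ sub]) (use f in auto)
          have Pfce: "(\<lambda>t. P t (f t)) integrable_on {c..e}" by (rule integrable_subinterval_real[OF Pf[OF f(1)] sub])
          have Pxf: "(\<lambda>t. P x (f t)) integrable_on {c..e}" "integral {c..e} (\<lambda>t. P x (f t)) = P x (integral {c..e} f)"
            using integrable_linear[OF fce blinfun.bounded_linear_right[of "P x"]]
              integral_linear[OF fce blinfun.bounded_linear_right[of "P x"]] by (simp_all add: o_def)
          have "norm (integral {c..e} f) \<le> integral {c..e} N"
            by (rule integral_norm_bound_integral[OF fce Nce]) (use f(1) sub in auto)
          moreover have "norm (integral {c..e} (\<lambda>t. P x (f t) - P t (f t))) \<le> integral {c..e} (\<lambda>t. \<delta> * N t)"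
          proof (rule integral_norm_bound_integral)
            fix t assume t: "t \<in> {c..e}"
            then have "t \<in> {\<alpha>..\<beta>}" using sub by auto
            then show "norm (P x (f t) - P t (f t)) \<le> \<delta> * N t"
              using d(2)[OF ce(1-3) t, of "f t"] f(1) \<delta> unfolding norm_minus_commute[of "P x (f t)"]
              by (auto intro: order_trans[OF _ mult_left_mono])
          qed (use Pfce Pxf Nce in \<open>auto intro!: integrable_diff integrable_on_mult_right\<close>)
          then have "dist (P x (integral {c..e} f)) z \<le> \<delta> * integral {c..e} N"
            unfolding f(2) dist_norm using Pxf Pfce by (simp add: integral_diff)
          ultimately show "\<exists>a\<in>P x ` cball 0 (integral {c..e} N). dist a z \<le> \<delta> * integral {c..e} N" by auto
        qed
        then show ?thesis by (simp add: add.commute)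
      qed
      then show ?case unfolding Q_def using d(1) by blast
    qed
    then show ?thesis using that unfolding Q_def by simp
  qed
  define I where "I = integral {\<alpha>..\<beta>} N"
  have I: "I \<ge> 0" unfolding I_def using N N0 by (rule integral_nonneg)
  have "\<epsilon> / 2 / (I + 1) * I \<le> \<epsilon> / 2" using I \<open>\<epsilon> > 0\<close> by (simp add: field_simps)
  moreover have "finite_cover (\<epsilon> / 2 / (I + 1) * I + \<epsilon> / 2) (R \<alpha> \<beta>)"
    unfolding I_def by (rule cover) (use I \<open>\<epsilon> > 0\<close> I_def in auto)
  ultimately have "finite_cover \<epsilon> (R \<alpha> \<beta>)" using finite_cover_mono by (metis add.commute add_le_cancel_left field_sum_of_halves)
  then show ?thesis unfolding R_def by simp
qed

text \<open>By equicontinuity a function is known up to a small error from its values at finitely many times,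
  and each of these values from one of finitely many centres.\<close>

lemma Arzela_Ascoli_finite_cover:
  fixes \<F> :: "(real \<Rightarrow>\<^sub>C 'a::metric_space) set"
  assumes ext: "\<And>x t. x \<in> \<F> \<Longrightarrow> x t = x (clamp 0 b t)" and "b \<ge> 0"
    and eq: "\<And>\<epsilon>. \<epsilon> > 0 \<Longrightarrow> \<exists>\<delta>>0. \<forall>x\<in>\<F>. \<forall>t\<in>{0..b}. \<forall>s\<in>{0..b}. \<bar>t - s\<bar> < \<delta> \<longrightarrow> dist (x t) (x s) \<le> \<epsilon>"
    and pw: "\<And>t \<epsilon>. t \<in> {0..b} \<Longrightarrow> \<epsilon> > 0 \<Longrightarrow> finite_cover \<epsilon> ((\<lambda>x. apply_bcontfun x t) ` \<F>)"
    and "\<epsilon> > 0"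
  shows "finite_cover \<epsilon> \<F>"
proof -
  define e where "e = \<epsilon> / 5"
  have e: "e > 0" unfolding e_def using \<open>\<epsilon> > 0\<close> by simp
  obtain \<delta> where \<delta>: "\<delta> > 0" "\<And>x t s. x \<in> \<F> \<Longrightarrow> t \<in> {0..b} \<Longrightarrow> s \<in> {0..b} \<Longrightarrow> \<bar>t - s\<bar> < \<delta> \<Longrightarrow> dist (x t) (x s) \<le> e"
    using eq[OF e] by blast
  have "compact {0..b}" by simp
  then obtain T where T: "finite T" "T \<subseteq> {0..b}" "{0..b} \<subseteq> (\<Union>\<tau>\<in>T. ball \<tau> \<delta>)"
    using seq_compact_imp_totally_bounded \<delta>(1) compact_imp_seq_compact by metis
  have "\<exists>k. finite k \<and> (\<forall>x\<in>\<F>. \<exists>c\<in>k. dist c (x \<tau>) < e)" if "\<tau> \<in> T" for \<tau>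
  proof -
    have "\<tau> \<in> {0..b}" using that T(2) by blast
    from pw[OF this e] obtain k where k: "finite k" "(\<lambda>x. apply_bcontfun x \<tau>) ` \<F> \<subseteq> (\<Union>c\<in>k. ball c e)"
      unfolding finite_cover_def by blast
    have "\<exists>c\<in>k. dist c (x \<tau>) < e" if "x \<in> \<F>" for x
      using subsetD[OF k(2) imageI[OF that]] by auto
    then show ?thesis using k(1) by blast
  qed
  then obtain k where k: "\<And>\<tau>. \<tau> \<in> T \<Longrightarrow> finite (k \<tau>)" "\<And>\<tau> x. \<tau> \<in> T \<Longrightarrow> x \<in> \<F> \<Longrightarrow> \<exists>c\<in>k \<tau>. dist c (x \<tau>) < e" by metis
  define \<phi> where "\<phi> x \<tau> = (SOME c. c \<in> k \<tau> \<and> dist c (apply_bcontfun x \<tau>) < e)" for x \<tau>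
  have "\<phi> x \<tau> \<in> k \<tau> \<and> dist (\<phi> x \<tau>) (x \<tau>) < e" if "x \<in> \<F>" "\<tau> \<in> T" for x \<tau>
    unfolding \<phi>_def by (rule someI_ex) (use k(2)[OF that(2,1)] in blast)
  then have \<phi>: "\<phi> x \<tau> \<in> k \<tau>" "dist (\<phi> x \<tau>) (x \<tau>) < e" if "x \<in> \<F>" "\<tau> \<in> T" for x \<tau>
    using that by auto
  define \<psi> where "\<psi> x = restrict (\<phi> x) T" for x
  have "\<psi> ` \<F> \<subseteq> PiE T k" unfolding \<psi>_def using \<phi> by auto
  then have fin: "finite (\<psi> ` \<F>)" by (rule finite_subset) (rule finite_PiE[OF T(1) k(1)])
  have close: "dist x y \<le> 4 * e" if "x \<in> \<F>" "y \<in> \<F>" "\<psi> x = \<psi> y" for x y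
  proof (rule dist_bound)
    fix t
    define t' where "t' = clamp 0 b t"
    have t': "t' \<in> {0..b}" unfolding t'_def using clamp_in_interval[of 0 b t] \<open>b \<ge> 0\<close> by simp
    then obtain \<tau> where \<tau>: "\<tau> \<in> T" "dist \<tau> t' < \<delta>" using T(3) by auto
    have "\<phi> x \<tau> = \<phi> y \<tau>" using that(3) \<tau>(1) unfolding \<psi>_def by (metis restrict_apply')
    moreover have "dist (x t') (x \<tau>) \<le> e" "dist (y t') (y \<tau>) \<le> e"
      using \<delta>(2) that(1,2) t' \<tau> T(2) by (auto simp: dist_real_def abs_minus_commute)
    moreover have "dist (\<phi> x \<tau>) (x \<tau>) < e" "dist (\<phi> y \<tau>) (y \<tau>) < e" using \<phi>(2) that \<tau>(1) by auto
    ultimately have "dist (x t') (y t') \<le> 4 * e"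
      using dist_triangle[of "x t'" "y t'" "x \<tau>"] dist_triangle2[of "x \<tau>" "y t'" "y \<tau>"]
        dist_triangle3[of "x \<tau>" "y \<tau>" "\<phi> x \<tau>"] by simp
    then show "dist (x t) (y t) \<le> 4 * e" using ext[OF that(1), of t] ext[OF that(2), of t] unfolding t'_def by simp
  qed
  define r where "r p = (SOME x. x \<in> \<F> \<and> \<psi> x = p)" for p
  have r: "r (\<psi> x) \<in> \<F> \<and> \<psi> (r (\<psi> x)) = \<psi> x" if "x \<in> \<F>" for x
    unfolding r_def using someI[of "\<lambda>y. y \<in> \<F> \<and> \<psi> y = \<psi> x" x] that by simp
  have "\<F> \<subseteq> (\<Union>c\<in>r ` \<psi> ` \<F>. ball c \<epsilon>)"
  proof
    fix x assume x: "x \<in> \<F>"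
    have "dist (r (\<psi> x)) x < \<epsilon>" using close[of "r (\<psi> x)" x] r[OF x] x e unfolding e_def by simp
    then show "x \<in> (\<Union>c\<in>r ` \<psi> ` \<F>. ball c \<epsilon>)" using x by (auto simp: mem_ball)
  qed
  then show ?thesis unfolding finite_cover_def using finite_imageI[OF fin] by blast
qed

section \<open>Approximate fixed points\<close>

text \<open>Kuhn's lemma for the labelling by the sign of \<open>G w i - w i\<close> gives a small cube in which both labels
  occur in every coordinate. The dimension \<open>n\<close> is a number, so it may depend on a finite net chosen in
  the course of a proof.\<close>

lemma Brouwer_cube_approx:
  fixes G :: "(nat \<Rightarrow> real) \<Rightarrow> nat \<Rightarrow> real"
  assumes range: "\<And>w i. (\<forall>i<n. w i \<in> {0..1}) \<Longrightarrow> i < n \<Longrightarrow> G w i \<in> {0..1}"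
    and lip: "\<And>w w' d i. \<forall>i<n. w i \<in> {0..1} \<Longrightarrow> \<forall>i<n. w' i \<in> {0..1} \<Longrightarrow>
      \<forall>i<n. \<bar>w i - w' i\<bar> \<le> d \<Longrightarrow> i < n \<Longrightarrow> \<bar>G w i - G w' i\<bar> \<le> C * d"
    and "\<eta> > 0"
  shows "\<exists>w. (\<forall>i<n. w i \<in> {0..1}) \<and> (\<forall>i<n. \<bar>G w i - w i\<bar> < \<eta>)"
proof -
  obtain p :: nat where p: "(\<bar>C\<bar> + 1) / \<eta> < p" using reals_Archimedean2 by blast
  have "(\<bar>C\<bar> + 1) / \<eta> > 0" using \<open>\<eta> > 0\<close> by (simp add: add_nonneg_pos)
  then have p0: "p > 0" using p by (metis less_trans of_nat_0_less_iff)
  have small: "\<bar>C\<bar> * (1 / p) + 1 / p < \<eta>" using p p0 \<open>\<eta> > 0\<close> by (simp add: field_simps)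
  define W where "W x = (\<lambda>i. real (x i) / p)" for x :: "nat \<Rightarrow> nat"
  have W: "\<forall>i<n. W x i \<in> {0..1}" if "\<forall>i<n. x i \<le> p" for x
    unfolding W_def using that p0 by auto
  define lab :: "(nat \<Rightarrow> nat) \<Rightarrow> nat \<Rightarrow> nat" where
    "lab x i = (if x i = 0 then 0 else if x i = p then 1 else if W x i \<le> G (W x) i then 0 else 1)" for x i
  have lab0: "W x i \<le> G (W x) i" if "\<forall>i<n. x i \<le> p" "i < n" "lab x i = 0" for x i
    using that range[OF W[OF that(1)] that(2)] by (auto simp: lab_def W_def split: if_splits)
  have lab1: "G (W x) i \<le> W x i" if "\<forall>i<n. x i \<le> p" "i < n" "lab x i \<noteq> 0" for x i
    using that p0 range[OF W[OF that(1)] that(2)] by (auto simp: lab_def W_def split: if_splits)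
  obtain q where q: "\<forall>i<n. q i < p" and lq: "\<forall>i<n. \<exists>r s.
      (\<forall>j<n. q j \<le> r j \<and> r j \<le> q j + 1) \<and> (\<forall>j<n. q j \<le> s j \<and> s j \<le> q j + 1) \<and> lab r i \<noteq> lab s i"
    by (rule kuhn_lemma[OF p0, of n lab]) (use p0 in \<open>auto simp: lab_def\<close>)
  have close: "\<forall>i<n. r i \<le> p" "\<forall>i<n. \<bar>W q i - W r i\<bar> \<le> 1 / p" "\<And>i. i < n \<Longrightarrow> W q i \<le> W r i"
    "\<And>i. i < n \<Longrightarrow> W r i \<le> W q i + 1 / p"
    if r: "\<forall>j<n. q j \<le> r j \<and> r j \<le> q j + 1" for r
  proof -
    show "\<forall>i<n. r i \<le> p" using r q by fastforce
    show 1: "W q i \<le> W r i" if "i < n" for i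
      using that r unfolding W_def by (simp add: divide_right_mono)
    show 2: "W r i \<le> W q i + 1 / p" if "i < n" for i
    proof -
      have "real (r i) \<le> real (q i) + 1" using that r by fastforce
      then show ?thesis unfolding W_def using p0 by (simp add: field_simps)
    qed
    show "\<forall>i<n. \<bar>W q i - W r i\<bar> \<le> 1 / p" using 1 2 by (smt (verit))
  qed
  have qp: "\<forall>i<n. q i \<le> p" using q by (simp add: less_imp_le)
  have "\<bar>G (W q) i - W q i\<bar> < \<eta>" if i: "i < n" for i
  proof -
    have key: "\<bar>G (W q) i - W q i\<bar> < \<eta>"
      if r: "\<forall>j<n. q j \<le> r j \<and> r j \<le> q j + 1" and s: "\<forall>j<n. q j \<le> s j \<and> s j \<le> q j + 1"
        and l: "lab r i = 0" "lab s i \<noteq> 0" for r s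
    proof -
      have "C * (1 / p) \<le> \<bar>C\<bar> * (1 / p)" using p0 by (intro mult_right_mono) auto
      moreover have "1 / real p \<ge> 0" by simp
      ultimately show ?thesis
        using lab0[OF close(1)[OF r] i l(1)] lab1[OF close(1)[OF s] i l(2)]
          close(3)[OF r i] close(4)[OF s i] small
          lip[OF W[OF qp] W[OF close(1)[OF r]] close(2)[OF r] i]
          lip[OF W[OF qp] W[OF close(1)[OF s]] close(2)[OF s] i] by linarith
    qed
    obtain r s where "\<forall>j<n. q j \<le> r j \<and> r j \<le> q j + 1" "\<forall>j<n. q j \<le> s j \<and> s j \<le> q j + 1" "lab r i \<noteq> lab s i"
      using lq i by blast
    moreover have "lab r i \<le> 1" "lab s i \<le> 1" by (auto simp: lab_def)
    ultimately show ?thesis using key[of r s] key[of s r] by (cases "lab r i = 0") auto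
  qed
  then show ?thesis using W[OF qp] by blast
qed

lemma abs_quotient_diff_le:
  fixes a b a' b' :: real
  assumes "b \<ge> \<beta>" "b' \<ge> \<beta>" "\<beta> > 0" "0 \<le> a'" "a' \<le> A"
  shows "\<bar>a / b - a' / b'\<bar> \<le> \<bar>a - a'\<bar> / \<beta> + A * \<bar>b - b'\<bar> / \<beta>\<^sup>2"
proof -
  have "a / b - a' / b' = (a - a') / b + a' * (b' - b) / (b * b')"
    using assms by (simp add: field_simps)
  also have "\<bar>\<dots>\<bar> \<le> \<bar>a - a'\<bar> / b + a' * \<bar>b - b'\<bar> / (b * b')"
    using assms by (intro order_trans[OF abs_triangle_ineq]) (simp add: abs_mult abs_minus_commute)
  also have "\<dots> \<le> \<bar>a - a'\<bar> / \<beta> + A * \<bar>b - b'\<bar> / (\<beta> * \<beta>)"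
    using assms by (intro add_mono frac_le mult_mono) auto
  finally show ?thesis by (simp add: power2_eq_square)
qed

text \<open>A Lipschitz map from the cube onto the standard simplex that fixes the simplex: if the coordinates
  sum to more than one they are rescaled, otherwise the missing mass is distributed evenly.\<close>

definition simplex_weight :: "nat \<Rightarrow> (nat \<Rightarrow> real) \<Rightarrow> nat \<Rightarrow> real" where
  "simplex_weight n w i = (w i + max 0 (1 - sum w {..<n}) / n) / max 1 (sum w {..<n})"

lemma simplex_weight_nonneg: "\<forall>i<n. w i \<in> {0..1} \<Longrightarrow> i < n \<Longrightarrow> 0 \<le> simplex_weight n w i"
  unfolding simplex_weight_def by (intro divide_nonneg_pos add_nonneg_nonneg) auto

lemma sum_simplex_weight: "n > 0 \<Longrightarrow> sum (simplex_weight n w) {..<n} = 1"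
  unfolding simplex_weight_def sum_divide_distrib[symmetric] sum.distrib by (auto simp: max_def)

lemma simplex_weight_fixed: "sum w {..<n} = 1 \<Longrightarrow> simplex_weight n w i = w i"
  unfolding simplex_weight_def by simp

lemma simplex_weight_lipschitz:
  assumes w: "\<forall>i<n. w i \<in> {0..1}" "\<forall>i<n. w' i \<in> {0..1}" "\<forall>i<n. \<bar>w i - w' i\<bar> \<le> d" and i: "i < n"
  shows "\<bar>simplex_weight n w i - simplex_weight n w' i\<bar> \<le> (2 + 2 * n) * d"
proof -
  let ?s = "sum w {..<n}" and ?s' = "sum w' {..<n}"
  have n: "real n > 0" using i by simp
  have "\<bar>?s - ?s'\<bar> = \<bar>\<Sum>i<n. w i - w' i\<bar>" by (simp add: sum_subtractf)
  also have "\<dots> \<le> (\<Sum>i<n. d)" using w(3) by (intro order_trans[OF sum_abs] sum_mono) auto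
  finally have s: "\<bar>?s - ?s'\<bar> \<le> n * d" by simp
  have "\<bar>max 0 (1 - ?s) / n - max 0 (1 - ?s') / n\<bar> = \<bar>max 0 (1 - ?s) - max 0 (1 - ?s')\<bar> / n"
    using n by (simp flip: diff_divide_distrib)
  also have "\<dots> \<le> (n * d) / n" using s by (intro divide_right_mono) auto
  finally have num: "\<bar>max 0 (1 - ?s) / n - max 0 (1 - ?s') / n\<bar> \<le> d" using n by simp
  have s0: "?s' \<ge> 0" using w(2) by (intro sum_nonneg) auto
  have "max 0 (1 - ?s') / n \<le> 1" "0 \<le> max 0 (1 - ?s') / n" using n s0 by (auto simp: divide_le_eq)
  then have a': "0 \<le> w' i + max 0 (1 - ?s') / n" "w' i + max 0 (1 - ?s') / n \<le> 2" using w(2) i by (force, smt (verit) atLeastAtMost_iff)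
  have "\<bar>simplex_weight n w i - simplex_weight n w' i\<bar> \<le>
     \<bar>(w i + max 0 (1 - ?s) / n) - (w' i + max 0 (1 - ?s') / n)\<bar> / 1 + 2 * \<bar>max 1 ?s - max 1 ?s'\<bar> / 1\<^sup>2"
    unfolding simplex_weight_def by (rule abs_quotient_diff_le) (use a' in auto)
  also have "\<bar>(w i + max 0 (1 - ?s) / n) - (w' i + max 0 (1 - ?s') / n)\<bar> \<le> 2 * d" using num w(3) i by (smt (verit))
  also have "\<bar>max 1 ?s - max 1 ?s'\<bar> \<le> n * d" using s by linarith
  finally show ?thesis by (simp add: algebra_simps)
qed

text \<open>The function \<open>g\<close> is arbitrary. Take a finite net of \<open>K\<close>, replace \<open>g\<close> by the interpolation of its values
  at the net with a Lipschitz partition of unity, and read the resulting continuous map in barycentric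
  coordinates, where it acts on a cube. An approximate fixed point of it is a convex combination of values
  of \<open>g\<close> at points of the net near that combination. For a selection \<open>g\<close> of a multivalued map this is an
  approximate fixed point of the multivalued map.\<close>

lemma Cellina_approximate_fixed_point:
  fixes g :: "'y::real_normed_vector \<Rightarrow> 'y"
  assumes K: "convex K" "K \<noteq> {}" "\<And>\<epsilon>. \<epsilon> > 0 \<Longrightarrow> \<exists>k. finite k \<and> K \<subseteq> (\<Union>c\<in>k. ball c \<epsilon>)"
    and g: "\<And>x. g x \<in> K" and "\<epsilon> > 0"
  shows "\<exists>X w. finite X \<and> (\<forall>z\<in>X. 0 \<le> w z) \<and> sum w X = 1 \<and>
    (\<forall>z\<in>X. w z > 0 \<longrightarrow> dist (\<Sum>z\<in>X. w z *\<^sub>R g z) z < \<epsilon>)"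
proof -
  define e where "e = \<epsilon> / 2"
  have e: "e > 0" unfolding e_def using \<open>\<epsilon> > 0\<close> by simp
  obtain X where X: "finite X" "K \<subseteq> (\<Union>c\<in>X. ball c (e/2))" using K(3)[of "e/2"] e by auto
  obtain z where z: "bij_betw z {..<card X} X"
    using ex_bij_betw_nat_finite[OF X(1)] unfolding atLeast0LessThan by blast
  define n where "n = card X"
  have "X \<noteq> {}" using X(2) K(2) by auto
  then have n: "n > 0" unfolding n_def using X(1) by (simp add: card_gt_0_iff)
  note zb = z[folded n_def]
  define l where "l i x = max 0 (e - dist x (z i))" for i x
  define L where "L x = (\<Sum>i<n. l i x)" for x
  have l0: "l i x \<ge> 0" "l i x \<le> e" for i x unfolding l_def using e by auto
  have L: "L x \<ge> e / 2" if x: "x \<in> K" for x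
  proof -
    obtain c where c: "c \<in> X" "dist c x < e/2" using X(2) x by (auto simp: mem_ball)
    then obtain i where i: "i < n" "c = z i" using bij_betw_imp_surj_on[OF zb] by auto
    have "e / 2 \<le> l i x" unfolding l_def using c(2) i(2) by (auto simp: dist_commute max_def)
    also have "\<dots> \<le> L x" unfolding L_def using i(1) l0 by (intro member_le_sum) auto
    finally show ?thesis .
  qed
  have l_lip: "\<bar>l i x - l i y\<bar> \<le> dist x y" for i x y
    unfolding l_def using dist_triangle2[of x "z i" y] dist_triangle3[of y "z i" x]
    by (smt (verit) dist_commute dist_triangle)
  have L_lip: "\<bar>L x - L y\<bar> \<le> n * dist x y" for x y
  proof -
    have "\<bar>L x - L y\<bar> = \<bar>\<Sum>i<n. l i x - l i y\<bar>" unfolding L_def by (simp add: sum_subtractf)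
    also have "\<dots> \<le> (\<Sum>i<n. dist x y)" by (intro order_trans[OF sum_abs] sum_mono l_lip)
    finally show ?thesis by simp
  qed
  define P where "P w = (\<Sum>i<n. simplex_weight n w i *\<^sub>R g (z i))" for w
  define M where "M = (\<Sum>i<n. norm (g (z i)))"
  have M: "M \<ge> 0" "\<And>i. i < n \<Longrightarrow> norm (g (z i)) \<le> M" unfolding M_def
    by (auto intro: sum_nonneg member_le_sum)
  have PK: "P w \<in> K" if "\<forall>i<n. w i \<in> {0..1}" for w
    unfolding P_def using sum_simplex_weight[OF n] simplex_weight_nonneg[OF that] g
    by (intro convex_sum K) auto
  define c where "c = real n * ((2 + 2 * n) * M)"
  have c0: "c \<ge> 0" unfolding c_def using M by simp
  have P_lip: "dist (P w) (P w') \<le> c * d" if "\<forall>i<n. w i \<in> {0..1}" "\<forall>i<n. w' i \<in> {0..1}"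
    "\<forall>i<n. \<bar>w i - w' i\<bar> \<le> d" for w w' d
  proof -
    have "dist (P w) (P w') = norm (\<Sum>i<n. (simplex_weight n w i - simplex_weight n w' i) *\<^sub>R g (z i))"
      unfolding P_def dist_norm by (simp add: sum_subtractf scaleR_diff_left)
    also have "\<dots> \<le> (\<Sum>i<n. (2 + 2 * n) * d * M)"
    proof (intro order_trans[OF norm_sum] sum_mono)
      fix i assume "i \<in> {..<n}"
      then show "norm ((simplex_weight n w i - simplex_weight n w' i) *\<^sub>R g (z i)) \<le> (2 + 2 * n) * d * M"
        unfolding norm_scaleR using simplex_weight_lipschitz[OF that] M
        by (intro mult_mono) (auto intro: order_trans[OF abs_ge_zero])
    qed
    finally show ?thesis unfolding c_def by (simp add: algebra_simps)
  qed
  define G where "G w i = l i (P w) / L (P w)" for w i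
  have G: "G w i \<in> {0..1}" "sum (G w) {..<n} = 1" if "\<forall>i<n. w i \<in> {0..1}" "i < n" for w i
  proof -
    have Lp: "L (P w) > 0" using L[OF PK[OF that(1)]] e by linarith
    have "l i (P w) \<le> L (P w)" unfolding L_def using that(2) l0 by (intro member_le_sum) auto
    then show "G w i \<in> {0..1}" unfolding G_def using Lp l0 by simp
    show "sum (G w) {..<n} = 1" unfolding G_def sum_divide_distrib[symmetric] using Lp L_def by simp
  qed
  define \<eta> where "\<eta> = e / (c + 1)"
  have \<eta>: "\<eta> > 0" "c * \<eta> < e" unfolding \<eta>_def using e c0 by (auto simp: field_simps add_nonneg_pos)
  have "\<exists>w. (\<forall>i<n. w i \<in> {0..1}) \<and> (\<forall>i<n. \<bar>G w i - w i\<bar> < \<eta>)"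
  proof (rule Brouwer_cube_approx[where C = "c / (e/2) + e * (n * c) / (e/2)\<^sup>2"])
    fix w w' :: "nat \<Rightarrow> real" and d i
    assume w: "\<forall>i<n. w i \<in> {0..1}" "\<forall>i<n. w' i \<in> {0..1}" "\<forall>i<n. \<bar>w i - w' i\<bar> \<le> d" and "i < n"
    have "\<bar>G w i - G w' i\<bar> \<le> \<bar>l i (P w) - l i (P w')\<bar> / (e/2) + e * \<bar>L (P w) - L (P w')\<bar> / (e/2)\<^sup>2"
      unfolding G_def using L[OF PK] w e l0 by (intro abs_quotient_diff_le) auto
    also have "\<dots> \<le> (c * d) / (e/2) + e * (n * (c * d)) / (e/2)\<^sup>2"
      using order_trans[OF l_lip P_lip[OF w]] order_trans[OF L_lip mult_left_mono[OF P_lip[OF w]]] e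
      by (intro add_mono divide_right_mono mult_left_mono) auto
    finally show "\<bar>G w i - G w' i\<bar> \<le> (c / (e/2) + e * (n * c) / (e/2)\<^sup>2) * d"
      by (simp add: algebra_simps add_divide_distrib)
  qed (use G \<eta> in auto)
  then obtain w where w: "\<forall>i<n. w i \<in> {0..1}" "\<forall>i<n. \<bar>G w i - w i\<bar> < \<eta>" by blast
  have "P (G w) = (\<Sum>i<n. G w i *\<^sub>R g (z i))"
    unfolding P_def by (simp add: simplex_weight_fixed[OF G(2)[OF w(1) n]])
  moreover have "dist (P w) (P (G w)) \<le> c * \<eta>"
    by (rule P_lip) (use w G(1)[OF w(1)] in \<open>auto simp: abs_minus_commute intro: less_imp_le\<close>)
  ultimately have near: "dist (P w) (\<Sum>i<n. G w i *\<^sub>R g (z i)) < e" using \<eta> by simp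
  define v where "v y = G w (inv_into {..<n} z y)" for y
  have v: "v (z i) = G w i" if "i < n" for i
    unfolding v_def using that bij_betw_imp_inj_on[OF zb] by simp
  have sumX: "(\<Sum>y\<in>X. v y *\<^sub>R h y) = (\<Sum>i<n. G w i *\<^sub>R h (z i))" for h :: "'y \<Rightarrow> 'b::real_vector"
    by (subst sum.reindex_bij_betw[OF zb, symmetric]) (simp add: v)
  have "sum v X = 1" using sumX[of "\<lambda>_. 1::real"] G(2)[OF w(1) n] by simp
  moreover have "0 \<le> v y \<and> (v y > 0 \<longrightarrow> dist (\<Sum>z\<in>X. v z *\<^sub>R g z) y < \<epsilon>)" if yX: "y \<in> X" for y
  proof -
    obtain i where i: "i < n" "y = z i" using yX bij_betw_imp_surj_on[OF zb] by auto
    have "dist (\<Sum>z\<in>X. v z *\<^sub>R g z) y < \<epsilon>" if "G w i > 0"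
    proof -
      have "L (P w) > 0" using L[OF PK[OF w(1)]] e by linarith
      then have "dist (P w) y < e" using that unfolding G_def l_def i(2) by (auto simp: zero_less_divide_iff max_def split: if_splits)
      then show ?thesis unfolding sumX using near unfolding e_def
        by (smt (verit) dist_commute dist_triangle field_sum_of_halves)
    qed
    then show ?thesis using G(1)[OF w(1) i(1)] v[OF i(1)] i(2) by auto
  qed
  ultimately show ?thesis using X(1) by blast
qed

section \<open>Cosine families and the phase space\<close>

lemma norm_diff_le_of_vector_derivative_bound:
  fixes f :: "real \<Rightarrow> 'a::banach"
  assumes f: "\<And>t. t \<in> {\<alpha>..\<beta>} \<Longrightarrow> (f has_vector_derivative f' t) (at t within {\<alpha>..\<beta>})"
    and B: "\<And>t. t \<in> {\<alpha>..\<beta>} \<Longrightarrow> norm (f' t) \<le> B" and st: "s \<in> {\<alpha>..\<beta>}" "t \<in> {\<alpha>..\<beta>}"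
  shows "norm (f t - f s) \<le> B * \<bar>t - s\<bar>"
proof -
  have le: "norm (f t - f s) \<le> B * (t - s)" if "s \<le> t" "s \<in> {\<alpha>..\<beta>}" "t \<in> {\<alpha>..\<beta>}" for s t
  proof -
    have "0 \<le> B" by (rule order_trans[OF norm_ge_zero B[OF that(2)]])
    moreover have "(f' has_integral (f t - f s)) {s..t}"
    proof (rule fundamental_theorem_of_calculus[OF that(1)])
      fix x assume "x \<in> {s..t}"
      then show "(f has_vector_derivative f' x) (at x within {s..t})"
        using that by (intro has_vector_derivative_within_subset[OF f]) auto
    qed
    moreover have "norm (f' x) \<le> B" if "x \<in> {s..t} - {}" for x using B that \<open>s \<in> _\<close> \<open>t \<in> _\<close> by auto
    ultimately have "norm (f t - f s) \<le> B * measure lborel {s..t}" by (rule has_integral_bound_real[OF _ finite.emptyI])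
    then show ?thesis using that by simp
  qed
  show ?thesis using le[of s t] le[of t s] st by (cases "s \<le> t") (auto simp: norm_minus_commute)
qed

lemma vector_derivative_zero_imp_constant:
  fixes f :: "real \<Rightarrow> 'a::banach"
  assumes "\<And>t. (f has_vector_derivative 0) (at t)"
  shows "f t = f 0"
proof -
  have "norm (f t - f 0) \<le> 0 * \<bar>t - 0\<bar>"
    by (rule norm_diff_le_of_vector_derivative_bound[of "min t 0" "max t 0" f "\<lambda>_. 0"])
      (use has_vector_derivative_at_within[OF assms] in auto)
  then show ?thesis by simp
qed

locale cosine_fam =
  fixes C0 :: "real \<Rightarrow> 'a::banach \<Rightarrow>\<^sub>L 'a"
  assumes cosine: "cosine_family C0"
begin

abbreviation S0 where "S0 \<equiv> sine_family C0"
abbreviation E where "E \<equiv> E_space C0"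

text \<open>\<open>V x\<close> is the derivative of \<open>t \<mapsto> C\<^sub>0(t)x\<close>; it is meaningful for \<open>x \<in> E\<close>, and then \<open>V x t = A S\<^sub>0(t) x\<close>.\<close>

definition V where "V x t = vector_derivative (\<lambda>s. C0 s x) (at t)"

lemma C0_0 [simp]: "C0 0 = id_blinfun" using cosine unfolding cosine_family_def by blast

lemma dAlembert: "C0 (t + s) x + C0 (t - s) x = 2 *\<^sub>R C0 t (C0 s x)"
proof -
  have "C0 (t + s) + C0 (t - s) = 2 *\<^sub>R (C0 t o\<^sub>L C0 s)" using cosine unfolding cosine_family_def by blast
  from arg_cong[OF this, of "\<lambda>T. blinfun_apply T x"]
  show ?thesis by (simp add: blinfun.add_left blinfun.scaleR_left)
qed

lemma C0_even [simp]: "C0 (- t) x = C0 t x"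
  using dAlembert[of 0 t x] by (simp add: scaleR_2)

lemma C0_continuous: "continuous_on T (\<lambda>t. C0 t x)"
  using cosine unfolding cosine_family_def by (meson continuous_on_subset subset_UNIV)

lemma C0_bounded: "\<exists>M\<ge>0. \<forall>t\<in>{-R..R}. norm (C0 t) \<le> M"
proof (rule uniform_boundedness_blinfun)
  fix x
  have "bounded ((\<lambda>t. C0 t x) ` {-R..R})"
    by (intro compact_imp_bounded compact_continuous_image C0_continuous) simp
  then show "\<exists>K. \<forall>t\<in>{-R..R}. norm (C0 t x) \<le> K" unfolding bounded_iff by blast
qed

lemma S0_0 [simp]: "S0 0 x = 0"
  unfolding sine_family_def signed_integral_def by simp

lemma S0_derivative: "((\<lambda>t. S0 t x) has_vector_derivative C0 t x) (at t)"
proof -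
  define R where "R = \<bar>t\<bar> + 1"
  let ?I = "\<lambda>u. integral {-R..u} (\<lambda>s. C0 s x)"
  have eq: "?I u - ?I 0 = S0 u x" if u: "u \<in> {-R<..<R}" for u
  proof -
    have int: "(\<lambda>s. C0 s x) integrable_on {-R..v}" for v
      by (intro integrable_continuous_real C0_continuous)
    show ?thesis
    proof (cases "0 \<le> u")
      case True
      then have "?I 0 + integral {0..u} (\<lambda>s. C0 s x) = ?I u"
        by (intro Henstock_Kurzweil_Integration.integral_combine int) (auto simp: R_def)
      then show ?thesis using True unfolding sine_family_def signed_integral_def by (simp add: algebra_simps)
    next
      case False
      then have "?I u + integral {u..0} (\<lambda>s. C0 s x) = ?I 0"
        using u by (intro Henstock_Kurzweil_Integration.integral_combine int) auto
      then show ?thesis using False unfolding sine_family_def signed_integral_def by (simp add: algebra_simps)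
    qed
  qed
  have t: "t \<in> {-R<..<R}" unfolding R_def by auto
  have "(?I has_vector_derivative C0 t x) (at t within {-R..R})"
    by (rule integral_has_vector_derivative) (use t C0_continuous in auto)
  then have "(?I has_vector_derivative C0 t x) (at t)"
    using t by (simp add: at_within_Icc_at)
  then have "((\<lambda>u. ?I u - ?I 0) has_vector_derivative C0 t x) (at t)"
    by (auto intro!: derivative_eq_intros)
  then show ?thesis
    by (rule has_vector_derivative_transform_within_open[OF _ open_greaterThanLessThan t]) (rule eq)
qed

lemma S0_derivative_comp:
  assumes "(g has_real_derivative g') (at t)"
  shows "((\<lambda>t. S0 (g t) x) has_vector_derivative g' *\<^sub>R C0 (g t) x) (at t)"
  using vector_diff_chain_at[of g g' t "\<lambda>t. S0 t x" "C0 (g t) x"] assms S0_derivative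
  by (simp add: o_def has_real_derivative_iff_has_vector_derivative)

lemma S0_odd: "S0 (- t) x = - S0 t x"
proof -
  have "((\<lambda>t. S0 t x + S0 (- t) x) has_vector_derivative 0) (at t)" for t
    using has_vector_derivative_add[OF S0_derivative[of x t] S0_derivative_comp[of uminus "-1" t x]]
    by (simp add: DERIV_minus)
  from vector_derivative_zero_imp_constant[of "\<lambda>t. S0 t x + S0 (- t) x", OF this, of t] show ?thesis
    by (simp add: eq_neg_iff_add_eq_0 add.commute)
qed

text \<open>Both sides vanish at \<open>t = 0\<close> and have the same derivative by d'Alembert's equation.\<close>

lemma C0_S0: "C0 r (S0 t x) = (1/2) *\<^sub>R (S0 (t + r) x + S0 (t - r) x)"
proof -
  let ?h = "\<lambda>t. C0 r (S0 t x) - (1/2) *\<^sub>R (S0 (t + r) x + S0 (t - r) x)"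
  have "(?h has_vector_derivative 0) (at t)" for t
  proof -
    have "(?h has_vector_derivative C0 r (C0 t x) - (1/2) *\<^sub>R (1 *\<^sub>R C0 (t + r) x + 1 *\<^sub>R C0 (t - r) x)) (at t)"
      by (intro has_vector_derivative_diff bounded_linear.has_vector_derivative[OF blinfun.bounded_linear_right]
          bounded_linear.has_vector_derivative[OF bounded_linear_scaleR_right]
          has_vector_derivative_add S0_derivative S0_derivative_comp) (auto intro!: derivative_eq_intros)
    moreover have "C0 r (C0 t x) = (1/2) *\<^sub>R (C0 (t + r) x + C0 (t - r) x)"
      using dAlembert[of r t x] C0_even[of "t - r" x] by (simp add: add.commute)
    ultimately show ?thesis by simp
  qed
  from vector_derivative_zero_imp_constant[of ?h, OF this, of t] show ?thesis
    using S0_odd[of r x] by (simp add: blinfun.zero_right)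
qed

lemma S0_lipschitz:
  assumes M: "\<And>t. t \<in> {-R..R} \<Longrightarrow> norm (C0 t) \<le> M" and st: "s \<in> {-R..R}" "t \<in> {-R..R}"
  shows "norm (S0 t x - S0 s x) \<le> M * norm x * \<bar>t - s\<bar>"
  using norm_diff_le_of_vector_derivative_bound[OF has_vector_derivative_at_within[OF S0_derivative] _ st, of x "M * norm x"] M
  by (meson norm_blinfun order_trans mult_right_mono norm_ge_zero)

lemma E_derivative:
  assumes "x \<in> E"
  shows "((\<lambda>t. C0 t x) has_vector_derivative V x t) (at t)" "continuous_on T (V x)"
proof -
  have "\<forall>t. (\<lambda>t. C0 t x) differentiable (at t)" "continuous_on UNIV (V x)"
    using assms unfolding E_space_def C1_differentiable_on_eq V_def[abs_def] by auto
  then show "((\<lambda>t. C0 t x) has_vector_derivative V x t) (at t)" "continuous_on T (V x)"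
    unfolding V_def by (auto simp: vector_derivative_works[symmetric] intro: continuous_on_subset)
qed

lemma E_memI:
  assumes "\<And>t. ((\<lambda>t. C0 t x) has_vector_derivative v t) (at t)" "continuous_on UNIV v"
  shows "x \<in> E" "V x = v"
  using assms unfolding E_space_def C1_differentiable_on_def V_def[abs_def]
  by (auto intro: vector_derivative_at)

lemma E_add: "x \<in> E \<Longrightarrow> y \<in> E \<Longrightarrow> x + y \<in> E \<and> V (x + y) = (\<lambda>t. V x t + V y t)"
  and E_scale: "x \<in> E \<Longrightarrow> c *\<^sub>R x \<in> E \<and> V (c *\<^sub>R x) = (\<lambda>t. c *\<^sub>R V x t)"
  and E_diff: "x \<in> E \<Longrightarrow> y \<in> E \<Longrightarrow> x - y \<in> E \<and> V (x - y) = (\<lambda>t. V x t - V y t)"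
proof -
  show "x + y \<in> E \<and> V (x + y) = (\<lambda>t. V x t + V y t)" if "x \<in> E" "y \<in> E"
    using E_memI[of "x + y" "\<lambda>t. V x t + V y t"] E_derivative[OF that(1)] E_derivative[OF that(2)]
    by (simp add: blinfun.add_right has_vector_derivative_add continuous_on_add)
  show "c *\<^sub>R x \<in> E \<and> V (c *\<^sub>R x) = (\<lambda>t. c *\<^sub>R V x t)" if "x \<in> E"
    using E_memI[of "c *\<^sub>R x" "\<lambda>t. c *\<^sub>R V x t"] E_derivative(2)[OF that]
      bounded_linear.has_vector_derivative[OF bounded_linear_scaleR_right E_derivative(1)[OF that], of c]
    by (simp add: blinfun.scaleR_right continuous_on_scaleR)
  show "x - y \<in> E \<and> V (x - y) = (\<lambda>t. V x t - V y t)" if "x \<in> E" "y \<in> E"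
    using E_memI[of "x - y" "\<lambda>t. V x t - V y t"] E_derivative[OF that(1)] E_derivative[OF that(2)]
    by (simp add: blinfun.diff_right has_vector_derivative_diff continuous_on_diff)
qed

lemma C0_derivative_comp:
  assumes "x \<in> E" "(g has_real_derivative g') (at t)"
  shows "((\<lambda>t. C0 (g t) x) has_vector_derivative g' *\<^sub>R V x (g t)) (at t)"
  using vector_diff_chain_at[of g g' t "\<lambda>t. C0 t x" "V x (g t)"] assms E_derivative(1)[OF assms(1)]
  by (simp add: o_def has_real_derivative_iff_has_vector_derivative)

lemma V_odd: "x \<in> E \<Longrightarrow> V x (- t) = - V x t"
  using vector_derivative_unique_at[OF E_derivative(1)[of x t], of "- V x (- t)"]
    C0_derivative_comp[of x uminus "-1" t] by (simp add: DERIV_minus)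

text \<open>This recursion carries bounds of \<open>V x\<close> from one unit interval to the next, which is why the norm of
  \<open>E\<close> can be content with times in \<open>[0,1]\<close>.\<close>

lemma V_step:
  assumes x: "x \<in> E"
  shows "V x (t + 1) = 2 *\<^sub>R C0 1 (V x t) - V x (t - 1)"
proof -
  have "C0 (t + 1) x = 2 *\<^sub>R C0 1 (C0 t x) - C0 (t - 1) x" for t
    using dAlembert[of 1 t x] C0_even[of "t - 1" x] by (simp add: algebra_simps)
  then have "((\<lambda>t. C0 (t + 1) x) has_vector_derivative 2 *\<^sub>R C0 1 (V x t) - 1 *\<^sub>R V x (t - 1)) (at t)"
    by (simp only:)
      (intro has_vector_derivative_diff bounded_linear.has_vector_derivative[OF bounded_linear_scaleR_right]
        bounded_linear.has_vector_derivative[OF blinfun.bounded_linear_right] E_derivative x C0_derivative_comp,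
        auto intro!: derivative_eq_intros)
  moreover have "((\<lambda>t. C0 (t + 1) x) has_vector_derivative 1 *\<^sub>R V x (t + 1)) (at t)"
    by (intro C0_derivative_comp x) (auto intro!: derivative_eq_intros)
  ultimately show ?thesis using vector_derivative_unique_at by fastforce
qed

lemma S0_in_E: "S0 t x \<in> E" "V (S0 t x) = (\<lambda>r. (1/2) *\<^sub>R (C0 (t + r) x - C0 (t - r) x))"
proof -
  have "((\<lambda>r. C0 r (S0 t x)) has_vector_derivative (1/2) *\<^sub>R (1 *\<^sub>R C0 (t + r) x + (-1) *\<^sub>R C0 (t - r) x)) (at r)" for r
    unfolding C0_S0 by (intro bounded_linear.has_vector_derivative[OF bounded_linear_scaleR_right]
          has_vector_derivative_add S0_derivative_comp) (auto intro!: derivative_eq_intros)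
  then have "((\<lambda>r. C0 r (S0 t x)) has_vector_derivative (1/2) *\<^sub>R (C0 (t + r) x - C0 (t - r) x)) (at r)" for r
    by simp
  moreover have "continuous_on UNIV (\<lambda>r. (1/2) *\<^sub>R (C0 (t + r) x - C0 (t - r) x))"
    by (intro continuous_intros continuous_on_compose2[OF C0_continuous[of UNIV]]) auto
  ultimately show "S0 t x \<in> E" "V (S0 t x) = (\<lambda>r. (1/2) *\<^sub>R (C0 (t + r) x - C0 (t - r) x))"
    using E_memI[of "S0 t x" "\<lambda>r. (1/2) *\<^sub>R (C0 (t + r) x - C0 (t - r) x)"] by auto
qed

end

locale cosine_gen = cosine_fam C0 for C0 :: "real \<Rightarrow> 'a::banach \<Rightarrow>\<^sub>L 'a" +
  fixes A :: "'a \<Rightarrow> 'a" and D :: "'a set"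
  assumes gen: "generates_cosine A D C0"
begin

abbreviation \<nu> where "\<nu> \<equiv> E_norm A C0"

lemma D_subset_E: "D \<subseteq> E"
proof
  fix x assume "x \<in> D"
  then obtain v where v: "\<And>t. ((\<lambda>t. C0 t x) has_vector_derivative v t) (at t)" "v C1_differentiable_on UNIV"
    using gen unfolding generates_cosine_def by auto
  have "continuous_on UNIV v" using v(2) C1_differentiable_imp_continuous_on by blast
  then show "x \<in> E" using E_memI[OF v(1)] by blast
qed

text \<open>Thus the norm of \<open>E\<close> can be computed from \<open>V\<close> alone, without the unbounded operator.\<close>

lemma A_S0:
  assumes x: "x \<in> E"
  shows "A (S0 t x) = V x t"
proof -
  let ?v = "\<lambda>r. (1/2) *\<^sub>R (C0 (t + r) x - C0 (t - r) x)"
  have v': "(?v has_vector_derivative (1/2) *\<^sub>R (V x (t + r) + V x (t - r))) (at r)" for r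
  proof -
    have "(?v has_vector_derivative (1/2) *\<^sub>R (1 *\<^sub>R V x (t + r) - (-1) *\<^sub>R V x (t - r))) (at r)"
      by (intro bounded_linear.has_vector_derivative[OF bounded_linear_scaleR_right]
          has_vector_derivative_diff C0_derivative_comp x) (auto intro!: derivative_eq_intros)
    then show ?thesis by simp
  qed
  have "continuous_on UNIV (\<lambda>r. (1/2) *\<^sub>R (V x (t + r) + V x (t - r)))"
    by (intro continuous_intros continuous_on_compose2[OF E_derivative(2)[OF x, of UNIV]]) auto
  then have "?v C1_differentiable_on UNIV" unfolding C1_differentiable_on_def using v'
    by (intro exI[of _ "\<lambda>r. (1/2) *\<^sub>R (V x (t + r) + V x (t - r))"]) auto
  moreover have "((\<lambda>r. C0 r (S0 t x)) has_vector_derivative ?v r) (at r)" for r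
    using E_derivative(1)[OF S0_in_E(1)] S0_in_E(2) by metis
  moreover have D: "D = {x. \<exists>v. (\<forall>t. ((\<lambda>t. C0 t x) has_vector_derivative v t) (at t)) \<and> v C1_differentiable_on UNIV}"
    using gen unfolding generates_cosine_def by blast
  ultimately have "S0 t x \<in> D" unfolding D by (intro CollectI exI[of _ ?v]) auto
  then have "((\<lambda>r. V (S0 t x) r) has_vector_derivative A (S0 t x)) (at 0)"
    using gen unfolding generates_cosine_def V_def by blast
  then have "(?v has_vector_derivative A (S0 t x)) (at 0)" unfolding S0_in_E(2) .
  from vector_derivative_unique_at[OF this v'] show ?thesis by (simp flip: scaleR_2)
qed

lemma E_norm_eq: "x \<in> E \<Longrightarrow> \<nu> x = norm x + (SUP t\<in>{0..1}. norm (V x t))"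
  unfolding E_norm_def by (simp add: A_S0)

lemma bdd_above_V: "x \<in> E \<Longrightarrow> bdd_above ((\<lambda>t. norm (V x t)) ` {0..1::real})"
  by (intro bounded_imp_bdd_above compact_imp_bounded compact_continuous_image continuous_on_norm E_derivative) auto

lemma norm_V_le: "x \<in> E \<Longrightarrow> t \<in> {0..1} \<Longrightarrow> norm x + norm (V x t) \<le> \<nu> x"
  unfolding E_norm_eq by (intro add_mono cSUP_upper bdd_above_V) auto

lemma \<nu>_le: "x \<in> E \<Longrightarrow> (\<And>t. t \<in> {0..1} \<Longrightarrow> norm x + norm (V x t) \<le> K) \<Longrightarrow> \<nu> x \<le> K"
  unfolding E_norm_eq using cSUP_least[of "{0..1::real}" "\<lambda>t. norm (V x t)" "K - norm x"] by (force simp: algebra_simps)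

lemma \<nu>_ge: "x \<in> E \<Longrightarrow> norm x \<le> \<nu> x"
  using norm_V_le[of x 0] by (simp add: add_increasing2 order_trans[rotated])

lemma \<nu>_add: "x \<in> E \<Longrightarrow> y \<in> E \<Longrightarrow> \<nu> (x + y) \<le> \<nu> x + \<nu> y"
proof -
  assume xy: "x \<in> E" "y \<in> E"
  show "\<nu> (x + y) \<le> \<nu> x + \<nu> y"
  proof (rule \<nu>_le)
    fix t :: real assume "t \<in> {0..1}"
    then show "norm (x + y) + norm (V (x + y) t) \<le> \<nu> x + \<nu> y"
      using norm_V_le[OF xy(1)] norm_V_le[OF xy(2)] norm_triangle_ineq[of x y]
        norm_triangle_ineq[of "V x t" "V y t"] E_add[OF xy] by (smt (verit))
  qed (use E_add[OF xy] in blast)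
qed

lemma \<nu>_scale: "x \<in> E \<Longrightarrow> \<nu> (c *\<^sub>R x) = \<bar>c\<bar> * \<nu> x"
proof -
  assume x: "x \<in> E"
  have le: "\<nu> (c *\<^sub>R x) \<le> \<bar>c\<bar> * \<nu> x" if x: "x \<in> E" for c x
  proof (rule \<nu>_le)
    fix t :: real assume t: "t \<in> {0..1}"
    have "\<bar>c\<bar> * (norm x + norm (V x t)) \<le> \<bar>c\<bar> * \<nu> x" using norm_V_le[OF x t] by (rule mult_left_mono) simp
    then show "norm (c *\<^sub>R x) + norm (V (c *\<^sub>R x) t) \<le> \<bar>c\<bar> * \<nu> x" using E_scale[OF x, of c] by (simp add: algebra_simps)
  qed (use E_scale[OF that] in blast)
  show ?thesis
  proof (cases "c = 0")
    case False
    have "\<nu> ((1/c) *\<^sub>R c *\<^sub>R x) \<le> \<bar>1/c\<bar> * \<nu> (c *\<^sub>R x)" using E_scale[OF x] by (intro le) blast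
    then have "\<bar>c\<bar> * \<nu> x \<le> \<nu> (c *\<^sub>R x)" using False by (simp add: field_simps)
    then show ?thesis using le[OF x, of c] by simp
  next
    case True
    then show ?thesis using le[OF x, of 0] \<nu>_ge[of "0 *\<^sub>R x"] E_scale[OF x, of 0] by simp
  qed
qed

lemma subspace_E: "subspace E"
proof (rule subspaceI)
  show "0 \<in> E" using E_memI[of 0 "\<lambda>_. 0"] by (auto simp: blinfun.zero_right)
qed (use E_add E_scale in blast)+

text \<open>The recursion \<open>V_step\<close> for positive times, and oddness of \<open>V x\<close> for negative ones.\<close>

lemma V_bound_on: "\<exists>c. \<forall>x\<in>E. \<forall>t\<in>{- real (Suc n)..real (Suc n)}. norm (V x t) \<le> c * \<nu> x"
proof (induction n)
  case 0
  have "norm (V x t) \<le> 1 * \<nu> x" if x: "x \<in> E" and t: "t \<in> {- real (Suc 0)..real (Suc 0)}" for x t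
    using norm_V_le[OF x, of "\<bar>t\<bar>"] t V_odd[OF x, of "\<bar>t\<bar>"] norm_ge_zero[of x]
    by (cases "t \<ge> 0") (auto simp: abs_if simp del: norm_ge_zero)
  then show ?case by blast
next
  case (Suc n)
  then obtain c where c: "\<And>x t. x \<in> E \<Longrightarrow> t \<in> {- real (Suc n)..real (Suc n)} \<Longrightarrow> norm (V x t) \<le> c * \<nu> x" by blast
  define k where "k = 2 * norm (C0 1)"
  have k: "k \<ge> 0" unfolding k_def by simp
  have pos: "norm (V x t) \<le> (k * \<bar>c\<bar> + \<bar>c\<bar>) * \<nu> x" if x: "x \<in> E" and t: "t \<in> {0..real (Suc (Suc n))}" for x t
  proof -
    have \<nu>0: "\<nu> x \<ge> 0" using \<nu>_ge[OF x] norm_ge_zero[of x] by linarith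
    have cc: "c * \<nu> x \<le> \<bar>c\<bar> * \<nu> x" using \<nu>0 by (intro mult_right_mono) auto
    have "\<bar>c\<bar> * \<nu> x \<le> (k * \<bar>c\<bar> + \<bar>c\<bar>) * \<nu> x" using \<nu>0 k by (intro mult_right_mono) auto
    moreover have "norm (V x t) \<le> (k * \<bar>c\<bar> + \<bar>c\<bar>) * \<nu> x" if "t > real (Suc n)"
    proof -
      have "norm (V x t) = norm (2 *\<^sub>R C0 1 (V x (t - 1)) - V x (t - 2))" using V_step[OF x, of "t - 1"] by simp
      also have "\<dots> \<le> norm (2 *\<^sub>R C0 1 (V x (t - 1))) + norm (V x (t - 2))" by (rule norm_triangle_ineq4)
      also have "\<dots> \<le> k * norm (V x (t - 1)) + norm (V x (t - 2))"
        unfolding k_def using norm_blinfun[of "C0 1" "V x (t - 1)"] by simp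
      also have "\<dots> \<le> k * (\<bar>c\<bar> * \<nu> x) + \<bar>c\<bar> * \<nu> x"
        using k c[OF x, of "t - 1"] c[OF x, of "t - 2"] cc t that by (intro add_mono mult_left_mono) auto
      finally show ?thesis by (simp add: algebra_simps)
    qed
    ultimately show ?thesis using c[OF x, of t] t cc by (cases "t \<le> real (Suc n)") auto
  qed
  have "norm (V x t) \<le> (k * \<bar>c\<bar> + \<bar>c\<bar>) * \<nu> x" if x: "x \<in> E" and t: "t \<in> {- real (Suc (Suc n))..real (Suc (Suc n))}" for x t
    using pos[OF x, of "\<bar>t\<bar>"] t V_odd[OF x, of "\<bar>t\<bar>"] by (cases "t \<ge> 0") (auto simp: abs_if)
  then show ?case by blast
qed

end

lemma derivative_norm_le_of_lipschitz:
  fixes f :: "real \<Rightarrow> 'a::real_normed_vector"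
  assumes d: "(f has_vector_derivative v) (at r)" and lip: "\<And>y. y \<in> {0..1} \<Longrightarrow> norm (f y - f r) \<le> L * \<bar>y - r\<bar>" and r: "r \<in> {0..1}"
  shows "norm v \<le> L"
proof (rule field_le_epsilon)
  fix e :: real assume "e > 0"
  then obtain d where d: "d > 0" "\<And>y. norm (y - r) < d \<Longrightarrow> norm (f y - f r - (y - r) *\<^sub>R v) \<le> e * norm (y - r)"
    using d unfolding has_vector_derivative_def has_derivative_at_alt by blast
  obtain y where y: "y \<in> {0..1}" "y \<noteq> r" "norm (y - r) < d"
  proof (cases "r < 1")
    case True
    then show ?thesis using that[of "r + min ((1 - r) / 2) (d / 2)"] d(1) r by (auto simp: min_def field_simps)
  next
    case False
    then show ?thesis using that[of "r - min (1 / 2) (d / 2)"] d(1) r by (auto simp: min_def)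
  qed
  have "norm ((y - r) *\<^sub>R v) \<le> norm (f y - f r) + norm (f y - f r - (y - r) *\<^sub>R v)"
    using norm_triangle_ineq4[of "f y - f r" "f y - f r - (y - r) *\<^sub>R v"] by simp
  also have "\<dots> \<le> (L + e) * \<bar>y - r\<bar>" using lip[OF y(1)] d(2)[OF y(3)] by (simp add: algebra_simps)
  finally show "norm v \<le> L + e" using y(2) by (simp add: mult.commute[of "\<bar>_\<bar>"])
qed

text \<open>The maximum of \<open>\<phi> t * exp (-2 c (t - s))\<close> bounds itself: inserted into the integral it comes back with
  the factor \<open>1/2\<close>.\<close>

lemma Gronwall_continuous:
  fixes \<phi> :: "real \<Rightarrow> real"
  assumes \<phi>: "continuous_on {s..b} \<phi>" and c: "c > 0" and a: "a \<ge> 0"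
    and le: "\<And>t. t \<in> {s..b} \<Longrightarrow> \<phi> t \<le> c * (a + integral {s..t} \<phi>)" and t: "t \<in> {s..b}"
  shows "\<phi> t \<le> 2 * c * a * exp (2 * c * (b - s))"
proof -
  define E where "E t = exp (2 * c * (t - s))" for t
  have E: "E t > 0" "E t \<ge> 1 \<longleftrightarrow> t \<ge> s" for t unfolding E_def using c by (auto simp: zero_le_mult_iff)
  have "continuous_on {s..b} (\<lambda>t. \<phi> t / E t)" unfolding E_def by (intro continuous_intros \<phi>) auto
  then obtain t0 where t0: "t0 \<in> {s..b}" "\<And>u. u \<in> {s..b} \<Longrightarrow> \<phi> u / E u \<le> \<phi> t0 / E t0"
    using continuous_attains_sup[of "{s..b}" "\<lambda>t. \<phi> t / E t"] t by auto
  define m where "m = \<phi> t0 / E t0"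
  have m: "\<phi> u \<le> m * E u" if "u \<in> {s..b}" for u using t0(2)[OF that] E(1)[of u] unfolding m_def by (simp add: field_simps)
  have m0: "m \<le> 2 * c * a"
  proof (cases "m \<ge> 0")
    case True
    have int: "(E has_integral (E t0 / (2 * c) - E s / (2 * c))) {s..t0}"
      using t0(1) c unfolding E_def
      by (intro fundamental_theorem_of_calculus) (auto intro!: derivative_eq_intros simp flip: has_real_derivative_iff_has_vector_derivative)
    have "\<phi> t0 \<le> c * (a + integral {s..t0} \<phi>)" by (rule le[OF t0(1)])
    also have "integral {s..t0} \<phi> \<le> integral {s..t0} (\<lambda>u. m * E u)"
    proof (rule integral_le)
      show "\<phi> integrable_on {s..t0}" by (intro integrable_continuous_real continuous_on_subset[OF \<phi>]) (use t0 in auto)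
      show "(\<lambda>u. m * E u) integrable_on {s..t0}" using int by (intro integrable_on_mult_right) auto
    qed (use m t0 in auto)
    also have "\<dots> = m * (E t0 / (2 * c) - E s / (2 * c))" using int by (simp add: integral_unique)
    also have "\<dots> \<le> m * (E t0 / (2 * c))" using True E(1)[of s] c by (intro mult_left_mono) auto
    finally have "\<phi> t0 \<le> c * (a + m * (E t0 / (2 * c)))" using c by simp
    also have "\<dots> = c * a + m * E t0 / 2" using c by (simp add: field_simps)
    finally have "\<phi> t0 \<le> c * a + m * E t0 / 2" .
    moreover have "\<phi> t0 = m * E t0" unfolding m_def using E(1)[of t0] by simp
    ultimately have "m * E t0 \<le> 2 * c * a" by simp
    moreover have "m \<le> m * E t0" using True E(2)[of t0] t0(1) by (simp add: mult_le_cancel_left1)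
    ultimately show ?thesis by linarith
  next
    case False
    have "0 \<le> 2 * c * a" using c a by simp
    then show ?thesis using False by linarith
  qed
  have "\<phi> t \<le> m * E t" by (rule m[OF t])
  also have "\<dots> \<le> (2 * c * a) * E t" using m0 E(1)[of t] by (intro mult_right_mono) auto
  also have "\<dots> \<le> (2 * c * a) * exp (2 * c * (b - s))" unfolding E_def using c a t by (intro mult_left_mono) auto
  finally show ?thesis .
qed

context cosine_fam
begin

lemma S0_add: "S0 t (x + y) = S0 t x + S0 t y"
proof -
  have "((\<lambda>t. S0 t (x + y) - (S0 t x + S0 t y)) has_vector_derivative (C0 t (x + y) - (C0 t x + C0 t y))) (at t)" for t
    by (intro has_vector_derivative_diff has_vector_derivative_add S0_derivative)
  then have "((\<lambda>t. S0 t (x + y) - (S0 t x + S0 t y)) has_vector_derivative 0) (at t)" for t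
    by (simp add: blinfun.add_right)
  from vector_derivative_zero_imp_constant[OF this, of t] show ?thesis by simp
qed

lemma S0_scaleR: "S0 t (c *\<^sub>R x) = c *\<^sub>R S0 t x"
proof -
  have "((\<lambda>t. S0 t (c *\<^sub>R x) - c *\<^sub>R S0 t x) has_vector_derivative (C0 t (c *\<^sub>R x) - c *\<^sub>R C0 t x)) (at t)" for t
    by (intro has_vector_derivative_diff S0_derivative bounded_linear.has_vector_derivative[OF bounded_linear_scaleR_right])
  then have "((\<lambda>t. S0 t (c *\<^sub>R x) - c *\<^sub>R S0 t x) has_vector_derivative 0) (at t)" for t
    by (simp add: blinfun.scaleR_right)
  from vector_derivative_zero_imp_constant[OF this, of t] show ?thesis by simp
qed

lemma bounded_linear_S0: "bounded_linear (S0 t)"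
proof -
  obtain M where M: "\<And>r. r \<in> {-\<bar>t\<bar>..\<bar>t\<bar>} \<Longrightarrow> norm (C0 r) \<le> M" using C0_bounded[of "\<bar>t\<bar>"] by blast
  have "norm (S0 t x) \<le> norm x * (M * \<bar>t\<bar>)" for x
    using S0_lipschitz[of "\<bar>t\<bar>" M 0 t x] M abs_ge_self[of t] abs_ge_minus_self[of t]
    by (simp add: mult_ac del: abs_ge_self abs_ge_minus_self)
  then show ?thesis by (intro bounded_linear_intro S0_add S0_scaleR)
qed

definition Sine :: "real \<Rightarrow> 'a \<Rightarrow>\<^sub>L 'a" where "Sine t = Blinfun (S0 t)"

lemma Sine_apply [simp]: "blinfun_apply (Sine t) = S0 t"
  unfolding Sine_def by (rule bounded_linear_Blinfun_apply[OF bounded_linear_S0])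

lemma Sine_lipschitz:
  assumes M: "\<And>t. t \<in> {-R..R} \<Longrightarrow> norm (C0 t) \<le> M" and st: "s \<in> {-R..R}" "t \<in> {-R..R}"
  shows "norm (Sine t - Sine s) \<le> M * \<bar>t - s\<bar>"
proof (rule norm_blinfun_bound)
  show "0 \<le> M * \<bar>t - s\<bar>" using M[OF st(1)] norm_ge_zero[of "C0 s"] by (intro mult_nonneg_nonneg) linarith+
  show "norm (blinfun_apply (Sine t - Sine s) x) \<le> M * \<bar>t - s\<bar> * norm x" for x
    using S0_lipschitz[OF M st, of x] by (simp add: blinfun.diff_left mult_ac)
qed

lemma Sine_continuous: "continuous_on T Sine"
proof -
  have "continuous_on {-R<..<R} Sine" for R
  proof -
    obtain M where M: "\<And>r. r \<in> {-R..R} \<Longrightarrow> norm (C0 r) \<le> M" using C0_bounded[of R] by blast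
    show ?thesis
    proof (cases "R > 0")
      case True
      have "M \<ge> 0" using True by (intro order_trans[OF norm_ge_zero M[of 0]]) auto
      then have "M-lipschitz_on {-R<..<R} Sine"
        by (intro lipschitz_onI) (use Sine_lipschitz[OF M] in \<open>auto simp: dist_norm\<close>)
      then show ?thesis by (rule lipschitz_on_continuous_on)
    qed simp
  qed
  then have "isCont Sine t" for t
  proof -
    have "t \<in> {-(\<bar>t\<bar>+1)<..<\<bar>t\<bar>+1}" by auto
    then show ?thesis
      using continuous_on_eq_continuous_at[OF open_greaterThanLessThan] \<open>\<And>R. continuous_on {-R<..<R} Sine\<close> by blast
  qed
  then show ?thesis by (simp add: continuous_at_imp_continuous_on)
qed

lemma compact_operator_Sine:
  assumes "\<forall>t>0. compact_operator (S0 t)" "t \<ge> 0"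
  shows "compact_operator (blinfun_apply (Sine t))"
proof (cases "t = 0")
  case True
  have "compact_operator (S0 0)"
  proof (rule compact_operatorI[OF bounded_linear_S0])
    fix \<epsilon> :: real assume "\<epsilon> > 0"
    then show "finite_cover \<epsilon> (S0 0 ` cball 0 1)"
      unfolding finite_cover_def by (intro exI[of _ "{0}"]) auto
  qed
  then show ?thesis using True by simp
qed (use assms in simp)

end

context cosine_gen
begin

text \<open>The derivatives \<open>V (s n)\<close> converge uniformly on bounded intervals by \<open>V_bound_on\<close>, so their limit is
  continuous and is the derivative of \<open>t \<mapsto> C\<^sub>0(t)x\<close> for the limit \<open>x\<close> of \<open>s\<close> in \<open>X\<close>.\<close>

lemma E_complete:
  assumes s: "\<And>n. s n \<in> E" and step: "\<And>n. \<nu> (s (Suc n) - s n) \<le> (1/3)^n"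
  shows "\<exists>x\<in>E. (\<lambda>n. \<nu> (x - s n)) \<longlonglongrightarrow> 0"
proof -
  have add: "\<nu> (s (n + k) - s n) \<le> 3/2 * (1/3)^n * (1 - (1/3)^k)" for n k
  proof (induction k)
    case 0 show ?case using \<nu>_scale[OF s, of 0 0] by simp
  next
    case (Suc k)
    have "\<nu> (s (n + Suc k) - s n) = \<nu> ((s (Suc (n + k)) - s (n+k)) + (s (n + k) - s n))" by simp
    also have "\<dots> \<le> (1/3)^(n+k) + 3/2 * (1/3)^n * (1 - (1/3)^k)"
      using \<nu>_add[of "s (Suc (n + k)) - s (n+k)" "s (n + k) - s n"] step[of "n+k"] Suc E_diff[OF s s] by (smt (verit))
    also have "\<dots> = 3/2 * (1/3)^n * (1 - (1/3)^Suc k)" by (simp add: power_add field_simps)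
    finally show ?case .
  qed
  have tail: "\<nu> (s m - s n) \<le> 3/2 * (1/3)^n" if "m \<ge> n" for m n
  proof -
    have "\<nu> (s m - s n) \<le> 3/2 * (1/3)^n * (1 - (1/3)^(m - n))" using add[of n "m - n"] that by simp
    also have "\<dots> \<le> 3/2 * (1/3)^n" by (simp add: mult_left_le)
    finally show ?thesis .
  qed
  have small: "(\<lambda>n. C * (3/2 * (1/3)^n)) \<longlonglongrightarrow> 0" for C :: real
    by (intro tendsto_mult_right_zero LIMSEQ_power_zero) simp
  \<comment> \<open>Needed twice: for the vectors \<open>s n\<close> and, at each time \<open>t\<close>, for the derivatives \<open>V (s n) t\<close>.\<close>
  have geo: "\<exists>l. u \<longlonglongrightarrow> l \<and> (\<forall>n. norm (l - u n) \<le> C * (3/2 * (1/3)^n))"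
    if u: "\<And>m n. m \<ge> n \<Longrightarrow> norm (u m - u n) \<le> C * (3/2 * (1/3)^n)" for u :: "nat \<Rightarrow> 'a" and C
  proof -
    have "Cauchy u"
    proof (rule metric_CauchyI)
      fix e :: real assume "e > 0"
      then obtain M where M: "C * (3/2 * (1/3)^M) < e / 2"
        using order_tendstoD(2)[OF small[of C], of "e/2"] unfolding eventually_sequentially by auto
      have "dist (u m) (u n) < e" if "m \<ge> M" "n \<ge> M" for m n
        using u[OF that(1)] u[OF that(2)] M dist_triangle2[of "u m" "u n" "u M"] by (simp add: dist_norm)
      then show "\<exists>M. \<forall>m\<ge>M. \<forall>n\<ge>M. dist (u m) (u n) < e" by blast
    qed
    then obtain l where l: "u \<longlonglongrightarrow> l" using Cauchy_convergent_iff convergent_def by blast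
    have "norm (l - u n) \<le> C * (3/2 * (1/3)^n)" for n
      proof (rule LIMSEQ_le_const2[OF tendsto_norm[OF tendsto_diff[OF l tendsto_const]]])
      show "\<exists>N. \<forall>m\<ge>N. norm (u m - u n) \<le> C * (3/2 * (1/3)^n)" using u by blast
    qed
    then show ?thesis using l by blast
  qed
  have ex: "\<exists>l. s \<longlonglongrightarrow> l \<and> (\<forall>n. norm (l - s n) \<le> 1 * (3/2 * (1/3)^n))"
  proof (rule geo)
    fix m n :: nat assume "n \<le> m"
    have "norm (s m - s n) \<le> \<nu> (s m - s n)" using \<nu>_ge E_diff[OF s s] by blast
    then show "norm (s m - s n) \<le> 1 * (3/2 * (1/3)^n)" using tail[OF \<open>n \<le> m\<close>] by simp
  qed
  then obtain x where x: "s \<longlonglongrightarrow> x" "\<And>n. norm (x - s n) \<le> 3/2 * (1/3)^n" by auto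
  have Vtail: "\<exists>C. \<forall>t\<in>{- real (Suc k)..real (Suc k)}. \<forall>n m. m \<ge> n \<longrightarrow> norm (V (s m) t - V (s n) t) \<le> C * (3/2 * (1/3)^n)" for k
  proof -
    obtain c where c: "\<forall>x\<in>E. \<forall>t\<in>{- real (Suc k)..real (Suc k)}. norm (V x t) \<le> c * \<nu> x" using V_bound_on[of k] by blast
    have "norm (V (s m) t - V (s n) t) \<le> \<bar>c\<bar> * (3/2 * (1/3)^n)"
      if t: "t \<in> {- real (Suc k)..real (Suc k)}" and "m \<ge> n" for t n m
    proof -
      have E: "s m - s n \<in> E" "V (s m - s n) = (\<lambda>t. V (s m) t - V (s n) t)" using E_diff[OF s s] by auto
      have "norm (V (s m - s n) t) \<le> c * \<nu> (s m - s n)" using c E(1) t by blast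
      also have "\<dots> \<le> \<bar>c\<bar> * \<nu> (s m - s n)"
        using \<nu>_ge[OF E(1)] norm_ge_zero[of "s m - s n"] by (intro mult_right_mono) linarith+
      also have "\<dots> \<le> \<bar>c\<bar> * (3/2 * (1/3)^n)" using tail[OF \<open>m \<ge> n\<close>] by (intro mult_left_mono) auto
      finally show ?thesis unfolding E(2) .
    qed
    then show ?thesis by blast
  qed
  have inint: "\<exists>k. t \<in> {- real (Suc k)<..<real (Suc k)}" for t
  proof -
    obtain k :: nat where "\<bar>t\<bar> < k" using reals_Archimedean2 by blast
    then show ?thesis by (intro exI[of _ k]) auto
  qed
  have "\<exists>l. (\<lambda>n. V (s n) t) \<longlonglongrightarrow> l" for t
  proof -
    obtain k where k: "t \<in> {- real (Suc k)<..<real (Suc k)}" using inint by blast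
    then have t: "t \<in> {- real (Suc k)..real (Suc k)}" by auto
    obtain C where C: "\<forall>t\<in>{- real (Suc k)..real (Suc k)}. \<forall>n m. m \<ge> n \<longrightarrow> norm (V (s m) t - V (s n) t) \<le> C * (3/2 * (1/3)^n)"
      using Vtail[of k] by blast
    have "\<And>n m. m \<ge> n \<Longrightarrow> norm (V (s m) t - V (s n) t) \<le> C * (3/2 * (1/3)^n)" using C t by blast
    from geo[OF this] show ?thesis by blast
  qed
  then obtain w where w: "\<And>t. (\<lambda>n. V (s n) t) \<longlonglongrightarrow> w t" by metis
  have wrate: "\<exists>C. \<forall>t\<in>{- real (Suc k)..real (Suc k)}. \<forall>n. norm (w t - V (s n) t) \<le> C * (3/2 * (1/3)^n)" for k
  proof -
    obtain C where C: "\<forall>t\<in>{- real (Suc k)..real (Suc k)}. \<forall>n m. m \<ge> n \<longrightarrow> norm (V (s m) t - V (s n) t) \<le> C * (3/2 * (1/3)^n)"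
      using Vtail[of k] by blast
    have "norm (w t - V (s n) t) \<le> C * (3/2 * (1/3)^n)" if "t \<in> {- real (Suc k)..real (Suc k)}" for t n
    proof (rule LIMSEQ_le_const2[OF tendsto_norm[OF tendsto_diff[OF w tendsto_const]]])
      show "\<exists>N. \<forall>m\<ge>N. norm (V (s m) t - V (s n) t) \<le> C * (3/2 * (1/3)^n)" using C that by blast
    qed
    then show ?thesis by blast
  qed
  have loc: "((\<lambda>t. C0 t x) has_vector_derivative w t) (at t)" "isCont w t" for t
  proof -
    obtain k where k: "t \<in> {- real (Suc k)<..<real (Suc k)}" using inint by blast
    let ?T = "{- real (Suc k)<..<real (Suc k)}"
    obtain C where C': "\<forall>t\<in>{- real (Suc k)..real (Suc k)}. \<forall>n. norm (w t - V (s n) t) \<le> C * (3/2 * (1/3)^n)" using wrate[of k] by blast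
    have C: "norm (w t - V (s n) t) \<le> C * (3/2 * (1/3)^n)" if "t \<in> ?T" for t n
    proof -
      have "t \<in> {- real (Suc k)..real (Suc k)}" using that by auto
      then show ?thesis using C' by blast
    qed
    have ev: "\<forall>\<^sub>F n in sequentially. \<forall>t\<in>?T. norm (V (s n) t - w t) < e" if "e > 0" for e
      using order_tendstoD(2)[OF small[of C] that]
    proof eventually_elim
      case (elim n)
      show ?case using le_less_trans[OF C elim] by (simp only: norm_minus_commute) blast
    qed
    have "uniform_limit ?T (\<lambda>n. V (s n)) w sequentially"
      unfolding uniform_limit_iff dist_norm using ev by blast
    then have "continuous_on ?T w"
      by (rule uniform_limit_theorem[rotated]) (simp, intro always_eventually allI E_derivative s)
    then show "isCont w t" using k by (simp add: continuous_on_eq_continuous_at[OF open_greaterThanLessThan])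
    have "\<exists>g. \<forall>t\<in>?T. (\<lambda>n. C0 t (s n)) \<longlonglongrightarrow> g t \<and> (g has_derivative (\<lambda>h. h *\<^sub>R w t)) (at t within ?T)"
    proof (rule has_derivative_sequence[where f' = "\<lambda>n t h. h *\<^sub>R V (s n) t" and l = x])
      show "((\<lambda>t. C0 t (s n)) has_derivative (\<lambda>h. h *\<^sub>R V (s n) t)) (at t within ?T)" for n t
        using has_vector_derivative_at_within[OF E_derivative(1)[OF s]] unfolding has_vector_derivative_def by blast
      show "\<forall>\<^sub>F n in sequentially. \<forall>t\<in>?T. \<forall>h. norm (h *\<^sub>R V (s n) t - h *\<^sub>R w t) \<le> e * norm h" if "e > 0" for e
        using ev[OF that]
      proof eventually_elim
        case (elim n)
        show ?case
        proof (intro ballI allI)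
          fix t h assume "t \<in> ?T"
          then have "\<bar>h\<bar> * norm (V (s n) t - w t) \<le> \<bar>h\<bar> * e" using elim by (intro mult_left_mono) (auto intro: less_imp_le)
          then show "norm (h *\<^sub>R V (s n) t - h *\<^sub>R w t) \<le> e * norm h"
            by (simp add: mult.commute flip: scaleR_diff_right)
        qed
      qed
      show "(0::real) \<in> ?T" by auto
      show "(\<lambda>n. C0 0 (s n)) \<longlonglongrightarrow> x" using x(1) by simp
    qed simp
    then obtain g where g: "\<And>t. t \<in> ?T \<Longrightarrow> (\<lambda>n. C0 t (s n)) \<longlonglongrightarrow> g t"
      "(g has_derivative (\<lambda>h. h *\<^sub>R w t)) (at t within ?T)" using k by blast
    have geq: "g u = C0 u x" if "u \<in> ?T" for u
      using LIMSEQ_unique[OF g(1)[OF that]] blinfun.tendsto[OF tendsto_const x(1)] by blast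
    have "(g has_vector_derivative w t) (at t)"
      using g(2) k unfolding has_vector_derivative_def by (simp add: at_within_open[OF _ open_greaterThanLessThan])
    then show "((\<lambda>t. C0 t x) has_vector_derivative w t) (at t)"
      by (rule has_vector_derivative_transform_within_open[OF _ open_greaterThanLessThan k]) (rule geq)
  qed
  have xE: "x \<in> E" "V x = w" using E_memI[OF loc(1)] loc(2) by (auto intro: continuous_at_imp_continuous_on)
  obtain C where C: "\<And>t n. t \<in> {- real (Suc 0)..real (Suc 0)} \<Longrightarrow> norm (w t - V (s n) t) \<le> C * (3/2 * (1/3)^n)" using wrate[of 0] by blast
  have "\<nu> (x - s n) \<le> (1 + C) * (3/2 * (1/3)^n)" for n
  proof (rule \<nu>_le)
    show "x - s n \<in> E" using E_diff[OF xE(1) s] by blast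
    fix t :: real assume t: "t \<in> {0..1}"
    have "V (x - s n) t = w t - V (s n) t" using E_diff[OF xE(1) s] xE(2) by simp
    then show "norm (x - s n) + norm (V (x - s n) t) \<le> (1 + C) * (3/2 * (1/3)^n)"
      using x(2)[of n] C[of t n] t by (simp add: distrib_right)
  qed
  moreover have "0 \<le> \<nu> (x - s n)" for n using \<nu>_ge E_diff[OF xE(1) s] norm_ge_zero order_trans by blast
  ultimately have "(\<lambda>n. \<nu> (x - s n)) \<longlonglongrightarrow> 0"
    by (intro tendsto_sandwich[OF _ _ tendsto_const small[of "1 + C"]]) auto
  then show ?thesis using xE by blast
qed

text \<open>Uniform boundedness on the complete space \<open>E\<close>; pointwise boundedness holds since \<open>t \<mapsto> Bt t x\<close> is
  continuous on a compact interval.\<close>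

lemma perturbation_uniformly_bounded:
  assumes adm: "admissible_perturbation A C0 Bt"
  shows "\<exists>K\<ge>0. \<forall>t\<in>{0..b}. \<forall>x\<in>E. norm (Bt t x) \<le> K * \<nu> x"
proof -
  have lin: "bounded_linear_from_E A C0 (Bt t)" and C1: "x \<in> E \<Longrightarrow> (\<lambda>t. Bt t x) C1_differentiable_on UNIV" for t x
    using adm unfolding admissible_perturbation_def by auto
  have "\<exists>K. \<forall>t\<in>{0..b}. \<forall>x\<in>E. norm (Bt t x) \<le> K * \<nu> x"
  proof (rule uniform_boundedness[OF subspace_E \<nu>_add \<nu>_scale E_complete])
    fix x assume "x \<in> E"
    then have "continuous_on {0..b} (\<lambda>t. Bt t x)"
      using C1_differentiable_imp_continuous_on[OF C1] continuous_on_subset by blast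
    then have "bounded ((\<lambda>t. Bt t x) ` {0..b})" by (intro compact_imp_bounded compact_continuous_image) auto
    then show "\<exists>K. \<forall>t\<in>{0..b}. norm (Bt t x) \<le> K" unfolding bounded_iff by blast
  next
    fix t show "\<exists>K. \<forall>x\<in>E. norm (Bt t x) \<le> K * \<nu> x" using lin[of t] unfolding bounded_linear_from_E_def by blast
  next
    fix t x y assume "x \<in> E" "y \<in> E"
    then show "norm (Bt t (x + y)) \<le> norm (Bt t x) + norm (Bt t y)"
      using lin[of t] norm_triangle_ineq unfolding bounded_linear_from_E_def by metis
  next
    fix t c x assume "x \<in> E"
    then show "norm (Bt t (c *\<^sub>R x)) = \<bar>c\<bar> * norm (Bt t x)"
      using lin[of t] unfolding bounded_linear_from_E_def by simp
  qed auto
  then obtain K where K: "\<And>t x. t \<in> {0..b} \<Longrightarrow> x \<in> E \<Longrightarrow> norm (Bt t x) \<le> K * \<nu> x" by blast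
  have "norm (Bt t x) \<le> \<bar>K\<bar> * \<nu> x" if "t \<in> {0..b}" "x \<in> E" for t x
  proof -
    have "\<nu> x \<ge> 0" using \<nu>_ge[OF that(2)] norm_ge_zero[of x] by linarith
    then show ?thesis using K[OF that] by (meson abs_ge_self mult_right_mono order_trans)
  qed
  then show ?thesis by (intro exI[of _ "\<bar>K\<bar>"]) auto
qed

end

section \<open>Compactness of the perturbed evolution operator\<close>

locale perturbed_cosine = cosine_gen C0 A D
  for C0 :: "real \<Rightarrow> 'a::banach \<Rightarrow>\<^sub>L 'a" and A D +
  fixes Bt :: "real \<Rightarrow> 'a \<Rightarrow> 'a" and S :: "real \<Rightarrow> real \<Rightarrow> 'a \<Rightarrow>\<^sub>L 'a" and b :: real
  assumes adm: "admissible_perturbation A C0 Bt"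
    and assoc: "associated_evolution {0..b} A C0 Bt S"
begin

lemma evolution_solution:
  assumes "s \<in> {0..b}" "y \<in> E"
  shows "perturbed_solution {0..b} A C0 Bt s y (\<lambda>t. S t s y)"
  using assoc assms unfolding associated_evolution_def by blast

lemma S_in_E: "s \<in> {0..b} \<Longrightarrow> y \<in> E \<Longrightarrow> t \<in> {0..b} \<Longrightarrow> S t s y \<in> E"
  using evolution_solution unfolding perturbed_solution_def by blast

text \<open>\<open>\<tau> \<mapsto> S(\<tau>,s)y\<close> is continuous into \<open>E\<close>, the operators \<open>Bt \<tau>\<close> are uniformly bounded on \<open>E\<close> and
  strongly continuous.\<close>

lemma continuous_forcing:
  assumes s: "s \<in> {0..b}" and y: "y \<in> E"
  shows "continuous_on {0..b} (\<lambda>\<tau>. Bt \<tau> (S \<tau> s y))"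
  unfolding continuous_on_def
proof
  fix t assume t: "t \<in> {0..b}"
  define x where "x \<tau> = S \<tau> s y" for \<tau>
  obtain K where K: "\<forall>t\<in>{0..b}. \<forall>x\<in>E. norm (Bt t x) \<le> K * \<nu> x"
    using perturbation_uniformly_bounded[OF adm, of b] by blast
  have xE: "x \<tau> \<in> E" if "\<tau> \<in> {0..b}" for \<tau> unfolding x_def by (rule S_in_E[OF s y that])
  have "((\<lambda>\<tau>. \<nu> (x \<tau> - x t)) \<longlongrightarrow> 0) (at t within {0..b})"
    using evolution_solution[OF s y] t unfolding perturbed_solution_def x_def by blast
  then have lim1: "((\<lambda>\<tau>. K * \<nu> (x \<tau> - x t)) \<longlongrightarrow> 0) (at t within {0..b})" by (rule tendsto_mult_right_zero)
  have "((\<lambda>\<tau>. Bt \<tau> (x \<tau> - x t)) \<longlongrightarrow> 0) (at t within {0..b})"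
  proof (rule Lim_null_comparison[OF _ lim1])
    have "\<forall>\<tau>\<in>{0..b}. norm (Bt \<tau> (x \<tau> - x t)) \<le> K * \<nu> (x \<tau> - x t)"
      using K E_diff[OF xE xE[OF t]] by blast
    then show "\<forall>\<^sub>F \<tau> in at t within {0..b}. norm (Bt \<tau> (x \<tau> - x t)) \<le> K * \<nu> (x \<tau> - x t)"
      unfolding eventually_at_filter by (intro always_eventually) blast
  qed
  moreover have "((\<lambda>\<tau>. Bt \<tau> (x t)) \<longlongrightarrow> Bt t (x t)) (at t within {0..b})"
  proof -
    have "(\<lambda>t'. Bt t' (x t)) C1_differentiable_on UNIV" using adm xE[OF t] unfolding admissible_perturbation_def by blast
    then have "continuous_on {0..b} (\<lambda>t'. Bt t' (x t))"
      using C1_differentiable_imp_continuous_on continuous_on_subset by blast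
    then show ?thesis using t unfolding continuous_on_def by blast
  qed
  ultimately have "((\<lambda>\<tau>. Bt \<tau> (x \<tau> - x t) + Bt \<tau> (x t)) \<longlongrightarrow> 0 + Bt t (x t)) (at t within {0..b})" by (rule tendsto_add)
  moreover have "\<forall>\<^sub>F \<tau> in at t within {0..b}. Bt \<tau> (x \<tau> - x t) + Bt \<tau> (x t) = Bt \<tau> (x \<tau>)"
  proof -
    have "Bt \<tau> (x \<tau> - x t) + Bt \<tau> (x t) = Bt \<tau> (x \<tau>)" if "\<tau> \<in> {0..b}" for \<tau>
    proof -
      have "Bt \<tau> ((x \<tau> - x t) + x t) = Bt \<tau> (x \<tau> - x t) + Bt \<tau> (x t)"
        using adm E_diff[OF xE[OF that] xE[OF t]] xE[OF t]
        unfolding admissible_perturbation_def bounded_linear_from_E_def by blast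
      then show ?thesis by simp
    qed
    then show ?thesis unfolding eventually_at_filter by (intro always_eventually) blast
  qed
  ultimately show "((\<lambda>\<tau>. Bt \<tau> (S \<tau> s y)) \<longlongrightarrow> Bt t (S t s y)) (at t within {0..b})"
    unfolding x_def add_0_left by (rule Lim_transform_eventually)
qed

lemma variation_of_constants:
  assumes "s \<in> {0..b}" "y \<in> E" "t \<in> {s..b}"
  shows "S t s y = S0 (t - s) y + integral {s..t} (\<lambda>\<tau>. Sine (t - \<tau>) (Bt \<tau> (S \<tau> s y)))"
proof -
  have "t \<in> {0..b}" using assms by auto
  then have "S t s y = S0 (t - s) y + signed_integral s t (\<lambda>\<tau>. S0 (t - \<tau>) (Bt \<tau> (S \<tau> s y)))"
    using evolution_solution[OF assms(1,2)] unfolding perturbed_solution_def by blast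
  then show ?thesis using assms(3) unfolding signed_integral_def by simp
qed

text \<open>The point is that the right-hand side contains the norm of \<open>X\<close>, although \<open>Bt t\<close> is bounded on \<open>E\<close> only.
  Let \<open>x\<close> be the solution at time \<open>u\<close>. Applying \<open>C\<^sub>0(r)\<close> to the integral equation and using
  \<open>C0_S0\<close>, one sees that \<open>r \<mapsto> C\<^sub>0(r)x\<close> is Lipschitz with a constant controlled by the norm of \<open>y\<close> and the
  integral of the norm of the forcing term. As \<open>x \<in> E\<close>, its derivative \<open>V x\<close> exists and obeys the
  same bound, so no differentiation under the integral sign is required. This estimates \<open>x\<close> in \<open>E\<close>, hence the
  forcing term at time \<open>u\<close> by its own integral, and Gronwall's lemma applies.\<close>

lemma forcing_bound: "\<exists>\<kappa>\<ge>0. \<forall>s\<in>{0..b}. \<forall>y\<in>E. \<forall>t\<in>{s..b}. norm (Bt t (S t s y)) \<le> \<kappa> * norm y"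
proof -
  define R where "R = b + 1"
  obtain M where M0: "M \<ge> 0" and M: "\<And>r. r \<in> {-R..R} \<Longrightarrow> norm (C0 r) \<le> M" using C0_bounded[of R] by blast
  obtain K where K0: "K \<ge> 0" and K: "\<forall>t\<in>{0..b}. \<forall>x\<in>E. norm (Bt t x) \<le> K * \<nu> x"
    using perturbation_uniformly_bounded[OF adm, of b] by blast
  define c where "c = K * (M * R + M) + 1"
  have bound: "norm (Bt t (S t s y)) \<le> (2 * c * exp (2 * c * b)) * norm y" if s: "s \<in> {0..b}" and y: "y \<in> E" and t: "t \<in> {s..b}" for s y t
  proof -
    have R: "R \<ge> 0" "b \<le> R" using s unfolding R_def by auto
    have c: "c > 0" unfolding c_def using K0 M0 R by (simp add: add_nonneg_pos)
    define z where "z \<tau> = Bt \<tau> (S \<tau> s y)" for \<tau>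
    have zc: "continuous_on {s..b} z" unfolding z_def using continuous_forcing[OF s y] by (rule continuous_on_subset) (use s in auto)
    have main: "norm (z u) \<le> c * (norm y + integral {s..u} (\<lambda>\<tau>. norm (z \<tau>)))" if u: "u \<in> {s..b}" for u
    proof -
      have u0: "u \<in> {0..b}" "u - s \<in> {0..b}" using u s by auto
      have zu: "continuous_on {s..u} z" by (rule continuous_on_subset[OF zc]) (use u in auto)
      have nz: "(\<lambda>\<tau>. norm (z \<tau>)) integrable_on {s..u}" by (intro integrable_continuous_real continuous_intros zu)
      define I where "I = integral {s..u} (\<lambda>\<tau>. norm (z \<tau>))"
      have I0: "I \<ge> 0" unfolding I_def using nz by (rule integral_nonneg) simp
      define x where "x = S u s y"
      have xE: "x \<in> E" unfolding x_def by (rule S_in_E[OF s y u0(1)])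
      have xeq: "x = S0 (u - s) y + integral {s..u} (\<lambda>\<tau>. Sine (u - \<tau>) (z \<tau>))"
        unfolding x_def z_def by (rule variation_of_constants[OF s y u])
      have int: "(\<lambda>\<tau>. Sine (g \<tau>) (z \<tau>)) integrable_on {s..u}" if "continuous_on {s..u} g" for g
        by (intro integrable_continuous_real bounded_bilinear.continuous_on[OF bounded_bilinear_blinfun_apply]
            continuous_on_compose2[OF Sine_continuous[of UNIV] that] zu) auto
      have Sb: "norm (Sine r v - Sine r' v) \<le> M * \<bar>r - r'\<bar> * norm v" if "r \<in> {-R..R}" "r' \<in> {-R..R}" for r r' v
        using S0_lipschitz[OF M that(2,1), of v] by (simp add: mult_ac)
      have Ibound: "norm (integral {s..u} (\<lambda>\<tau>. Sine (g \<tau>) (z \<tau>) - Sine (h \<tau>) (z \<tau>))) \<le> M * d * I"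
        if g: "continuous_on {s..u} g" "continuous_on {s..u} h" and gh: "\<And>\<tau>. \<tau> \<in> {s..u} \<Longrightarrow> g \<tau> \<in> {-R..R} \<and> h \<tau> \<in> {-R..R} \<and> \<bar>g \<tau> - h \<tau>\<bar> \<le> d" for g h d
      proof -
        have "norm (integral {s..u} (\<lambda>\<tau>. Sine (g \<tau>) (z \<tau>) - Sine (h \<tau>) (z \<tau>))) \<le> integral {s..u} (\<lambda>\<tau>. M * d * norm (z \<tau>))"
        proof (rule integral_norm_bound_integral)
          fix \<tau> assume "\<tau> \<in> {s..u}"
          note gh = gh[OF this]
          have "norm (Sine (g \<tau>) (z \<tau>) - Sine (h \<tau>) (z \<tau>)) \<le> M * \<bar>g \<tau> - h \<tau>\<bar> * norm (z \<tau>)" using gh by (intro Sb) auto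
          also have "\<dots> \<le> M * d * norm (z \<tau>)" using gh M0 by (intro mult_right_mono mult_left_mono) auto
          finally show "norm (Sine (g \<tau>) (z \<tau>) - Sine (h \<tau>) (z \<tau>)) \<le> M * d * norm (z \<tau>)" .
        qed (intro integrable_diff int g integrable_on_mult_right nz)+
        then show ?thesis unfolding I_def by simp
      qed
      have xn: "norm x \<le> M * R * (norm y + I)"
      proof -
        have "norm (S0 (u - s) y) \<le> M * \<bar>u - s\<bar> * norm y" using Sb[of "u - s" 0 y] u0 R by simp
        also have "\<dots> \<le> M * R * norm y" using u0 R M0 by (intro mult_right_mono mult_left_mono) auto
        finally have "norm (S0 (u - s) y) \<le> M * R * norm y" .
        moreover have "norm (integral {s..u} (\<lambda>\<tau>. Sine (u - \<tau>) (z \<tau>) - Sine 0 (z \<tau>))) \<le> M * R * I"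
          by (rule Ibound) (use s u R in \<open>auto intro!: continuous_intros\<close>)
        ultimately show ?thesis unfolding xeq
          using norm_triangle_ineq[of "S0 (u - s) y" "integral {s..u} (\<lambda>\<tau>. Sine (u - \<tau>) (z \<tau>))"] by (simp add: algebra_simps)
      qed
      have Vx: "norm (V x r) \<le> M * (norm y + I)" if r: "r \<in> {0..1}" for r
      proof (rule derivative_norm_le_of_lipschitz[OF E_derivative(1)[OF xE] _ r])
        fix q :: real assume q: "q \<in> {0..1}"
        have C0x: "C0 r x = (1/2) *\<^sub>R (S0 (u - s + r) y + S0 (u - s - r) y)
            + (1/2) *\<^sub>R (integral {s..u} (\<lambda>\<tau>. Sine (u - \<tau> + r) (z \<tau>)) + integral {s..u} (\<lambda>\<tau>. Sine (u - \<tau> - r) (z \<tau>)))" for r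
        proof -
          have i: "(\<lambda>\<tau>. Sine (u - \<tau>) (z \<tau>)) integrable_on {s..u}" "(\<lambda>\<tau>. Sine (u - \<tau> + r) (z \<tau>)) integrable_on {s..u}"
            "(\<lambda>\<tau>. Sine (u - \<tau> - r) (z \<tau>)) integrable_on {s..u}" by (intro int continuous_intros)+
          have "C0 r (integral {s..u} (\<lambda>\<tau>. Sine (u - \<tau>) (z \<tau>))) = integral {s..u} (\<lambda>\<tau>. C0 r (Sine (u - \<tau>) (z \<tau>)))"
            using integral_linear[OF i(1) blinfun.bounded_linear_right[of "C0 r"]] by (simp add: o_def)
          also have "\<dots> = integral {s..u} (\<lambda>\<tau>. (1/2) *\<^sub>R (Sine (u - \<tau> + r) (z \<tau>) + Sine (u - \<tau> - r) (z \<tau>)))"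
            by (simp add: C0_S0)
          also have "\<dots> = (1/2) *\<^sub>R (integral {s..u} (\<lambda>\<tau>. Sine (u - \<tau> + r) (z \<tau>)) + integral {s..u} (\<lambda>\<tau>. Sine (u - \<tau> - r) (z \<tau>)))"
            using i by (simp only: integral_cmul Henstock_Kurzweil_Integration.integral_add)
          finally show ?thesis unfolding xeq by (simp add: blinfun.add_right C0_S0)
        qed
        define a1 where "a1 = S0 (u - s + q) y - S0 (u - s + r) y"
        define a2 where "a2 = S0 (u - s - q) y - S0 (u - s - r) y"
        define a3 where "a3 = integral {s..u} (\<lambda>\<tau>. Sine (u - \<tau> + q) (z \<tau>) - Sine (u - \<tau> + r) (z \<tau>))"
        define a4 where "a4 = integral {s..u} (\<lambda>\<tau>. Sine (u - \<tau> - q) (z \<tau>) - Sine (u - \<tau> - r) (z \<tau>))"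
        have "norm a1 \<le> M * \<bar>q - r\<bar> * norm y" "norm a2 \<le> M * \<bar>q - r\<bar> * norm y"
          using Sb[of "u - s + q" "u - s + r" y] Sb[of "u - s - q" "u - s - r" y] u0 q r
          unfolding a1_def a2_def R_def by (auto simp: abs_minus_commute)
        moreover have "norm a3 \<le> M * \<bar>q - r\<bar> * I" "norm a4 \<le> M * \<bar>q - r\<bar> * I"
          unfolding a3_def a4_def by (intro Ibound continuous_intros; use s u q r in \<open>auto simp: R_def\<close>)+
        moreover have "C0 q x - C0 r x = (1/2) *\<^sub>R ((a1 + a2) + (a3 + a4))"
        proof -
          have "a3 = integral {s..u} (\<lambda>\<tau>. Sine (u - \<tau> + q) (z \<tau>)) - integral {s..u} (\<lambda>\<tau>. Sine (u - \<tau> + r) (z \<tau>))"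
            unfolding a3_def by (intro integral_diff int continuous_intros)
          moreover have "a4 = integral {s..u} (\<lambda>\<tau>. Sine (u - \<tau> - q) (z \<tau>)) - integral {s..u} (\<lambda>\<tau>. Sine (u - \<tau> - r) (z \<tau>))"
            unfolding a4_def by (intro integral_diff int continuous_intros)
          ultimately show ?thesis unfolding C0x a1_def a2_def by (simp add: scaleR_right_distrib scaleR_right_diff_distrib)
        qed
        moreover have "norm ((a1 + a2) + (a3 + a4)) \<le> (norm a1 + norm a2) + (norm a3 + norm a4)"
          by (intro order_trans[OF norm_triangle_ineq] add_mono norm_triangle_ineq)
        ultimately have "2 * norm (C0 q x - C0 r x) \<le> 2 * (M * \<bar>q - r\<bar> * norm y) + 2 * (M * \<bar>q - r\<bar> * I)" by simp
        then show "norm (C0 q x - C0 r x) \<le> M * (norm y + I) * \<bar>q - r\<bar>" by (simp add: algebra_simps)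
      qed
      have "\<nu> x \<le> (M * R + M) * (norm y + I)"
        by (rule \<nu>_le[OF xE]) (use xn Vx in \<open>simp add: add_mono distrib_right\<close>)
      then have "K * \<nu> x \<le> K * ((M * R + M) * (norm y + I))" using K0 by (rule mult_left_mono)
      moreover have "norm (z u) \<le> K * \<nu> x" unfolding z_def x_def[symmetric] using K u0 xE by blast
      moreover have "K * ((M * R + M) * (norm y + I)) \<le> c * (norm y + I)"
        unfolding c_def using I0 by (simp add: algebra_simps)
      ultimately show ?thesis unfolding I_def by linarith
    qed
    have "norm (z t) \<le> 2 * c * norm y * exp (2 * c * (b - s))"
      by (rule Gronwall_continuous[OF _ c _ main t]) (auto intro: continuous_on_norm zc)
    also have "\<dots> \<le> 2 * c * norm y * exp (2 * c * b)" using c s by (intro mult_left_mono) auto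
    finally show ?thesis unfolding z_def by (simp add: mult_ac)
  qed
  have nonneg: "2 * c * exp (2 * c * b) \<ge> 0" if "b \<ge> 0"
    using K0 M0 that unfolding c_def R_def by auto
  show ?thesis
  proof (cases "b < 0")
    case False
    then show ?thesis using nonneg bound by (intro exI[of _ "2 * c * exp (2 * c * b)"]) auto
  qed (intro exI[of _ 0], auto)
qed

text \<open>On the dense subspace \<open>E\<close> the integral equation writes \<open>S(t,s)y\<close> as a compact operator applied to \<open>y\<close>
  plus an integral covered by \<open>totally_bounded_integrals\<close>.\<close>

lemma compact_operator_S:
  assumes cpt: "\<forall>t>0. compact_operator (S0 t)" and D: "closure D = UNIV" and s: "s \<in> {0..b}" and t: "t \<in> {s..b}"
  shows "compact_operator (blinfun_apply (S t s))"
proof (rule compact_operatorI[OF blinfun.bounded_linear_right])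
  fix \<epsilon> :: real assume \<epsilon>: "\<epsilon> > 0"
  obtain \<kappa> where \<kappa>: "\<kappa> \<ge> 0" "\<And>y u. y \<in> E \<Longrightarrow> u \<in> {s..b} \<Longrightarrow> norm (Bt u (S u s y)) \<le> \<kappa> * norm y" using forcing_bound s by blast
  let ?R = "{integral {s..t} (\<lambda>\<tau>. Sine (t - \<tau>) (f \<tau>)) |f. f integrable_on {s..t} \<and> (\<forall>\<tau>\<in>{s..t}. norm (f \<tau>) \<le> \<kappa> * 2)}"
  have 1: "finite_cover (\<epsilon>/4) (blinfun_apply (Sine (t - s)) ` cball 0 2)"
    by (rule compact_operator_finite_cover[OF compact_operator_Sine[OF cpt]]) (use t \<epsilon> in auto)
  have 2: "finite_cover (\<epsilon>/4) ?R"
  proof (rule totally_bounded_integrals)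
    show "continuous_on {s..t} (\<lambda>\<tau>. Sine (t - \<tau>))"
      by (intro continuous_on_compose2[OF Sine_continuous[of UNIV]] continuous_intros) auto
    show "compact_operator (blinfun_apply (Sine (t - \<tau>)))" if "\<tau> \<in> {s..t}" for \<tau>
      by (rule compact_operator_Sine[OF cpt]) (use that in auto)
  qed (use t \<epsilon> \<kappa> in auto)
  have "finite_cover (\<epsilon>/4 + \<epsilon>/4 + \<epsilon>/2) (blinfun_apply (S t s) ` cball 0 1)"
  proof (rule finite_cover_near[OF finite_cover_plus[OF 1 2]])
    fix v assume "v \<in> blinfun_apply (S t s) ` cball 0 1"
    then obtain y where y: "v = S t s y" "norm y \<le> 1" by auto
    define \<delta> where "\<delta> = min 1 (\<epsilon> / 2 / (norm (S t s) + 1))"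
    have \<delta>: "\<delta> > 0" unfolding \<delta>_def using \<epsilon> by (simp add: add_nonneg_pos)
    have "y \<in> closure D" using D by simp
    then obtain y' where y': "y' \<in> D" "dist y' y < \<delta>" using \<delta> unfolding closure_approachable by blast
    have E: "y' \<in> E" using y' D_subset_E by blast
    have n2: "norm y' \<le> 2" using y'(2) y(2) norm_triangle_sub[of y' y] unfolding \<delta>_def dist_norm by simp
    have "S t s y' = Sine (t - s) y' + integral {s..t} (\<lambda>\<tau>. Sine (t - \<tau>) (Bt \<tau> (S \<tau> s y')))"
      using variation_of_constants[OF s E t] by simp
    moreover have "(\<lambda>\<tau>. Bt \<tau> (S \<tau> s y')) integrable_on {s..t}"
      by (intro integrable_continuous_real continuous_on_subset[OF continuous_forcing[OF s E]]) (use s t in auto)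
    moreover have "norm (Bt \<tau> (S \<tau> s y')) \<le> \<kappa> * 2" if "\<tau> \<in> {s..t}" for \<tau>
      using \<kappa>(2)[OF E, of \<tau>] mult_left_mono[OF n2 \<kappa>(1)] that t by simp
    ultimately have mem: "S t s y' \<in> {x + z |x z. x \<in> blinfun_apply (Sine (t - s)) ` cball 0 2 \<and> z \<in> ?R}"
      using n2 by (intro CollectI exI[of _ "Sine (t - s) y'"] exI[of _ "integral {s..t} (\<lambda>\<tau>. Sine (t - \<tau>) (Bt \<tau> (S \<tau> s y')))"]) auto
    have "dist (S t s y') v \<le> norm (S t s) * dist y' y"
      unfolding y(1) dist_norm blinfun.diff_right[symmetric] by (rule norm_blinfun)
    also have "\<dots> \<le> (norm (S t s) + 1) * (\<epsilon> / 2 / (norm (S t s) + 1))"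
      using y'(2) unfolding \<delta>_def by (intro mult_mono) auto
    also have "\<dots> = \<epsilon> / 2"
    proof -
      have "norm (S t s) + 1 \<noteq> 0" using norm_ge_zero[of "S t s"] by linarith
      then show ?thesis by (rule nonzero_mult_div_cancel_left[of _ "\<epsilon> / 2", unfolded times_divide_eq_right[symmetric]])
    qed
    finally show "\<exists>a\<in>{x + z |x z. x \<in> blinfun_apply (Sine (t - s)) ` cball 0 2 \<and> z \<in> ?R}. dist a v \<le> \<epsilon> / 2"
      using mem by blast
  qed
  then show "finite_cover \<epsilon> (blinfun_apply (S t s) ` cball 0 1)" by simp
qed

end

text \<open>For each vector the difference quotients are bounded by the continuous partial derivatives; the
  uniform boundedness principle makes the bound uniform over the unit ball.\<close>

lemma evolution_lipschitz:
  fixes S :: "real \<Rightarrow> real \<Rightarrow> 'a::banach \<Rightarrow>\<^sub>L 'a"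
  assumes Z1: "evolution_Z1 {0..b} S" and b: "b > 0"
  shows "\<exists>M\<ge>0. \<forall>t\<in>{0..b}. \<forall>s\<in>{0..b}. \<forall>t'\<in>{0..b}. \<forall>s'\<in>{0..b}. norm (S t s - S t' s') \<le> M * (\<bar>t - t'\<bar> + \<bar>s - s'\<bar>)"
proof -
  let ?J = "{0..b}"
  let ?Q = "(?J \<times> ?J) \<times> (?J \<times> ?J)"
  define T where "T = (\<lambda>((t, s), (t', s')). (1 / (\<bar>t - t'\<bar> + \<bar>s - s'\<bar>)) *\<^sub>R (S t s - S t' s'))"
  have "\<exists>M\<ge>0. \<forall>i\<in>?Q. norm (T i) \<le> M"
  proof (rule uniform_boundedness_blinfun)
    fix x
    let ?g = "\<lambda>t s. S t s x"
    have C1: "class_C1 ?J ?g" using Z1 unfolding evolution_Z1_def by blast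
    have bd: "\<exists>K. \<forall>p\<in>?J \<times> ?J. norm (case p of (t, s) \<Rightarrow> h t s) \<le> K" if "continuous_on (?J \<times> ?J) (\<lambda>(t, s). h t s)" for h :: "real \<Rightarrow> real \<Rightarrow> 'a"
    proof -
      have "bounded ((\<lambda>(t, s). h t s) ` (?J \<times> ?J))"
        by (intro compact_imp_bounded compact_continuous_image that compact_Times) auto
      then show ?thesis unfolding bounded_iff by blast
    qed
    obtain K1 where K1: "\<And>t s. t \<in> ?J \<Longrightarrow> s \<in> ?J \<Longrightarrow> norm (pd1 ?J ?g t s) \<le> K1"
      using bd[of "pd1 ?J ?g"] C1 unfolding class_C1_def by fastforce
    obtain K2 where K2: "\<And>t s. t \<in> ?J \<Longrightarrow> s \<in> ?J \<Longrightarrow> norm (pd2 ?J ?g t s) \<le> K2"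
      using bd[of "pd2 ?J ?g"] C1 unfolding class_C1_def by fastforce
    define K where "K = max K1 K2"
    have l1: "norm (?g t s - ?g t' s) \<le> K * \<bar>t - t'\<bar>" if "t \<in> ?J" "s \<in> ?J" "t' \<in> ?J" for t t' s
    proof (rule norm_diff_le_of_vector_derivative_bound)
      show "((\<lambda>t. ?g t s) has_vector_derivative pd1 ?J ?g u s) (at u within ?J)" if "u \<in> ?J" for u
        using C1 that \<open>s \<in> ?J\<close> unfolding class_C1_def pd1_def by (auto simp: vector_derivative_works)
      show "norm (pd1 ?J ?g u s) \<le> K" if "u \<in> ?J" for u using K1[OF that \<open>s \<in> ?J\<close>] unfolding K_def by simp
    qed (use that in auto)
    have l2: "norm (?g t s - ?g t s') \<le> K * \<bar>s - s'\<bar>" if "t \<in> ?J" "s \<in> ?J" "s' \<in> ?J" for t s s'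
    proof (rule norm_diff_le_of_vector_derivative_bound)
      show "((\<lambda>s. ?g t s) has_vector_derivative pd2 ?J ?g t u) (at u within ?J)" if "u \<in> ?J" for u
        using C1 that \<open>t \<in> ?J\<close> unfolding class_C1_def pd2_def by (auto simp: vector_derivative_works)
      show "norm (pd2 ?J ?g t u) \<le> K" if "u \<in> ?J" for u using K2[OF \<open>t \<in> ?J\<close> that] unfolding K_def by simp
    qed (use that in auto)
    have K0: "K \<ge> 0" unfolding K_def using b by (intro max.coboundedI1 order_trans[OF norm_ge_zero K1[of 0 0]]) auto
    have "norm (T ((t, s), (t', s')) x) \<le> K" if "t \<in> ?J" "s \<in> ?J" "t' \<in> ?J" "s' \<in> ?J" for t s t' s'
    proof -
      define d where "d = \<bar>t - t'\<bar> + \<bar>s - s'\<bar>"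
      have "norm (?g t s - ?g t' s') \<le> K * \<bar>t - t'\<bar> + K * \<bar>s - s'\<bar>"
        using norm_triangle_ineq[of "?g t s - ?g t' s" "?g t' s - ?g t' s'"] l1[of t s t'] l2[of t' s s'] that by simp
      then have "norm (?g t s - ?g t' s') \<le> K * d" unfolding d_def by (simp add: algebra_simps)
      moreover have "d \<ge> 0" unfolding d_def by simp
      ultimately show ?thesis using K0
        by (cases "d = 0") (simp_all add: T_def blinfun.scaleR_left blinfun.diff_left flip: d_def, simp add: divide_le_eq)
    qed
    then show "\<exists>K. \<forall>i\<in>?Q. norm (T i x) \<le> K" by (intro exI[of _ K]) auto
  qed
  then obtain M where M: "M \<ge> 0" "\<And>t s t' s'. t \<in> ?J \<Longrightarrow> s \<in> ?J \<Longrightarrow> t' \<in> ?J \<Longrightarrow> s' \<in> ?J \<Longrightarrow> norm (T ((t, s), (t', s'))) \<le> M" by auto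
  have "norm (S t s - S t' s') \<le> M * (\<bar>t - t'\<bar> + \<bar>s - s'\<bar>)" if "t \<in> ?J" "s \<in> ?J" "t' \<in> ?J" "s' \<in> ?J" for t s t' s'
  proof (cases "\<bar>t - t'\<bar> + \<bar>s - s'\<bar> = 0")
    case False
    then have "\<bar>t - t'\<bar> + \<bar>s - s'\<bar> > 0" by (simp add: add_nonneg_eq_0_iff less_le)
    then show ?thesis using M(2)[OF that] unfolding T_def by (simp add: divide_le_eq)
  qed (simp add: add_nonneg_eq_0_iff)
  then show ?thesis using M(1) by blast
qed

section \<open>The Volterra operator of a compact evolution operator\<close>

text \<open>Extension by constant values outside \<open>[0,b]\<close> identifies \<open>C([0,b],X)\<close> with a subset of a complete
  normed type.\<close>

definition interval_bcontfun :: "real \<Rightarrow> (real \<Rightarrow> 'a::metric_space) \<Rightarrow> real \<Rightarrow>\<^sub>C 'a" where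
  "interval_bcontfun b x = Bcontfun (\<lambda>t. x (clamp 0 b t))"

lemma interval_bcontfun_apply:
  fixes x :: "real \<Rightarrow> 'a::metric_space"
  assumes "continuous_on {0..b} x"
  shows "apply_bcontfun (interval_bcontfun b x) t = x (clamp 0 b t)"
proof -
  have x: "continuous_on (cbox 0 b) x" using assms by simp
  have "(\<lambda>t. x (clamp 0 b t)) \<in> bcontfun"
    unfolding bcontfun_def using clamp_continuous_on[OF x]
      clamp_bounded[OF compact_imp_bounded[OF compact_continuous_image[OF x compact_cbox]]] by auto
  then show ?thesis unfolding interval_bcontfun_def by (simp add: Bcontfun_inverse)
qed

lemma clamp_Icc: "0 \<le> b \<Longrightarrow> clamp 0 b t \<in> {0..b::real}"
  using clamp_in_interval[of 0 b t] by simp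

lemma clamp_Icc_id: "t \<in> {0..b::real} \<Longrightarrow> clamp 0 b t = t"
  using clamp_cancel_cbox[of t 0 b] by simp

definition dominated_by :: "real \<Rightarrow> (real \<Rightarrow> real) \<Rightarrow> (real \<Rightarrow> 'a::banach) set" where
  "dominated_by b N = {f. f integrable_on {0..b} \<and> (\<forall>t\<in>{0..b}. norm (f t) \<le> N t)}"

locale compact_evolution =
  fixes b :: real and S :: "real \<Rightarrow> real \<Rightarrow> 'a::banach \<Rightarrow>\<^sub>L 'a" and M :: real
  assumes b_pos: "b > 0" and M_nonneg: "M \<ge> 0"
    and S_lipschitz: "\<And>t s t' s'. t \<in> {0..b} \<Longrightarrow> s \<in> {0..b} \<Longrightarrow> t' \<in> {0..b} \<Longrightarrow> s' \<in> {0..b}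
      \<Longrightarrow> norm (S t s - S t' s') \<le> M * (\<bar>t - t'\<bar> + \<bar>s - s'\<bar>)"
    and S_compact: "\<And>s t. s \<in> {0..b} \<Longrightarrow> t \<in> {s..b} \<Longrightarrow> compact_operator (blinfun_apply (S t s))"
begin

definition op_bound where "op_bound = norm (S 0 0) + 2 * M * b"

lemma op_bound_nonneg: "op_bound \<ge> 0" unfolding op_bound_def using M_nonneg b_pos by simp

lemma norm_S_le: "t \<in> {0..b} \<Longrightarrow> s \<in> {0..b} \<Longrightarrow> norm (S t s) \<le> op_bound"
proof -
  assume ts: "t \<in> {0..b}" "s \<in> {0..b}"
  have "norm (S t s - S 0 0) \<le> M * (\<bar>t - 0\<bar> + \<bar>s - 0\<bar>)" by (rule S_lipschitz) (use ts b_pos in auto)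
  also have "\<dots> \<le> M * (b + b)" using ts M_nonneg by (intro mult_left_mono add_mono) auto
  finally show ?thesis using norm_triangle_sub[of "S t s" "S 0 0"] unfolding op_bound_def by simp
qed

lemma norm_S_apply_le: "t \<in> {0..b} \<Longrightarrow> s \<in> {0..b} \<Longrightarrow> norm (S t s v) \<le> op_bound * norm v"
  using norm_blinfun[of "S t s" v] norm_S_le by (meson mult_right_mono norm_ge_zero order_trans)

lemma continuous_on_S: "t \<in> {0..b} \<Longrightarrow> T \<subseteq> {0..b} \<Longrightarrow> continuous_on T (\<lambda>s. S t s)"
proof -
  assume t: "t \<in> {0..b}" and T: "T \<subseteq> {0..b}"
  have "norm (S t s - S t s') \<le> M * norm (s - s')" if "s \<in> T" "s' \<in> T" for s s'
    using S_lipschitz[of t s t s'] that T t by (auto simp: subset_iff)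
  then have "M-lipschitz_on T (\<lambda>s. S t s)"
    using M_nonneg by (intro lipschitz_onI) (auto simp: dist_norm)
  then show ?thesis by (rule lipschitz_on_continuous_on)
qed

definition volterra :: "(real \<Rightarrow> 'a) \<Rightarrow> real \<Rightarrow> 'a" where
  "volterra f t = integral {0..t} (\<lambda>s. S t s (f s))"

lemma integrable_kernel:
  assumes f: "f \<in> dominated_by b N" and N: "N integrable_on {0..b}" and r: "r \<in> {0..b}" and cd: "{c..d} \<subseteq> {0..b}"
  shows "(\<lambda>s. S r s (f s)) integrable_on {c..d}"
  by (rule integrable_on_continuous_operator[OF continuous_on_S[OF r cd] integrable_subinterval_real[OF _ cd]
        integrable_subinterval_real[OF N cd]])
    (use f cd in \<open>auto simp: dominated_by_def\<close>)

lemma norm_integral_kernel_le: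
  assumes f: "f \<in> dominated_by b N" and N: "N integrable_on {0..b}" and r: "r \<in> {0..b}" and cd: "{c..d} \<subseteq> {0..b}"
  shows "norm (integral {c..d} (\<lambda>s. S r s (f s))) \<le> op_bound * integral {c..d} N"
proof -
  have "norm (integral {c..d} (\<lambda>s. S r s (f s))) \<le> integral {c..d} (\<lambda>s. op_bound * N s)"
  proof (rule integral_norm_bound_integral[OF integrable_kernel[OF assms]])
    show "(\<lambda>s. op_bound * N s) integrable_on {c..d}" by (rule integrable_on_mult_right[OF integrable_subinterval_real[OF N cd]])
    fix s assume "s \<in> {c..d}"
    then have s: "s \<in> {0..b}" using cd by auto
    have "norm (S r s (f s)) \<le> op_bound * norm (f s)" by (rule norm_S_apply_le[OF r s])
    also have "\<dots> \<le> op_bound * N s" using f s op_bound_nonneg by (intro mult_left_mono) (auto simp: dominated_by_def)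
    finally show "norm (S r s (f s)) \<le> op_bound * N s" .
  qed
  then show ?thesis by simp
qed

lemma dominated_nonneg: "f \<in> dominated_by b N \<Longrightarrow> s \<in> {0..b} \<Longrightarrow> 0 \<le> N s"
  unfolding dominated_by_def using norm_ge_zero order_trans by blast

lemma norm_volterra_le:
  assumes f: "f \<in> dominated_by b N" and N: "N integrable_on {0..b}" and t: "t \<in> {0..b}"
  shows "norm (volterra f t) \<le> op_bound * integral {0..b} N"
proof -
  have sub: "{0..t} \<subseteq> {0..b}" using t by auto
  have "integral {0..t} N \<le> integral {0..b} N"
    by (rule integral_subset_le[OF sub integrable_subinterval_real[OF N sub] N]) (use dominated_nonneg[OF f] in blast)
  then show ?thesis unfolding volterra_def
    using norm_integral_kernel_le[OF f N t sub] mult_left_mono[OF _ op_bound_nonneg] by (meson order_trans)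
qed

text \<open>The increment consists of the change of the kernel on \<open>[0,t]\<close> and of the new piece on \<open>[t,t']\<close>.\<close>

lemma volterra_increment:
  assumes f: "f \<in> dominated_by b N" and N: "N integrable_on {0..b}" and t: "t \<in> {0..b}" "t' \<in> {0..b}" "t \<le> t'"
  shows "norm (volterra f t' - volterra f t) \<le> M * (t' - t) * integral {0..b} N + op_bound * (integral {0..t'} N - integral {0..t} N)"
proof -
  have sub: "{0..t} \<subseteq> {0..b}" "{0..t'} \<subseteq> {0..b}" "{t..t'} \<subseteq> {0..b}" using t by auto
  note i = integrable_kernel[OF f N] and Ni = integrable_subinterval_real[OF N]
  have split: "integral {0..t} (\<lambda>s. S t' s (f s)) + integral {t..t'} (\<lambda>s. S t' s (f s)) = volterra f t'"
    unfolding volterra_def using t by (intro Henstock_Kurzweil_Integration.integral_combine i) auto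
  have Nsplit: "integral {0..t} N + integral {t..t'} N = integral {0..t'} N"
    using t sub by (intro Henstock_Kurzweil_Integration.integral_combine Ni) auto
  have "norm (integral {0..t} (\<lambda>s. S t' s (f s) - S t s (f s))) \<le> integral {0..t} (\<lambda>s. M * (t' - t) * N s)"
  proof (rule integral_norm_bound_integral)
    fix s assume "s \<in> {0..t}"
    then have s: "s \<in> {0..b}" using t by auto
    have "norm (S t' s - S t s) \<le> M * (t' - t)" using S_lipschitz[OF t(2) s t(1) s] t(3) by simp
    then have "norm (S t' s (f s) - S t s (f s)) \<le> M * (t' - t) * norm (f s)"
      using norm_blinfun[of "S t' s - S t s" "f s"] unfolding blinfun.diff_left
      by (meson mult_right_mono norm_ge_zero order_trans)
    also have "\<dots> \<le> M * (t' - t) * N s" using f s M_nonneg t by (intro mult_left_mono) (auto simp: dominated_by_def)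
    finally show "norm (S t' s (f s) - S t s (f s)) \<le> M * (t' - t) * N s" .
  qed (intro integrable_diff i t sub integrable_on_mult_right Ni)+
  also have "\<dots> = M * (t' - t) * integral {0..t} N" by simp
  also have "\<dots> \<le> M * (t' - t) * integral {0..b} N"
    using M_nonneg t sub dominated_nonneg[OF f] by (intro mult_left_mono integral_subset_le Ni N) auto
  finally have 1: "norm (integral {0..t} (\<lambda>s. S t' s (f s)) - volterra f t) \<le> M * (t' - t) * integral {0..b} N"
    unfolding volterra_def using i[OF t(2) sub(1)] i[OF t(1) sub(1)] by (simp add: integral_diff)
  have 2: "norm (integral {t..t'} (\<lambda>s. S t' s (f s))) \<le> op_bound * integral {t..t'} N"
    by (rule norm_integral_kernel_le[OF f N t(2) sub(3)])
  have N_eq: "integral {t..t'} N = integral {0..t'} N - integral {0..t} N" using Nsplit by simp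
  have "volterra f t' - volterra f t = (integral {0..t} (\<lambda>s. S t' s (f s)) - volterra f t) + integral {t..t'} (\<lambda>s. S t' s (f s))"
    using split by (simp add: algebra_simps)
  then show ?thesis using norm_triangle_mono[OF 1 2] unfolding N_eq by (simp only:)
qed

lemma volterra_equicontinuous:
  assumes N: "N integrable_on {0..b}" and "\<epsilon> > 0"
  shows "\<exists>\<delta>>0. \<forall>f\<in>dominated_by b N. \<forall>t\<in>{0..b}. \<forall>s\<in>{0..b}. \<bar>t - s\<bar> < \<delta> \<longrightarrow> dist (volterra f t) (volterra f s) \<le> \<epsilon>"
proof -
  have "uniformly_continuous_on {0..b} (\<lambda>t. integral {0..t} N)"
    by (intro compact_uniformly_continuous indefinite_integral_continuous_1 N) simp
  then obtain d where d: "d > 0" "\<And>t s. t \<in> {0..b} \<Longrightarrow> s \<in> {0..b} \<Longrightarrow> dist s t < d \<Longrightarrow> dist (integral {0..s} N) (integral {0..t} N) < \<epsilon> / 2 / (op_bound + 1)"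
    unfolding uniformly_continuous_on_def using op_bound_nonneg \<open>\<epsilon> > 0\<close> by (metis add_nonneg_pos half_gt_zero zero_less_divide_iff zero_less_one)
  define I where "I = \<bar>integral {0..b} N\<bar>"
  define \<delta> where "\<delta> = min d (\<epsilon> / 2 / (M * I + 1))"
  have MI: "M * I + 1 > 0" unfolding I_def using M_nonneg by (simp add: add_nonneg_pos)
  have \<delta>: "\<delta> > 0" unfolding \<delta>_def using d(1) \<open>\<epsilon> > 0\<close> MI by simp
  have le: "norm (volterra f t - volterra f s) \<le> \<epsilon>"
    if f: "f \<in> dominated_by b N" and st: "s \<in> {0..b}" "t \<in> {0..b}" "s \<le> t" "t - s < \<delta>" for f s t
  proof -
    have "M * (t - s) * integral {0..b} N \<le> M * (t - s) * I"
      unfolding I_def using M_nonneg st by (intro mult_left_mono) auto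
    also have "\<dots> = (M * I) * (t - s)" by simp
    also have "\<dots> \<le> (M * I + 1) * (\<epsilon> / 2 / (M * I + 1))"
      using st MI M_nonneg unfolding \<delta>_def I_def by (intro mult_mono) auto
    also have "\<dots> = \<epsilon> / 2"
      by (rule nonzero_mult_div_cancel_left[of _ "\<epsilon> / 2", unfolded times_divide_eq_right[symmetric]]) (use MI in linarith)
    finally have 1: "M * (t - s) * integral {0..b} N \<le> \<epsilon> / 2" .
    have "integral {0..t} N - integral {0..s} N \<le> \<epsilon> / 2 / (op_bound + 1)"
      using d(2)[OF st(1,2)] st unfolding \<delta>_def dist_real_def by auto
    then have "op_bound * (integral {0..t} N - integral {0..s} N) \<le> op_bound * (\<epsilon> / 2 / (op_bound + 1))"
      by (rule mult_left_mono[OF _ op_bound_nonneg])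
    also have "\<dots> \<le> (op_bound + 1) * (\<epsilon> / 2 / (op_bound + 1))" using op_bound_nonneg \<open>\<epsilon> > 0\<close> by (intro mult_right_mono) auto
    also have "\<dots> = \<epsilon> / 2"
      by (rule nonzero_mult_div_cancel_left[of _ "\<epsilon> / 2", unfolded times_divide_eq_right[symmetric]]) (use op_bound_nonneg in linarith)
    finally show ?thesis using 1 volterra_increment[OF f N st(1-3)] by linarith
  qed
  have "dist (volterra f t) (volterra f s) \<le> \<epsilon>"
    if "f \<in> dominated_by b N" "t \<in> {0..b}" "s \<in> {0..b}" "\<bar>t - s\<bar> < \<delta>" for f t s
    using le[of f s t] le[of f t s] that unfolding dist_norm by (cases "s \<le> t") (auto simp: norm_minus_commute)
  then show ?thesis using \<delta> by blast
qed

lemma continuous_on_volterra: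
  assumes f: "f \<in> dominated_by b N" and N: "N integrable_on {0..b}"
  shows "continuous_on {0..b} (volterra f)"
  unfolding continuous_on_iff
proof (intro ballI allI impI)
  fix t and e :: real assume t: "t \<in> {0..b}" and e: "e > 0"
  obtain \<delta> where \<delta>: "\<delta> > 0" "\<And>s. s \<in> {0..b} \<Longrightarrow> \<bar>s - t\<bar> < \<delta> \<Longrightarrow> dist (volterra f s) (volterra f t) \<le> e / 2"
    using volterra_equicontinuous[OF N half_gt_zero[OF e]] f t by blast
  then show "\<exists>d>0. \<forall>s\<in>{0..b}. dist s t < d \<longrightarrow> dist (volterra f s) (volterra f t) < e"
    using e by (intro exI[of _ \<delta>]) (force simp: dist_real_def)
qed

lemma volterra_range_finite_cover:
  assumes N: "N integrable_on {0..b}" "\<And>s. s \<in> {0..b} \<Longrightarrow> 0 \<le> N s" and "\<epsilon> > 0"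
  shows "finite_cover \<epsilon> ((\<lambda>f. interval_bcontfun b (volterra f)) ` dominated_by b N)"
proof (rule Arzela_Ascoli_finite_cover[where b = b])
  note app = interval_bcontfun_apply[OF continuous_on_volterra[OF _ N(1)]]
  note cl = clamp_Icc_id
  show "b \<ge> 0" using b_pos by simp
  show "x t = x (clamp 0 b t)" if "x \<in> (\<lambda>f. interval_bcontfun b (volterra f)) ` dominated_by b N" for x t
    using that cl[OF clamp_Icc, of b t] b_pos by (auto simp: app)
  show "\<exists>\<delta>>0. \<forall>x\<in>(\<lambda>f. interval_bcontfun b (volterra f)) ` dominated_by b N. \<forall>t\<in>{0..b}. \<forall>s\<in>{0..b}. \<bar>t - s\<bar> < \<delta> \<longrightarrow> dist (x t) (x s) \<le> e"
    if "e > 0" for e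
    using volterra_equicontinuous[OF N(1) that] by (fastforce simp: app cl simp del: atLeastAtMost_iff)
  show "finite_cover e ((\<lambda>x. apply_bcontfun x t) ` (\<lambda>f. interval_bcontfun b (volterra f)) ` dominated_by b N)"
    if t: "t \<in> {0..b}" and "e > 0" for t e
  proof -
    have sub: "{0..t} \<subseteq> {0..b}" using t by auto
    have "finite_cover e {integral {0..t} (\<lambda>s. S t s (f s)) |f. f integrable_on {0..t} \<and> (\<forall>s\<in>{0..t}. norm (f s) \<le> N s)}"
      using t sub N \<open>e > 0\<close>
      by (intro totally_bounded_integrals continuous_on_S S_compact integrable_subinterval_real[OF N(1)]) auto
    moreover have "(\<lambda>x. apply_bcontfun x t) ` (\<lambda>f. interval_bcontfun b (volterra f)) ` dominated_by b N \<subseteq>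
       {integral {0..t} (\<lambda>s. S t s (f s)) |f. f integrable_on {0..t} \<and> (\<forall>s\<in>{0..t}. norm (f s) \<le> N s)}"
    proof clarify
      fix f :: "real \<Rightarrow> 'a" assume f: "f \<in> dominated_by b N"
      have "interval_bcontfun b (volterra f) t = integral {0..t} (\<lambda>s. S t s (f s))"
        by (simp add: app[OF f] cl[OF t] volterra_def)
      moreover have "f integrable_on {0..t}" "\<forall>s\<in>{0..t}. norm (f s) \<le> N s"
        using f sub integrable_subinterval_real[OF _ sub] by (auto simp: dominated_by_def)
      ultimately show "\<exists>g. interval_bcontfun b (volterra f) t = integral {0..t} (\<lambda>s. S t s (g s)) \<and>
          g integrable_on {0..t} \<and> (\<forall>s\<in>{0..t}. norm (g s) \<le> N s)" by blast
    qed
    ultimately show ?thesis by (rule finite_cover_subset)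
  qed
qed (use \<open>\<epsilon> > 0\<close> in auto)

lemma volterra_sum:
  assumes X: "finite X" and f: "\<And>z. z \<in> X \<Longrightarrow> f z \<in> dominated_by b (N z)" "\<And>z. z \<in> X \<Longrightarrow> N z integrable_on {0..b}" and t: "t \<in> {0..b}"
  shows "volterra (\<lambda>s. \<Sum>z\<in>X. c z *\<^sub>R f z s) t = (\<Sum>z\<in>X. c z *\<^sub>R volterra (f z) t)"
proof -
  have i: "(\<lambda>s. S t s (f z s)) integrable_on {0..t}" if "z \<in> X" for z
    by (rule integrable_kernel[OF f[OF that] t]) (use t in auto)
  have "volterra (\<lambda>s. \<Sum>z\<in>X. c z *\<^sub>R f z s) t = integral {0..t} (\<lambda>s. \<Sum>z\<in>X. c z *\<^sub>R S t s (f z s))"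
    unfolding volterra_def by (simp add: blinfun.sum_right blinfun.scaleR_right)
  also have "\<dots> = (\<Sum>z\<in>X. integral {0..t} (\<lambda>s. c z *\<^sub>R S t s (f z s)))"
    by (rule integral_sum[OF X]) (intro integrable_cmul i)
  finally show ?thesis unfolding volterra_def by simp
qed

lemma volterra_add:
  assumes "f \<in> dominated_by b N" "N integrable_on {0..b}" "g \<in> dominated_by b N'" "N' integrable_on {0..b}" and t: "t \<in> {0..b}"
  shows "volterra (\<lambda>s. f s + g s) t = volterra f t + volterra g t"
    and "volterra (\<lambda>s. f s - g s) t = volterra f t - volterra g t"
proof -
  have "(\<lambda>s. S t s (f s)) integrable_on {0..t}" "(\<lambda>s. S t s (g s)) integrable_on {0..t}"
    by (rule integrable_kernel[OF assms(1,2) t] integrable_kernel[OF assms(3,4) t]; use t in auto)+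
  then show "volterra (\<lambda>s. f s + g s) t = volterra f t + volterra g t"
    "volterra (\<lambda>s. f s - g s) t = volterra f t - volterra g t"
    unfolding volterra_def by (simp_all add: blinfun.add_right blinfun.diff_right integral_diff Henstock_Kurzweil_Integration.integral_add)
qed

end

section \<open>Steering the inclusion\<close>

locale controlled_evolution = compact_evolution b S M
  for b :: real and S :: "real \<Rightarrow> real \<Rightarrow> 'a::{real_inner,banach} \<Rightarrow>\<^sub>L 'a" and M :: real +
  fixes B :: "'u::{real_inner,banach} \<Rightarrow>\<^sub>L 'a"
begin

text \<open>The control of least energy that produces the effect \<open>\<Upsilon> v\<close> at time \<open>b\<close> in the linear system.\<close>

definition control :: "'a \<Rightarrow> real \<Rightarrow> 'u" where
  "control v s = adjoint (blinfun_apply B) (adjoint (blinfun_apply (S b s)) v)"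

lemma bounded_linear_control: "bounded_linear (\<lambda>v. control v s)"
  unfolding control_def by (intro bounded_linear_compose[OF bounded_linear_adjoint_blinfun] bounded_linear_adjoint_blinfun)

lemma norm_control_le: "s \<in> {0..b} \<Longrightarrow> norm (control v s) \<le> norm B * op_bound * norm v"
proof -
  assume s: "s \<in> {0..b}"
  have "norm (control v s) \<le> norm B * norm (adjoint (blinfun_apply (S b s)) v)"
    unfolding control_def by (rule norm_adjoint_blinfun_le)
  also have "\<dots> \<le> norm B * (norm (S b s) * norm v)" by (intro mult_left_mono norm_adjoint_blinfun_le) simp
  also have "\<dots> \<le> norm B * (op_bound * norm v)"
    using s b_pos by (intro mult_left_mono mult_right_mono norm_S_le) auto
  finally show ?thesis by (simp add: mult_ac)
qed

lemma continuous_on_control: "continuous_on {0..b} (control v)"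
proof -
  have "continuous_on {0..b} (\<lambda>s. adjoint (blinfun_apply (S b s)) v)"
  proof (rule lipschitz_on_continuous_on[OF lipschitz_onI])
    fix s s' assume s: "s \<in> {0..b}" "s' \<in> {0..b}"
    have "dist (adjoint (blinfun_apply (S b s)) v) (adjoint (blinfun_apply (S b s')) v) \<le> norm (S b s - S b s') * norm v"
      unfolding dist_norm adjoint_blinfun_diff by (rule norm_adjoint_blinfun_le)
    also have "\<dots> \<le> M * \<bar>s - s'\<bar> * norm v"
      using S_lipschitz[of b s b s'] s b_pos by (intro mult_right_mono) auto
    finally show "dist (adjoint (blinfun_apply (S b s)) v) (adjoint (blinfun_apply (S b s')) v) \<le> (M * norm v) * dist s s'"
      by (simp add: dist_real_def mult_ac)
  qed (use M_nonneg in simp)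
  then show ?thesis unfolding control_def[abs_def]
    by (rule bounded_linear.continuous_on[OF bounded_linear_adjoint_blinfun])
qed

lemma control_L2: "control v \<in> L2_on {0..b}"
  unfolding L2_on_def using strongly_measurable_on_continuous[OF continuous_on_control]
  by (auto intro!: continuous_imp_integrable_real continuous_intros continuous_on_control)

definition gain where "gain = norm B * (norm B * op_bound)"

lemma gain_nonneg: "gain \<ge> 0" unfolding gain_def using op_bound_nonneg by simp

lemma norm_B_control_le: "s \<in> {0..b} \<Longrightarrow> norm (B (control v s)) \<le> gain * norm v"
  using norm_blinfun[of B "control v s"] mult_left_mono[OF norm_control_le[of s v], of "norm B"]
  unfolding gain_def by (simp add: mult_ac)

lemma continuous_on_B_control: "continuous_on {0..b} (\<lambda>s. B (control v s))"
  by (intro bounded_linear.continuous_on[OF blinfun.bounded_linear_right] continuous_on_control)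

lemma const_integrable: "(\<lambda>s. c::real) integrable_on {0..b}"
  by (intro integrable_continuous_real continuous_intros)

lemma B_control_dominated: "(\<lambda>s. B (control v s)) \<in> dominated_by b (\<lambda>s. gain * norm v)"
  unfolding dominated_by_def using norm_B_control_le integrable_continuous_real[OF continuous_on_B_control] by auto

lemma control_sum: "control (\<Sum>z\<in>X. c z *\<^sub>R v z) s = (\<Sum>z\<in>X. c z *\<^sub>R control (v z) s)"
proof -
  interpret bounded_linear "\<lambda>v. control v s" by (rule bounded_linear_control)
  show ?thesis by (simp add: sum scaleR)
qed

lemma volterra_control_sum:
  assumes "finite X" "t \<in> {0..b}"
  shows "volterra (\<lambda>s. B (control (\<Sum>z\<in>X. c z *\<^sub>R v z) s)) t = (\<Sum>z\<in>X. c z *\<^sub>R volterra (\<lambda>s. B (control (v z) s)) t)"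
  using volterra_sum[where f = "\<lambda>z s. B (control (v z) s)" and c = c, OF assms(1) B_control_dominated const_integrable assms(2)]
  by (simp add: control_sum blinfun.sum_right blinfun.scaleR_right)

lemma Gramian_eq: "Gramian b S B v = volterra (\<lambda>s. B (control v s)) b"
  unfolding Gramian_def volterra_def control_def ..

lemma b_mem: "b \<in> {0..b}" using b_pos by simp

lemma norm_volterra_control_le: "t \<in> {0..b} \<Longrightarrow> norm (volterra (\<lambda>s. B (control v s)) t) \<le> op_bound * (b * gain) * norm v"
  using norm_volterra_le[OF B_control_dominated const_integrable, of t v] b_pos by (simp add: mult_ac)

lemma bounded_linear_Gramian: "bounded_linear (Gramian b S B)"
proof (rule bounded_linear_intro)
  show "Gramian b S B (x + y) = Gramian b S B x + Gramian b S B y" for x y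
    using volterra_control_sum[of "UNIV :: bool set" b "\<lambda>_. 1" "\<lambda>i. if i then x else y"] b_mem
    by (simp add: UNIV_bool Gramian_eq add.commute)
  show "Gramian b S B (r *\<^sub>R x) = r *\<^sub>R Gramian b S B x" for r x
    using volterra_control_sum[of "{()}" b "\<lambda>_. r" "\<lambda>_. x"] b_mem by (simp add: Gramian_eq)
  show "norm (Gramian b S B x) \<le> norm x * (op_bound * (b * gain))" for x
    using norm_volterra_control_le[OF b_mem, of x] by (simp add: Gramian_eq mult.commute)
qed

definition gramian where "gramian = Blinfun (Gramian b S B)"

lemma gramian_apply: "blinfun_apply gramian = Gramian b S B"
  unfolding gramian_def by (rule bounded_linear_Blinfun_apply[OF bounded_linear_Gramian])

sublocale positive_operator gramian
proof
  fix x
  have i: "(\<lambda>s. S b s (B (control x s))) integrable_on {0..b}"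
    by (rule integrable_kernel[OF B_control_dominated const_integrable b_mem]) simp
  have "gramian x \<bullet> x = integral {0..b} (\<lambda>s. S b s (B (control x s)) \<bullet> x)"
    unfolding gramian_apply Gramian_eq volterra_def
    using integral_linear[OF i bounded_linear_inner_left[of x]] by (simp add: o_def)
  also have "\<dots> = integral {0..b} (\<lambda>s. (norm (control x s))\<^sup>2)"
    unfolding adjoint_blinfun_inner control_def dot_square_norm ..
  also have "\<dots> \<ge> 0"
    by (intro integral_nonneg integrable_continuous_real continuous_intros continuous_on_control) simp
  finally show "0 \<le> gramian x \<bullet> x" .
qed

end

text \<open>A neighbourhood of radius \<open>e\<close> of the convex set \<open>\<Phi> x\<close> is open and convex. By upper semicontinuity it
  contains the values of \<open>\<Phi>\<close> near \<open>x\<close>, hence also their convex hull and finally the points \<open>h k\<close>.\<close>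

lemma usc_convex_limit:
  fixes \<Phi> :: "'a::real_normed_vector \<Rightarrow> 'a set"
  assumes usc: "usc_multimap \<Phi>" and cvx: "convex (\<Phi> x)"
    and h: "\<And>k. h k \<in> convex hull (\<Union>y\<in>ball x (1 / real (Suc k)). \<Phi> y)" and lim: "h \<longlonglongrightarrow> l"
  shows "l \<in> \<Phi> x"
proof -
  have "closed (\<Phi> x)" using usc unfolding usc_multimap_def by blast
  moreover have "l \<in> closure (\<Phi> x)"
    unfolding closure_approachable
  proof (intro allI impI)
    fix e :: real assume e: "e > 0"
    define U where "U = (\<Union>c\<in>\<Phi> x. ball c (e/2))"
    have U_eq: "U = (\<Union>c\<in>\<Phi> x. \<Union>v\<in>ball 0 (e/2). {c + v})"
    proof (intro equalityI subsetI)
      fix u assume "u \<in> U"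
      then obtain c where "c \<in> \<Phi> x" "dist c u < e/2" unfolding U_def by auto
      then show "u \<in> (\<Union>c\<in>\<Phi> x. \<Union>v\<in>ball 0 (e/2). {c + v})"
        by (intro UN_I[of c] UN_I[of "u - c"]) (simp_all add: dist_norm norm_minus_commute)
    next
      fix u assume "u \<in> (\<Union>c\<in>\<Phi> x. \<Union>v\<in>ball 0 (e/2). {c + v})"
      then obtain c v where "u = c + v" "c \<in> \<Phi> x" "norm v < e/2" by auto
      then show "u \<in> U" unfolding U_def by (intro UN_I[of c]) (simp_all add: dist_norm)
    qed
    have U: "convex U" "open U" "\<Phi> x \<subseteq> U"
    proof -
      show "convex U" unfolding U_eq by (rule convex_sums[OF cvx convex_ball])
      show "open U" unfolding U_def by auto
      show "\<Phi> x \<subseteq> U" unfolding U_def using e by (auto intro!: UN_I)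
    qed
    obtain W where W: "open W" "x \<in> W" "(\<Union>y\<in>W. \<Phi> y) \<subseteq> U"
      using usc U(2,3) unfolding usc_multimap_def by meson
    obtain d where d: "d > 0" "ball x d \<subseteq> W" using W(1,2) open_contains_ball by blast
    have "\<forall>\<^sub>F k in sequentially. 1 / real (Suc k) < d"
      using order_tendstoD(2)[OF LIMSEQ_Suc[OF lim_1_over_n] d(1)] .
    moreover have "\<forall>\<^sub>F k in sequentially. dist (h k) l < e / 2" using lim e by (intro tendstoD) auto
    ultimately obtain k where k: "1 / real (Suc k) < d" "dist (h k) l < e / 2"
      by (metis (mono_tags, lifting) eventually_conj eventually_happens' sequentially_bot)
    have "ball x (1 / real (Suc k)) \<subseteq> W" using d(2) k(1) subset_ball[of "1 / real (Suc k)" d x] by (meson less_imp_le subset_trans)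
    then have "convex hull (\<Union>y\<in>ball x (1 / real (Suc k)). \<Phi> y) \<subseteq> U"
      using W(3) U(1) by (intro hull_minimal) blast+
    then have "h k \<in> U" using h by blast
    then obtain c where "c \<in> \<Phi> x" "dist c (h k) < e / 2" unfolding U_def by auto
    then show "\<exists>y\<in>\<Phi> x. dist y l < e" using k(2) dist_triangle[of c l "h k"] by (intro bexI[of _ c]) linarith+
  qed
  ultimately show ?thesis by simp
qed

text \<open>\<open>\<xi>\<close> stands for the free motion \<open>C(t,0)x\<^sub>0 + S(t,0)y\<^sub>0\<close>. The null set \<open>Z\<close> collects the times at which
  \<open>N\<close> fails to bound the values of \<open>F\<close>; it is the same for all states, so forcing terms can be set to zero
  there and be dominated by \<open>N\<close> at every time.\<close>

locale controlled_inclusion = controlled_evolution b S M B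
  for b :: real and S :: "real \<Rightarrow> real \<Rightarrow> 'a::{real_inner,banach} \<Rightarrow>\<^sub>L 'a" and M :: real
    and B :: "'u::{real_inner,banach} \<Rightarrow>\<^sub>L 'a" +
  fixes F :: "real \<Rightarrow> 'a \<Rightarrow> 'a set" and N :: "real \<Rightarrow> real" and \<xi> :: "real \<Rightarrow> 'a" and Z :: "real set"
  assumes F: "admissible_multimap {0..b} F"
    and N: "integrable (lebesgue_on {0..b}) N" and N_nonneg: "\<And>t. t \<in> {0..b} \<Longrightarrow> 0 \<le> N t"
    and \<xi>: "continuous_on {0..b} \<xi>"
    and Z: "AE t in lebesgue_on {0..b}. t \<notin> Z"
    and F_bound: "\<And>t x v. t \<in> {0..b} \<Longrightarrow> t \<notin> Z \<Longrightarrow> v \<in> F t x \<Longrightarrow> norm v \<le> N t"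
begin

lemma N_integrable_on: "N integrable_on {0..b}"
  using has_integral_integral_lebesgue_on[OF N] by auto

definition meas_dominated :: "(real \<Rightarrow> 'a) set" where
  "meas_dominated = {f. strongly_measurable_on {0..b} f \<and> (\<forall>t\<in>{0..b}. norm (f t) \<le> N t)}"

lemma meas_dominated_L1: "f \<in> meas_dominated \<Longrightarrow> f \<in> L1_on {0..b}"
  unfolding meas_dominated_def by (intro dominated_imp_L1_on[OF _ _ N]) auto

lemma meas_dominated_dominated: "f \<in> meas_dominated \<Longrightarrow> f \<in> dominated_by b N"
  using L1_on_integrable_on[OF meas_dominated_L1] unfolding dominated_by_def meas_dominated_def by blast

lemma F_values:
  assumes "t \<in> {0..b}"
  shows "F t x \<noteq> {}" "closed (F t x)" "convex (F t x)" "usc_multimap (F t)"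
  using F assms unfolding admissible_multimap_def by auto

lemma selection_exists:
  fixes x :: "real \<Rightarrow>\<^sub>C 'a"
  shows "\<exists>f\<in>meas_dominated. \<forall>t\<in>{0..b}. t \<notin> Z \<longrightarrow> f t \<in> F t (x t)"
proof -
  have "selections {0..b} F x \<noteq> {}" using F unfolding admissible_multimap_def by (simp add: continuous_on_apply_bcontfun)
  then obtain g where g: "g \<in> L1_on {0..b}" "\<forall>t\<in>{0..b}. g t \<in> F t (x t)" unfolding selections_def by blast
  define f where "f t = (if t \<in> Z then 0 else g t)" for t
  have "strongly_measurable_on {0..b} f"
    by (rule strongly_measurable_on_AE_eq[of _ g]) (use g(1) Z in \<open>auto simp: L1_on_def f_def elim: eventually_mono\<close>)
  moreover have "norm (f t) \<le> N t" if "t \<in> {0..b}" for t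
    using F_bound[OF that, of "g t" "apply_bcontfun x t"] g(2) that N_nonneg[OF that] unfolding f_def by auto
  moreover have "\<forall>t\<in>{0..b}. t \<notin> Z \<longrightarrow> f t \<in> F t (x t)" using g(2) by (simp add: f_def)
  ultimately show ?thesis unfolding meas_dominated_def by blast
qed

context
  fixes a :: real and target :: 'a
  assumes a: "a > 0"
begin

text \<open>The part of the target that the free motion and the forcing term do not reach by themselves.\<close>

definition defect :: "(real \<Rightarrow> 'a) \<Rightarrow> 'a" where
  "defect f = target - \<xi> b - volterra f b"

definition steer :: "(real \<Rightarrow> 'a) \<Rightarrow> 'a" where
  "steer f = resolvent_op a (blinfun_apply gramian) (defect f)"

text \<open>The forcing term \<open>f\<close> alone determines the trajectory: the control is computed from \<open>f\<close> by feedback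
  through the defect. A solution of the inclusion is an \<open>f\<close> that selects from \<open>F\<close> along its own trajectory.\<close>

definition trajectory :: "(real \<Rightarrow> 'a) \<Rightarrow> real \<Rightarrow> 'a" where
  "trajectory f t = \<xi> t + volterra (\<lambda>s. f s + B (control (steer f) s)) t"

interpretation R: bounded_linear "resolvent_op a (blinfun_apply gramian)" by (rule bounded_linear_resolvent[OF a])

lemma norm_steer_le: "norm (resolvent_op a (blinfun_apply gramian) y) \<le> norm y / a"
  using norm_scaled_resolvent_le[OF a, of y] a by (simp add: field_simps)

lemma trajectory_split:
  assumes "f \<in> dominated_by b N" "t \<in> {0..b}"
  shows "trajectory f t = \<xi> t + volterra f t + volterra (\<lambda>s. B (control (steer f) s)) t"
  unfolding trajectory_def
  using volterra_add(1)[OF assms(1) N_integrable_on B_control_dominated const_integrable assms(2)] by simp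

text \<open>\<open>a R(a) + \<Upsilon> R(a) = I\<close>, and the control contributes \<open>\<Upsilon> R(a)\<close> applied to the defect.\<close>

lemma trajectory_end:
  assumes "f \<in> dominated_by b N"
  shows "trajectory f b = target - a *\<^sub>R steer f"
proof -
  have "a *\<^sub>R steer f + gramian (steer f) = defect f" unfolding steer_def by (rule shift_resolvent[OF a])
  then have "gramian (steer f) = defect f - a *\<^sub>R steer f" by (simp add: algebra_simps)
  then show ?thesis
    unfolding trajectory_split[OF assms b_mem] gramian_apply Gramian_eq[symmetric] defect_def by simp
qed

text \<open>A bound on \<open>B u\<close> for every control \<open>u\<close> obtained by feedback.\<close>

definition steering_bound where
  "steering_bound = gain * ((norm (target - \<xi> b) + op_bound * integral {0..b} N) / a)"

lemma trajectory_forcing_dominated: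
  assumes f: "f \<in> dominated_by b N"
  shows "(\<lambda>s. f s + B (control (steer f) s)) \<in> dominated_by b (\<lambda>s. N s + steering_bound)"
proof -
  have "norm (defect f) \<le> norm (target - \<xi> b) + op_bound * integral {0..b} N"
    unfolding defect_def using norm_triangle_ineq4[of "target - \<xi> b" "volterra f b"] norm_volterra_le[OF f N_integrable_on b_mem] by linarith
  then have "norm (steer f) \<le> (norm (target - \<xi> b) + op_bound * integral {0..b} N) / a"
    unfolding steer_def using norm_steer_le[of "defect f"] a by (meson divide_right_mono less_imp_le order_trans)
  then have "gain * norm (steer f) \<le> steering_bound" unfolding steering_bound_def by (rule mult_left_mono[OF _ gain_nonneg])
  then have "norm (f s + B (control (steer f) s)) \<le> N s + steering_bound" if s: "s \<in> {0..b}" for s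
    using norm_triangle_ineq[of "f s" "B (control (steer f) s)"] norm_B_control_le[OF s, of "steer f"] f s
    unfolding dominated_by_def by fastforce
  moreover have "(\<lambda>s. f s + B (control (steer f) s)) integrable_on {0..b}"
    using f B_control_dominated[of "steer f"] unfolding dominated_by_def by (intro Henstock_Kurzweil_Integration.integrable_add) auto
  ultimately show ?thesis unfolding dominated_by_def by blast
qed

lemma steering_bound_nonneg: "steering_bound \<ge> 0"
  unfolding steering_bound_def using gain_nonneg op_bound_nonneg a integral_nonneg[OF N_integrable_on N_nonneg] by simp

lemma majorant_integrable: "(\<lambda>s. N s + steering_bound) integrable_on {0..b}"
  by (intro Henstock_Kurzweil_Integration.integrable_add N_integrable_on const_integrable)

lemma steer_sum:
  assumes X: "finite X" "sum c X = 1" and f: "\<And>z. z \<in> X \<Longrightarrow> f z \<in> dominated_by b N"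
  shows "steer (\<lambda>s. \<Sum>z\<in>X. c z *\<^sub>R f z s) = (\<Sum>z\<in>X. c z *\<^sub>R steer (f z))"
proof -
  have one: "(\<Sum>z\<in>X. c z *\<^sub>R y) = y" for y :: 'a using X(2) by (simp add: scaleR_left.sum[symmetric])
  have "defect (\<lambda>s. \<Sum>z\<in>X. c z *\<^sub>R f z s) = (\<Sum>z\<in>X. c z *\<^sub>R (target - \<xi> b)) - (\<Sum>z\<in>X. c z *\<^sub>R volterra (f z) b)"
    unfolding defect_def one using volterra_sum[OF X(1) f N_integrable_on b_mem, where c = c] by simp
  also have "\<dots> = (\<Sum>z\<in>X. c z *\<^sub>R defect (f z))"
    unfolding defect_def by (simp add: sum_subtractf scaleR_diff_right)
  finally show ?thesis unfolding steer_def by (simp add: R.sum R.scaleR)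
qed

lemma trajectory_sum:
  assumes X: "finite X" "sum c X = 1" and f: "\<And>z. z \<in> X \<Longrightarrow> f z \<in> dominated_by b N"
    and fX: "(\<lambda>s. \<Sum>z\<in>X. c z *\<^sub>R f z s) \<in> dominated_by b N" and t: "t \<in> {0..b}"
  shows "trajectory (\<lambda>s. \<Sum>z\<in>X. c z *\<^sub>R f z s) t = (\<Sum>z\<in>X. c z *\<^sub>R trajectory (f z) t)"
proof -
  have one: "(\<Sum>z\<in>X. c z *\<^sub>R y) = y" for y :: 'a using X(2) by (simp add: scaleR_left.sum[symmetric])
  have vol: "volterra (\<lambda>s. \<Sum>z\<in>X. c z *\<^sub>R f z s) t = (\<Sum>z\<in>X. c z *\<^sub>R volterra (f z) t)"
    by (rule volterra_sum[OF X(1) f N_integrable_on t])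
  have st: "steer (\<lambda>s. \<Sum>z\<in>X. c z *\<^sub>R f z s) = (\<Sum>z\<in>X. c z *\<^sub>R steer (f z))"
    by (rule steer_sum[OF X f])
  have "trajectory (\<lambda>s. \<Sum>z\<in>X. c z *\<^sub>R f z s) t = (\<Sum>z\<in>X. c z *\<^sub>R \<xi> t) + (\<Sum>z\<in>X. c z *\<^sub>R volterra (f z) t)
      + (\<Sum>z\<in>X. c z *\<^sub>R volterra (\<lambda>s. B (control (steer (f z)) s)) t)"
    unfolding trajectory_split[OF fX t] one st volterra_control_sum[OF X(1) t] vol ..
  also have "\<dots> = (\<Sum>z\<in>X. c z *\<^sub>R trajectory (f z) t)"
    using trajectory_split[OF f t] by (simp add: sum.distrib scaleR_add_right)
  finally show ?thesis .
qed

lemma trajectory_L1_lipschitz: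
  assumes f: "f \<in> dominated_by b N" and g: "g \<in> dominated_by b N"
    and d: "(\<lambda>s. norm (f s - g s)) integrable_on {0..b}" and t: "t \<in> {0..b}"
  shows "norm (trajectory f t - trajectory g t) \<le> (op_bound + op_bound * (b * gain) * (op_bound / a)) * integral {0..b} (\<lambda>s. norm (f s - g s))"
proof -
  define I where "I = integral {0..b} (\<lambda>s. norm (f s - g s))"
  have fg: "(\<lambda>s. f s - g s) \<in> dominated_by b (\<lambda>s. norm (f s - g s))"
    using f g unfolding dominated_by_def by (auto intro: integrable_diff)
  have vol: "norm (volterra f t - volterra g t) \<le> op_bound * I" if t: "t \<in> {0..b}" for t
    using norm_volterra_le[OF fg d t] volterra_add(2)[OF f N_integrable_on g N_integrable_on t] unfolding I_def by simp
  have KI: "op_bound * (b * gain) \<ge> 0" using op_bound_nonneg gain_nonneg b_pos by simp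
  have "steer f - steer g = resolvent_op a (blinfun_apply gramian) (volterra g b - volterra f b)"
    unfolding steer_def defect_def R.diff[symmetric] by (simp add: algebra_simps)
  then have "norm (steer f - steer g) \<le> norm (volterra f b - volterra g b) / a"
    using norm_steer_le[of "volterra g b - volterra f b"] by (simp add: norm_minus_commute)
  also have "\<dots> \<le> op_bound * I / a" using vol[OF b_mem] a by (simp add: divide_right_mono)
  finally have st: "norm (steer f - steer g) \<le> op_bound * I / a" .
  have "volterra (\<lambda>s. B (control (steer f) s)) t - volterra (\<lambda>s. B (control (steer g) s)) t
      = volterra (\<lambda>s. B (control (steer f - steer g) s)) t"
  proof -
    interpret c: bounded_linear "\<lambda>v. control v s" for s by (rule bounded_linear_control)
    show ?thesis
      using volterra_add(2)[OF B_control_dominated const_integrable B_control_dominated const_integrable t, of "steer f" "steer g"]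
      by (simp add: c.diff blinfun.diff_right)
  qed
  then have "norm (volterra (\<lambda>s. B (control (steer f) s)) t - volterra (\<lambda>s. B (control (steer g) s)) t) \<le> op_bound * (b * gain) * (op_bound * I / a)"
    using norm_volterra_control_le[OF t, of "steer f - steer g"] mult_left_mono[OF st KI] by simp
  moreover have "trajectory f t - trajectory g t = (volterra f t - volterra g t)
      + (volterra (\<lambda>s. B (control (steer f) s)) t - volterra (\<lambda>s. B (control (steer g) s)) t)"
    unfolding trajectory_split[OF f t] trajectory_split[OF g t] by simp
  ultimately have "norm (trajectory f t - trajectory g t) \<le> op_bound * I + op_bound * (b * gain) * (op_bound * I / a)"
    using vol[OF t] norm_triangle_mono by metis
  then show ?thesis unfolding I_def by (simp add: algebra_simps)
qed

text \<open>The approximate solutions: convex hulls occur because approximate fixed points are convex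
  combinations of selections along different nearby functions.\<close>

definition tube :: "real \<Rightarrow> (real \<Rightarrow>\<^sub>C 'a) \<Rightarrow> (real \<Rightarrow> 'a) set" where
  "tube \<epsilon> x = {f \<in> meas_dominated. \<forall>t\<in>{0..b}. t \<notin> Z \<longrightarrow> f t \<in> convex hull (\<Union>y\<in>ball (x t) \<epsilon>. F t y)}"

text \<open>A convex totally bounded set that contains all trajectories.\<close>

abbreviation candidates :: "(real \<Rightarrow>\<^sub>C 'a) set" where
  "candidates \<equiv> (\<lambda>g. interval_bcontfun b \<xi> + interval_bcontfun b (volterra g)) ` dominated_by b (\<lambda>s. N s + steering_bound)"

lemma trajectory_bcontfun:
  assumes "f \<in> dominated_by b N"
  shows "interval_bcontfun b (trajectory f) \<in> candidates"
    "continuous_on {0..b} (trajectory f)"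
proof -
  let ?g = "\<lambda>s. f s + B (control (steer f) s)"
  note c = continuous_on_volterra[OF trajectory_forcing_dominated[OF assms] majorant_integrable]
  show t: "continuous_on {0..b} (trajectory f)" unfolding trajectory_def[abs_def] by (intro continuous_on_add \<xi> c)
  have "interval_bcontfun b (trajectory f) = interval_bcontfun b \<xi> + interval_bcontfun b (volterra ?g)"
  proof (rule bcontfun_eqI)
    fix r
    have "apply_bcontfun (interval_bcontfun b (trajectory f)) r = trajectory f (clamp 0 b r)"
      by (rule interval_bcontfun_apply[OF t])
    then show "apply_bcontfun (interval_bcontfun b (trajectory f)) r = (interval_bcontfun b \<xi> + interval_bcontfun b (volterra ?g)) r"
      by (simp add: interval_bcontfun_apply[OF \<xi>] interval_bcontfun_apply[OF c] plus_bcontfun.rep_eq trajectory_def)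
  qed
  then show "interval_bcontfun b (trajectory f) \<in> candidates" using trajectory_forcing_dominated[OF assms] by blast
qed

lemma candidates_finite_cover:
  assumes "\<epsilon> > 0"
  shows "finite_cover \<epsilon> candidates"
proof -
  have "finite_cover (\<epsilon>/2) {interval_bcontfun b \<xi>}" unfolding finite_cover_def using assms by (intro exI[of _ "{interval_bcontfun b \<xi>}"]) auto
  moreover have "finite_cover (\<epsilon>/2) ((\<lambda>f. interval_bcontfun b (volterra f)) ` dominated_by b (\<lambda>s. N s + steering_bound))"
    by (rule volterra_range_finite_cover[OF majorant_integrable]) (use N_nonneg steering_bound_nonneg assms in auto)
  ultimately have "finite_cover (\<epsilon>/2 + \<epsilon>/2) {x + y |x y. x \<in> {interval_bcontfun b \<xi>} \<and>
      y \<in> (\<lambda>f. interval_bcontfun b (volterra f)) ` dominated_by b (\<lambda>s. N s + steering_bound)}"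
    by (rule finite_cover_plus)
  then show ?thesis using finite_cover_subset[of "\<epsilon>/2 + \<epsilon>/2"] by (simp, elim finite_cover_subset) blast
qed

lemma candidates_convex: "convex candidates"
proof (rule convexI)
  fix x y :: "real \<Rightarrow>\<^sub>C 'a" and u v :: real
  assume xy: "x \<in> candidates" "y \<in> candidates" and uv: "0 \<le> u" "0 \<le> v" "u + v = 1"
  obtain g h where g: "g \<in> dominated_by b (\<lambda>s. N s + steering_bound)" "x = interval_bcontfun b \<xi> + interval_bcontfun b (volterra g)"
    and h: "h \<in> dominated_by b (\<lambda>s. N s + steering_bound)" "y = interval_bcontfun b \<xi> + interval_bcontfun b (volterra h)" using xy by blast
  define c where "c i = (if i then u else v)" for i
  define p where "p i = (if i then g else h)" for i
  let ?k = "\<lambda>s. u *\<^sub>R g s + v *\<^sub>R h s"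
  have k: "?k \<in> dominated_by b (\<lambda>s. N s + steering_bound)"
  proof -
    have "norm (?k s) \<le> N s + steering_bound" if "s \<in> {0..b}" for s
    proof -
      have "norm (?k s) \<le> u * norm (g s) + v * norm (h s)" using uv norm_triangle_ineq[of "u *\<^sub>R g s" "v *\<^sub>R h s"] by simp
      also have "\<dots> \<le> u * (N s + steering_bound) + v * (N s + steering_bound)"
        using g h that uv by (intro add_mono mult_left_mono) (auto simp: dominated_by_def)
      also have "\<dots> = N s + steering_bound" using uv by (simp flip: distrib_right)
      finally show ?thesis .
    qed
    then show ?thesis using g h unfolding dominated_by_def
      by (auto intro!: Henstock_Kurzweil_Integration.integrable_add integrable_cmul)
  qed
  have vk: "volterra ?k t = u *\<^sub>R volterra g t + v *\<^sub>R volterra h t" if "t \<in> {0..b}" for t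
    using volterra_sum[of "UNIV :: bool set" p "\<lambda>_ s. N s + steering_bound" t c] that g(1) h(1) majorant_integrable
    unfolding p_def c_def by (simp add: UNIV_bool add.commute)
  note cont = continuous_on_volterra[OF _ majorant_integrable]
  have one: "u *\<^sub>R \<xi> t + v *\<^sub>R \<xi> t = \<xi> t" for t using uv by (simp flip: scaleR_left_distrib)
  have "u *\<^sub>R x + v *\<^sub>R y = interval_bcontfun b \<xi> + interval_bcontfun b (volterra ?k)"
  proof (rule bcontfun_eqI)
    fix t
    have "clamp 0 b t \<in> {0..b}" using b_pos by (intro clamp_Icc) simp
    then show "(u *\<^sub>R x + v *\<^sub>R y) t = (interval_bcontfun b \<xi> + interval_bcontfun b (volterra ?k)) t"
      unfolding g(2) h(2) using one[of "clamp 0 b t"]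
      by (simp add: plus_bcontfun.rep_eq scaleR_bcontfun.rep_eq interval_bcontfun_apply \<xi> cont g h k vk scaleR_add_right)
  qed
  then show "u *\<^sub>R x + v *\<^sub>R y \<in> candidates" using k by blast
qed

lemma meas_dominated_sum:
  assumes X: "finite X" "sum c X = 1" "\<And>z. z \<in> X \<Longrightarrow> 0 \<le> c z" and f: "\<And>z. z \<in> X \<Longrightarrow> f z \<in> meas_dominated"
  shows "(\<lambda>s. \<Sum>z\<in>X. c z *\<^sub>R f z s) \<in> meas_dominated"
proof -
  have "norm (\<Sum>z\<in>X. c z *\<^sub>R f z s) \<le> N s" if s: "s \<in> {0..b}" for s
  proof -
    have "norm (\<Sum>z\<in>X. c z *\<^sub>R f z s) \<le> (\<Sum>z\<in>X. c z * N s)"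
      using X(3) f s by (intro sum_norm_le) (auto simp: meas_dominated_def intro!: mult_left_mono)
    then show ?thesis using X(2) by (simp flip: sum_distrib_right)
  qed
  then show ?thesis using f unfolding meas_dominated_def
    by (auto intro!: strongly_measurable_on_sum strongly_measurable_on_scaleR)
qed

text \<open>Cellina's argument for the map that sends a function to the trajectory of a selection along it. As
  trajectories depend on the forcing term in an affine way, the convex combination of
  trajectories is the trajectory of the same combination \<open>f\<close> of selections, and the weights charge only
  selections along functions within \<open>\<epsilon>\<close> of that trajectory.\<close>

lemma approximate_solution:
  assumes "\<epsilon> > 0"
  shows "\<exists>f. f \<in> tube \<epsilon> (interval_bcontfun b (trajectory f))"
proof -
  obtain sel where sel: "\<And>x. sel x \<in> meas_dominated" "\<And>x t. t \<in> {0..b} \<Longrightarrow> t \<notin> Z \<Longrightarrow> sel x t \<in> F t (apply_bcontfun x t)"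
    using selection_exists by metis
  note dom = meas_dominated_dominated[OF sel(1)]
  define g where "g x = interval_bcontfun b (trajectory (sel x))" for x
  have "\<exists>X c. finite X \<and> (\<forall>z\<in>X. 0 \<le> c z) \<and> sum c X = 1 \<and> (\<forall>z\<in>X. c z > 0 \<longrightarrow> dist (\<Sum>z\<in>X. c z *\<^sub>R g z) z < \<epsilon>)"
  proof (rule Cellina_approximate_fixed_point[OF candidates_convex])
    show gK: "g x \<in> candidates" for x unfolding g_def by (rule trajectory_bcontfun[OF dom])
    show "candidates \<noteq> {}" using gK by blast
    show "\<exists>k. finite k \<and> candidates \<subseteq> (\<Union>c\<in>k. ball c e)" if "e > 0" for e
      using candidates_finite_cover[OF that] unfolding finite_cover_def .
  qed (rule assms)
  then obtain X c where X: "finite X" "\<And>z. z \<in> X \<Longrightarrow> 0 \<le> c z" "sum c X = 1"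
    and close: "\<And>z. z \<in> X \<Longrightarrow> c z > 0 \<Longrightarrow> dist (\<Sum>z\<in>X. c z *\<^sub>R g z) z < \<epsilon>" by blast
  define f where "f s = (\<Sum>z\<in>X. c z *\<^sub>R sel z s)" for s
  have f: "f \<in> meas_dominated" unfolding f_def[abs_def] by (rule meas_dominated_sum[OF X(1,3,2) sel(1)])
  define x where "x = interval_bcontfun b (trajectory f)"
  have x: "(\<Sum>z\<in>X. c z *\<^sub>R g z) = x"
  proof (rule bcontfun_eqI)
    fix t
    have cl: "clamp 0 b t \<in> {0..b}" using b_pos by (intro clamp_Icc) simp
    have "apply_bcontfun (\<Sum>z\<in>X. c z *\<^sub>R g z) t = (\<Sum>z\<in>X. c z *\<^sub>R trajectory (sel z) (clamp 0 b t))"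
      using X(1) by (induction X)
        (auto simp: plus_bcontfun.rep_eq zero_bcontfun.rep_eq scaleR_bcontfun.rep_eq g_def interval_bcontfun_apply[OF trajectory_bcontfun(2)[OF dom]])
    also have "\<dots> = trajectory f (clamp 0 b t)"
      unfolding f_def[abs_def]
      by (rule trajectory_sum[OF X(1,3) dom _ cl, symmetric]) (use meas_dominated_dominated[OF f] in \<open>simp add: f_def[abs_def]\<close>)
    finally show "apply_bcontfun (\<Sum>z\<in>X. c z *\<^sub>R g z) t = apply_bcontfun x t"
      unfolding x_def by (simp add: interval_bcontfun_apply[OF trajectory_bcontfun(2)[OF meas_dominated_dominated[OF f]]])
  qed
  have "f t \<in> convex hull (\<Union>y\<in>ball (x t) \<epsilon>. F t y)" if t: "t \<in> {0..b}" "t \<notin> Z" for t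
  proof -
    let ?Y = "{z \<in> X. c z > 0}"
    have zero: "c z = 0" if "z \<in> X - ?Y" for z using that X(2)[of z] by auto
    have "f t = (\<Sum>z\<in>?Y. c z *\<^sub>R sel z t)"
      unfolding f_def using X(1) zero by (intro sum.mono_neutral_right) auto
    moreover have "sum c ?Y = 1"
    proof -
      have "sum c ?Y = sum c X" by (rule sum.mono_neutral_left) (use X(1) zero in auto)
      then show ?thesis using X(3) by simp
    qed
    moreover have "sel z t \<in> convex hull (\<Union>y\<in>ball (x t) \<epsilon>. F t y)" if z: "z \<in> ?Y" for z
    proof (rule hull_inc)
      have "dist (x t) (apply_bcontfun z t) \<le> dist x z" by (rule dist_bounded)
      also have "\<dots> < \<epsilon>" using close[of z] z unfolding x by simp
      finally show "sel z t \<in> (\<Union>y\<in>ball (x t) \<epsilon>. F t y)" using sel(2)[OF t, of z] by (intro UN_I[of "apply_bcontfun z t"]) simp_all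
    qed
    ultimately show ?thesis
      using convex_sum[of ?Y "convex hull (\<Union>y\<in>ball (x t) \<epsilon>. F t y)" c "\<lambda>z. sel z t"] X(1) by simp
  qed
  then have "f \<in> tube \<epsilon> x" unfolding tube_def using f by blast
  then show ?thesis unfolding x_def by blast
qed

lemma tube_mono:
  assumes f: "f \<in> tube \<epsilon> y" and "dist y x + \<epsilon> \<le> \<delta>"
  shows "f \<in> tube \<delta> x"
proof -
  have "ball (y t) \<epsilon> \<subseteq> ball (x t) \<delta>" for t
  proof
    fix z assume "z \<in> ball (y t) \<epsilon>"
    then show "z \<in> ball (x t) \<delta>"
      using dist_bounded[of y t x] assms(2) dist_triangle3[of "x t" z "y t"] by simp
  qed
  then have "convex hull (\<Union>z\<in>ball (y t) \<epsilon>. F t z) \<subseteq> convex hull (\<Union>z\<in>ball (x t) \<delta>. F t z)" for t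
    by (intro hull_mono) blast
  then show ?thesis using f unfolding tube_def by blast
qed

text \<open>Trajectories of approximate solutions have a limit point \<open>x\<close>. The sets \<open>V k\<close> of forcing terms that are
  approximate along \<open>x\<close> and whose trajectory is within \<open>1 / Suc k\<close> of \<open>x\<close> are convex, nonempty and
  decreasing. The limit of suitable elements has the trajectory \<open>x\<close> by \<open>L\<^sup>1\<close> continuity and selects
  from \<open>F\<close> along \<open>x\<close> by upper semicontinuity.\<close>

lemma exact_solution: "\<exists>f\<in>meas_dominated. AE t in lebesgue_on {0..b}. f t \<in> F t (trajectory f t)"
proof -
  let ?M = "lebesgue_on {0..b}"
  have "\<exists>f. f \<in> tube (1 / real (Suc n)) (interval_bcontfun b (trajectory f))" for n
    by (rule approximate_solution) simp
  then obtain \<phi> where \<phi>: "\<And>n. \<phi> n \<in> tube (1 / real (Suc n)) (interval_bcontfun b (trajectory (\<phi> n)))" by metis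
  define y where "y n = interval_bcontfun b (trajectory (\<phi> n))" for n
  have \<phi>m: "\<phi> n \<in> meas_dominated" for n using \<phi>[of n] unfolding tube_def by blast
  note \<phi>d = meas_dominated_dominated[OF \<phi>m]
  have "compact (closure candidates)"
    unfolding compact_eq_totally_bounded
  proof (intro conjI allI impI)
    show "complete (closure candidates)" by (simp add: complete_eq_closed)
    fix e :: real assume e: "e > 0"
    have "finite_cover (e/2 + e/2) (closure candidates)"
      by (rule finite_cover_near[OF candidates_finite_cover]) (use e closure_approachable[of _ candidates] in \<open>meson half_gt_zero less_imp_le\<close>)+
    then show "\<exists>k. finite k \<and> closure candidates \<subseteq> (\<Union>c\<in>k. ball c e)" unfolding finite_cover_def by simp
  qed
  moreover have "y n \<in> closure candidates" for n
    unfolding y_def using trajectory_bcontfun(1)[OF \<phi>d] closure_subset by blast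
  ultimately obtain x r where r: "strict_mono r" "(y \<circ> r) \<longlonglongrightarrow> x"
    unfolding compact_eq_seq_compact_metric seq_compact_def by metis
  define V where "V k = {f \<in> tube (1 / real (Suc k)) x. \<forall>t\<in>{0..b}. norm (trajectory f t - x t) \<le> 1 / real (Suc k)}" for k
  have ne: "V k \<noteq> {}" for k
  proof -
    define e where "e = 1 / real (Suc k) / 2"
    have e: "e > 0" unfolding e_def by simp
    have "\<forall>\<^sub>F n in sequentially. dist ((y \<circ> r) n) x < e" using r(2) e by (rule tendstoD)
    moreover have "\<forall>\<^sub>F n in sequentially. 1 / real (Suc n) < e"
      using order_tendstoD(2)[OF LIMSEQ_Suc[OF lim_1_over_n] e] .
    ultimately obtain n where n: "dist (y (r n)) x < e" "1 / real (Suc n) < e"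
      by (metis (mono_tags, lifting) comp_apply eventually_conj eventually_happens' sequentially_bot)
    have "1 / real (Suc (r n)) \<le> 1 / real (Suc n)"
      using seq_suble[OF r(1), of n] by (intro divide_left_mono) auto
    moreover have ke: "1 / real (Suc k) = 2 * e" unfolding e_def by (simp del: of_nat_Suc)
    ultimately have "dist (y (r n)) x + 1 / real (Suc (r n)) \<le> 1 / real (Suc k)" using n by linarith
    then have "\<phi> (r n) \<in> tube (1 / real (Suc k)) x" using tube_mono[OF \<phi>[of "r n", folded y_def]] by blast
    moreover have "norm (trajectory (\<phi> (r n)) t - x t) \<le> 1 / real (Suc k)" if t: "t \<in> {0..b}" for t
    proof -
      have "apply_bcontfun (y (r n)) t = trajectory (\<phi> (r n)) t"
        unfolding y_def by (simp add: interval_bcontfun_apply[OF trajectory_bcontfun(2)[OF \<phi>d]] clamp_Icc_id[OF t])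
      then have "norm (trajectory (\<phi> (r n)) t - x t) \<le> dist (y (r n)) x"
        using dist_bounded[of "y (r n)" t x] by (simp add: dist_norm)
      then show ?thesis using n(1) e ke by linarith
    qed
    ultimately show ?thesis unfolding V_def by blast
  qed
  have dec: "decseq V"
  proof (rule decseq_SucI, rule subsetI)
    fix k f assume f: "f \<in> V (Suc k)"
    have le: "1 / real (Suc (Suc k)) \<le> 1 / real (Suc k)" by (intro divide_left_mono) auto
    have f1: "f \<in> tube (1 / real (Suc (Suc k))) x" and f2: "\<And>t. t \<in> {0..b} \<Longrightarrow> norm (trajectory f t - x t) \<le> 1 / real (Suc (Suc k))"
      using f unfolding V_def by blast+
    have "f \<in> tube (1 / real (Suc k)) x" by (rule tube_mono[OF f1]) (use le in simp)
    then show "f \<in> V k" using order_trans[OF f2 le] unfolding V_def by blast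
  qed
  have Vm: "f \<in> meas_dominated" if "f \<in> V k" for f k using that unfolding V_def tube_def by blast
  have mid: "(\<lambda>t. (1/2) *\<^sub>R (f t + g t)) \<in> V k" if fg: "f \<in> V k" "g \<in> V k" for f g k
  proof -
    define p where "p i = (if i then f else g)" for i
    define c where "c i = (1/2::real)" for i :: bool
    have X: "finite (UNIV :: bool set)" "sum c UNIV = 1" "\<And>i. i \<in> UNIV \<Longrightarrow> 0 \<le> c i" unfolding c_def by auto
    have pm: "p i \<in> meas_dominated" for i using Vm[OF fg(1)] Vm[OF fg(2)] unfolding p_def by simp
    have m_eq: "(\<lambda>t. \<Sum>i\<in>UNIV. c i *\<^sub>R p i t) = (\<lambda>t. (1/2) *\<^sub>R (f t + g t))"
      unfolding c_def p_def by (simp add: UNIV_bool scaleR_add_right add.commute)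
    have m: "(\<lambda>t. (1/2) *\<^sub>R (f t + g t)) \<in> meas_dominated"
      unfolding m_eq[symmetric] by (rule meas_dominated_sum[OF X pm])
    have tr: "trajectory (\<lambda>t. (1/2) *\<^sub>R (f t + g t)) t = (1/2) *\<^sub>R (trajectory f t + trajectory g t)" if "t \<in> {0..b}" for t
    proof -
      have "trajectory (\<lambda>t. \<Sum>i\<in>UNIV. c i *\<^sub>R p i t) t = (\<Sum>i\<in>UNIV. c i *\<^sub>R trajectory (p i) t)"
        by (rule trajectory_sum[OF X(1,2) meas_dominated_dominated[OF pm] _ that])
          (use meas_dominated_dominated[OF m] in \<open>simp only: m_eq\<close>)
      then show ?thesis unfolding m_eq unfolding c_def p_def by (simp add: UNIV_bool scaleR_add_right add.commute)
    qed
    have "(1/2) *\<^sub>R (f t + g t) \<in> convex hull (\<Union>z\<in>ball (x t) (1 / real (Suc k)). F t z)" if t: "t \<in> {0..b}" "t \<notin> Z" for t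
    proof -
      have "f t \<in> convex hull (\<Union>z\<in>ball (x t) (1 / real (Suc k)). F t z)" "g t \<in> convex hull (\<Union>z\<in>ball (x t) (1 / real (Suc k)). F t z)"
        using fg t unfolding V_def tube_def by blast+
      then have "(1/2) *\<^sub>R f t + (1/2) *\<^sub>R g t \<in> convex hull (\<Union>z\<in>ball (x t) (1 / real (Suc k)). F t z)"
        by (rule convexD[OF convex_convex_hull]) auto
      then show ?thesis by (simp add: scaleR_add_right)
    qed
    moreover have "norm (trajectory (\<lambda>t. (1/2) *\<^sub>R (f t + g t)) t - x t) \<le> 1 / real (Suc k)" if t: "t \<in> {0..b}" for t
    proof -
      have "trajectory (\<lambda>t. (1/2) *\<^sub>R (f t + g t)) t - x t = (1/2) *\<^sub>R ((trajectory f t - x t) + (trajectory g t - x t))"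
        unfolding tr[OF t] by (simp add: algebra_simps flip: scaleR_add_left)
      then have "2 * norm (trajectory (\<lambda>t. (1/2) *\<^sub>R (f t + g t)) t - x t) \<le> norm (trajectory f t - x t) + norm (trajectory g t - x t)"
        using norm_triangle_ineq[of "trajectory f t - x t" "trajectory g t - x t"] by simp
      also have "\<dots> \<le> 1 / real (Suc k) + 1 / real (Suc k)" using fg t unfolding V_def by (intro add_mono) blast+
      finally show ?thesis by simp
    qed
    ultimately show ?thesis unfolding V_def tube_def using m by blast
  qed
  have "\<exists>h f. (\<forall>k. h k \<in> V k) \<and> strongly_measurable_on {0..b} f \<and> (\<forall>t\<in>{0..b}. norm (f t) \<le> N t) \<and>
    (AE t in ?M. (\<lambda>k. h k t) \<longlonglongrightarrow> f t)"
    by (rule nested_dominated_convex_sets[OF ne dec _ _ mid N]) (use Vm in \<open>auto simp: meas_dominated_def\<close>)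
  then obtain h f where h: "\<And>k. h k \<in> V k" and f: "f \<in> meas_dominated" and lim: "AE t in ?M. (\<lambda>k. h k t) \<longlonglongrightarrow> f t"
    unfolding meas_dominated_def by blast
  note hm = Vm[OF h] and fd = meas_dominated_dominated[OF f]
  note hd = meas_dominated_dominated[OF hm]
  have diffm: "strongly_measurable_on {0..b} (\<lambda>t. f t - h k t)" for k
    using f hm[of k] unfolding meas_dominated_def by (auto intro: strongly_measurable_on_diff)
  have diffb: "norm (f t - h k t) \<le> 2 * N t" if "t \<in> {0..b}" for k t
    using f hm[of k] that norm_triangle_ineq4[of "f t" "h k t"] unfolding meas_dominated_def by fastforce
  have N2: "integrable ?M (\<lambda>t. 2 * N t)" using N by simp
  have meas: "(\<lambda>t. norm (f t - h k t)) \<in> borel_measurable ?M" for k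
    by (rule borel_measurable_norm_strongly_measurable[OF diffm]) simp
  have bd2: "AE t in ?M. norm (norm (f t - h k t)) \<le> 2 * N t" for k by (rule AE_I2) (use diffb in simp)
  have lim0: "AE t in ?M. (\<lambda>k. norm (f t - h k t)) \<longlonglongrightarrow> 0"
    using lim
  proof eventually_elim
    case (elim t)
    show ?case using tendsto_norm[OF tendsto_diff[OF tendsto_const[of "f t"] elim]] by simp
  qed
  have inth: "integrable ?M (\<lambda>t. norm (f t - h k t))" for k
    by (rule integrable_dominated_convergence2[OF _ meas N2 lim0 bd2]) simp
  note hk = has_integral_integral_lebesgue_on[OF inth]
  have "(\<lambda>k. LINT t|?M. norm (f t - h k t)) \<longlonglongrightarrow> (LINT t|?M. 0)"
    by (rule integral_dominated_convergence[OF _ meas N2 lim0 bd2]) simp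
  then have L1: "(\<lambda>k. integral {0..b} (\<lambda>t. norm (f t - h k t))) \<longlonglongrightarrow> 0"
    using integral_unique[OF hk] by simp
  have tr: "trajectory f t = x t" if t: "t \<in> {0..b}" for t
  proof -
    define C where "C = op_bound + op_bound * (b * gain) * (op_bound / a)"
    have "norm (trajectory f t - x t) \<le> C * integral {0..b} (\<lambda>t. norm (f t - h k t)) + 1 / real (Suc k)" for k
    proof -
      have "(\<lambda>t. norm (f t - h k t)) integrable_on {0..b}" using hk[of k] by auto
      then have "norm (trajectory f t - trajectory (h k) t) \<le> C * integral {0..b} (\<lambda>t. norm (f t - h k t))"
        unfolding C_def by (rule trajectory_L1_lipschitz[OF fd hd _ t])
      moreover have "norm (trajectory (h k) t - x t) \<le> 1 / real (Suc k)" using h[of k] t unfolding V_def by blast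
      ultimately show ?thesis using norm_triangle_ineq[of "trajectory f t - trajectory (h k) t" "trajectory (h k) t - x t"] by simp
    qed
    moreover have "(\<lambda>k. C * integral {0..b} (\<lambda>t. norm (f t - h k t)) + 1 / real (Suc k)) \<longlonglongrightarrow> C * 0 + 0"
      by (intro tendsto_intros L1 LIMSEQ_Suc[OF lim_1_over_n])
    ultimately have "norm (trajectory f t - x t) \<le> 0" by (intro LIMSEQ_le_const[of _ 0]) auto
    then show ?thesis by simp
  qed
  have "AE t in ?M. f t \<in> F t (trajectory f t)"
    using lim Z AE_space
  proof eventually_elim
    case (elim t)
    then have t: "t \<in> {0..b}" by simp
    have "h k t \<in> convex hull (\<Union>z\<in>ball (x t) (1 / real (Suc k)). F t z)" for k
      using h[of k] t elim(2) unfolding V_def tube_def by blast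
    then show ?case unfolding tr[OF t] by (rule usc_convex_limit[OF F_values(4,3)[OF t] _ elim(1)])
  qed
  then show ?thesis using f by blast
qed

text \<open>The almost everywhere solution is changed on a null set to a selection at every time.\<close>

lemma steering:
  "\<exists>u x. u \<in> L2_on {0..b} \<and> continuous_on {0..b} x \<and>
     (\<exists>f\<in>selections {0..b} F x. \<forall>t\<in>{0..b}. x t = \<xi> t + integral {0..t} (\<lambda>s. S t s (f s)) + integral {0..t} (\<lambda>s. S t s (B (u s)))) \<and>
     (\<exists>g\<in>dominated_by b N. x b = target - a *\<^sub>R resolvent_op a (Gramian b S B) (target - \<xi> b - volterra g b))"
proof -
  obtain f where f: "f \<in> meas_dominated" and sol: "AE t in lebesgue_on {0..b}. f t \<in> F t (trajectory f t)"
    using exact_solution by blast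
  note fd = meas_dominated_dominated[OF f]
  define x where "x = trajectory f"
  define g where "g t = (if f t \<in> F t (x t) then f t else (SOME v. v \<in> F t (x t)))" for t
  have fg: "AE t in lebesgue_on {0..b}. f t = g t" using sol by eventually_elim (simp add: g_def x_def)
  have "integrable (lebesgue_on {0..b}) (\<lambda>t. norm (g t))"
  proof -
    have fL: "integrable (lebesgue_on {0..b}) (\<lambda>t. norm (f t))" using meas_dominated_L1[OF f] unfolding L1_on_def by blast
    have gm: "strongly_measurable_on {0..b} g" using strongly_measurable_on_AE_eq[OF _ fg] f unfolding meas_dominated_def by blast
    show ?thesis
      by (rule integrable_cong_AE_imp[OF fL borel_measurable_norm_strongly_measurable[OF gm]])
        (use fg in \<open>auto elim: eventually_mono\<close>)
  qed
  then have "g \<in> L1_on {0..b}"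
    using strongly_measurable_on_AE_eq[OF _ fg] f unfolding meas_dominated_def L1_on_def by blast
  moreover have "g t \<in> F t (x t)" if "t \<in> {0..b}" for t
    unfolding g_def using F_values(1)[OF that, of "x t"] by (auto intro: someI)
  ultimately have g: "g \<in> selections {0..b} F x" unfolding selections_def by blast
  have "negligible {t \<in> {0..b}. f t \<noteq> g t}"
  proof -
    interpret complete_measure "lebesgue_on {0..b}" by (rule complete_measure_lebesgue_on) simp
    have "{t \<in> {0..b}. f t \<noteq> g t} \<in> null_sets (lebesgue_on {0..b})" using fg unfolding AE_iff_null_sets by simp
    then show ?thesis by (simp add: negligible_iff_null_sets null_sets_restrict_space)
  qed
  then have "integral {0..t} (\<lambda>s. S t s (f s)) = integral {0..t} (\<lambda>s. S t s (g s))" if "t \<in> {0..b}" for t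
    by (rule integral_spike) (use that in auto)
  then have "x t = \<xi> t + integral {0..t} (\<lambda>s. S t s (g s)) + integral {0..t} (\<lambda>s. S t s (B (control (steer f) s)))" if "t \<in> {0..b}" for t
    unfolding x_def trajectory_split[OF fd that] volterra_def using that by simp
  moreover have "x b = target - a *\<^sub>R resolvent_op a (Gramian b S B) (target - \<xi> b - volterra f b)"
    unfolding x_def trajectory_end[OF fd] steer_def defect_def gramian_apply ..
  moreover have "continuous_on {0..b} x" unfolding x_def by (rule trajectory_bcontfun(2)[OF fd])
  ultimately show ?thesis using control_L2[of "steer f"] g fd by blast
qed

end

text \<open>For all \<open>a\<close> the defects lie in the same totally bounded set. On a finite net of it \<open>a R(a)\<close> is small
  for small \<open>a\<close>, and the uniform bound of \<open>a R(a)\<close> extends this to the whole set.\<close>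

lemma approximate_steering:
  assumes res: "\<And>v. ((\<lambda>a. a *\<^sub>R resolvent_op a (Gramian b S B) v) \<longlongrightarrow> 0) (at_right 0)" and "\<epsilon> > 0"
  shows "\<exists>u x. u \<in> L2_on {0..b} \<and> continuous_on {0..b} x \<and>
     (\<exists>f\<in>selections {0..b} F x. \<forall>t\<in>{0..b}. x t = \<xi> t + integral {0..t} (\<lambda>s. S t s (f s)) + integral {0..t} (\<lambda>s. S t s (B (u s)))) \<and>
     dist (x b) target < \<epsilon>"
proof -
  have "finite_cover (\<epsilon>/2) ((\<lambda>f. interval_bcontfun b (volterra f)) ` dominated_by b N)"
    by (rule volterra_range_finite_cover[OF N_integrable_on N_nonneg]) (use \<open>\<epsilon> > 0\<close> in auto)
  then obtain k where k: "finite k" "(\<lambda>f. interval_bcontfun b (volterra f)) ` dominated_by b N \<subseteq> (\<Union>c\<in>k. ball c (\<epsilon>/2))"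
    unfolding finite_cover_def by blast
  define p where "p c = target - \<xi> b - apply_bcontfun c b" for c
  have "\<forall>\<^sub>F a in at_right 0. \<forall>c\<in>k. dist (a *\<^sub>R resolvent_op a (Gramian b S B) (p c)) 0 < \<epsilon>/2"
    using k(1) by (intro eventually_ball_finite ballI tendstoD[OF res]) (use \<open>\<epsilon> > 0\<close> in auto)
  then obtain a0 where a0: "a0 > 0" "\<And>a. a > 0 \<Longrightarrow> a < a0 \<Longrightarrow> \<forall>c\<in>k. dist (a *\<^sub>R resolvent_op a (Gramian b S B) (p c)) 0 < \<epsilon>/2"
    unfolding eventually_at_right_field by auto
  define a where "a = a0 / 2"
  have a: "a > 0" "a < a0" unfolding a_def using a0(1) by auto
  interpret R: bounded_linear "resolvent_op a (Gramian b S B)"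
    using bounded_linear_resolvent[OF a(1)] unfolding gramian_apply .
  obtain u x g where ux: "u \<in> L2_on {0..b}" "continuous_on {0..b} x"
     "\<exists>f\<in>selections {0..b} F x. \<forall>t\<in>{0..b}. x t = \<xi> t + integral {0..t} (\<lambda>s. S t s (f s)) + integral {0..t} (\<lambda>s. S t s (B (u s)))"
    and g: "g \<in> dominated_by b N" "x b = target - a *\<^sub>R resolvent_op a (Gramian b S B) (target - \<xi> b - volterra g b)"
    using steering[OF a(1), of target] by blast
  define q where "q = target - \<xi> b - volterra g b"
  have "interval_bcontfun b (volterra g) \<in> (\<Union>c\<in>k. ball c (\<epsilon>/2))" using k(2) g(1) by blast
  then obtain c where c: "c \<in> k" "dist c (interval_bcontfun b (volterra g)) < \<epsilon>/2" by auto
  have "norm (q - p c) \<le> dist c (interval_bcontfun b (volterra g))"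
    using dist_bounded[of c b "interval_bcontfun b (volterra g)"]
    by (simp add: interval_bcontfun_apply[OF continuous_on_volterra[OF g(1) N_integrable_on]] clamp_Icc_id[OF b_mem] q_def p_def dist_norm)
  then have "norm (a *\<^sub>R resolvent_op a (Gramian b S B) (q - p c)) < \<epsilon>/2"
    using norm_scaled_resolvent_le[OF a(1), of "q - p c"] c(2) unfolding gramian_apply by linarith
  moreover have "norm (a *\<^sub>R resolvent_op a (Gramian b S B) (p c)) < \<epsilon>/2" using a0(2)[OF a] c(1) by simp
  moreover have "a *\<^sub>R resolvent_op a (Gramian b S B) q = a *\<^sub>R resolvent_op a (Gramian b S B) (q - p c) + a *\<^sub>R resolvent_op a (Gramian b S B) (p c)"
    by (simp add: R.diff scaleR_diff_right)
  ultimately have "norm (a *\<^sub>R resolvent_op a (Gramian b S B) q) < \<epsilon>"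
    using norm_triangle_ineq[of "a *\<^sub>R resolvent_op a (Gramian b S B) (q - p c)" "a *\<^sub>R resolvent_op a (Gramian b S B) (p c)"] by simp
  then have "dist (x b) target < \<epsilon>" unfolding g(2) q_def[symmetric] by (simp add: dist_norm)
  then show ?thesis using ux by blast
qed

end

section \<open>Approximate controllability\<close>

theorem theorem10:
  fixes b \<gamma> :: real
    and A :: "'x::{real_inner,banach} \<Rightarrow> 'x" and D :: "'x set"
    and C0 :: "real \<Rightarrow> 'x \<Rightarrow>\<^sub>L 'x"
    and Bt :: "real \<Rightarrow> 'x \<Rightarrow> 'x"
    and S :: "real \<Rightarrow> real \<Rightarrow> 'x \<Rightarrow>\<^sub>L 'x"
    and B :: "'u::{real_inner,banach} \<Rightarrow>\<^sub>L 'x"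
    and F :: "real \<Rightarrow> 'x \<Rightarrow> 'x set"
    and x0 y0 :: 'x
    and L :: "real \<Rightarrow> real \<Rightarrow> real" and N :: "real \<Rightarrow> real"
  assumes "b > 0"
    and "generates_cosine A D C0"
    and "closure D = UNIV"
    and "admissible_perturbation A C0 Bt"
    and "\<forall>t\<in>{0..b}. closed_operator D (A_pert A Bt t)"
    and "associated_evolution {0..b} A C0 Bt S"
    and "evolution_Z1 {0..b} S"
    and "evolution_Z2 {0..b} D (A_pert A Bt) S"
    and "evolution_Z3 {0..b} D (A_pert A Bt) S"
    and "admissible_multimap {0..b} F"
    and "\<forall>x. ((\<lambda>a. a *\<^sub>R resolvent_op a (Gramian b S B) x) \<longlongrightarrow> 0) (at_right 0)"
    and "\<forall>t>0. compact_operator (sine_family C0 t)"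
    and "\<forall>r>0. integrable (lebesgue_on {0..b}) (L r) \<and> (\<forall>t\<in>{0..b}. 0 \<le> L r t)"
    and "\<forall>r>0. \<forall>x. continuous_on {0..b} x \<and> (SUP t\<in>{0..b}. norm (x t)) \<le> r \<longrightarrow>
           (AE t in lebesgue_on {0..b}. (SUP f\<in>F t (x t). norm f) \<le> L r t)"
    and "\<gamma> > 0"
    and "((\<lambda>r. (1 / r) * (LINT s|lebesgue_on {0..b}. L r s)) \<longlongrightarrow> \<gamma>) at_top"
    and "integrable (lebesgue_on {0..b}) N" and "\<forall>t\<in>{0..b}. 0 \<le> N t"
    and "AE t in lebesgue_on {0..b}. \<forall>x. (SUP f\<in>F t x. norm f) \<le> N t"
  shows "approximately_controllable b S B F x0 y0"
proof -
  interpret perturbed_cosine C0 A D Bt S b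
    by unfold_locales (use assms(2,4,6) in \<open>auto simp: generates_cosine_def\<close>)
  obtain M where M: "M \<ge> 0" "\<And>t s t' s'. t \<in> {0..b} \<Longrightarrow> s \<in> {0..b} \<Longrightarrow> t' \<in> {0..b} \<Longrightarrow> s' \<in> {0..b}
      \<Longrightarrow> norm (S t s - S t' s') \<le> M * (\<bar>t - t'\<bar> + \<bar>s - s'\<bar>)"
    using evolution_lipschitz[OF assms(7,1)] by blast
  define \<xi> where "\<xi> t = C_evol {0..b} S t 0 x0 + S t 0 y0" for t
  define Z where "Z = {t. \<not> (\<forall>x. (SUP f\<in>F t x. norm f) \<le> N t)}"
  interpret evo: compact_evolution b S M
    by unfold_locales (use assms(1) M compact_operator_S[OF assms(12,3)] in auto)
  have \<xi>: "continuous_on {0..b} \<xi>"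
  proof -
    have "continuous_on ({0..b} \<times> {0..b}) (\<lambda>(t, s). pd2 {0..b} (\<lambda>t s. S t s x0) t s)"
      using assms(7) unfolding evolution_Z1_def class_C1_def by blast
    moreover have "continuous_on {0..b} (\<lambda>t. (t, 0::real))" by (intro continuous_intros)
    moreover have "(\<lambda>t. (t, 0::real)) ` {0..b} \<subseteq> {0..b} \<times> {0..b}" using assms(1) by auto
    ultimately have "continuous_on {0..b} (\<lambda>t. case (t, 0) of (t, s) \<Rightarrow> pd2 {0..b} (\<lambda>t s. S t s x0) t s)"
      by (rule continuous_on_compose2)
    then have "continuous_on {0..b} (\<lambda>t. pd2 {0..b} (\<lambda>t s. S t s x0) t 0)" by simp
    moreover have "continuous_on {0..b} (\<lambda>t. S t 0)"
      by (rule lipschitz_on_continuous_on[OF lipschitz_onI[OF _ M(1)]])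
        (use M(2)[of _ 0 _ 0] assms(1) in \<open>auto simp: dist_norm\<close>)
    ultimately show ?thesis unfolding \<xi>_def[abs_def] C_evol_def by (intro continuous_intros)
  qed
  have F_bdd: "norm v \<le> N t" if "t \<in> {0..b}" "t \<notin> Z" "v \<in> F t x" for t x v
  proof -
    have "bounded (F t x)" using assms(10) that(1) unfolding admissible_multimap_def by blast
    then have "bdd_above (norm ` F t x)" by (intro bounded_imp_bdd_above) (simp add: bounded_norm_comp)
    then have "norm v \<le> (SUP f\<in>F t x. norm f)" using that(3) by (intro cSUP_upper)
    also have "\<dots> \<le> N t" using that(2) unfolding Z_def by blast
    finally show ?thesis .
  qed
  interpret inc: controlled_inclusion b S M B F N \<xi> Z
    by unfold_locales (use assms(10,17-19) \<xi> F_bdd in \<open>auto simp: Z_def\<close>)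
  have "target \<in> closure (reachable_set b S B F x0 y0)" for target
    unfolding closure_approachable
  proof (intro allI impI)
    fix \<epsilon> :: real assume "\<epsilon> > 0"
    then obtain u x where "u \<in> L2_on {0..b}" "continuous_on {0..b} x" "dist (x b) target < \<epsilon>"
      "\<exists>f\<in>selections {0..b} F x. \<forall>t\<in>{0..b}. x t = \<xi> t + integral {0..t} (\<lambda>s. S t s (f s)) + integral {0..t} (\<lambda>s. S t s (B (u s)))"
      using inc.approximate_steering[OF assms(11)[rule_format], of \<epsilon> target] by blast
    then show "\<exists>y\<in>reachable_set b S B F x0 y0. dist y target < \<epsilon>"
      unfolding reachable_set_def mild_solution_def \<xi>_def by blast
  qed
  then show ?thesis unfolding approximately_controllable_def by blast
qed

end
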